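(* Let $\gamma\in[1,4]$ and $s>3/2$, and let $$\beta_\gamma=\sqrt{-\frac12+\frac3\gamma-\frac{\sqrt{12-3\gamma}}{2\sqrt\gamma}}\,.$$ Let $u\in C([0,+\infty),H^s(\mathbb{R}))\cap C^1([0,+\infty),H^{s-1}(\mathbb{R}))$ be a global solution of the rod equation on $\mathbb{R}$ with parameter $\gamma$. (i) For every $t\ge0$, either $u(t,x)>0$ for all $x\in\mathbb{R}$, or $u(t,x)<0$ for all $x\in\mathbb{R}$, or there exists $x_t\in\mathbb{R}$ such that $u(t,\cdot)\le0$ in $(-\infty,x_t]$ and $u(t,\cdot)\ge0$ in $[x_t,+\infty)$. In the latter case, if $x\mapsto u(t,x)$ vanishes at two distinct points of the real line, then it vanishes in the whole interval between them. (ii) If, at some time $t_0\ge0$, $$\liminf_{x\to+\infty}e^{\beta_\gamma x}u(t_0,x)\le0\quad\text{and}\quad\limsup_{x\to-\infty}e^{-\beta_\gamma x}u(t_0,x)\ge0,$$ then $u$ is the identically zero solution. In particular, if $u_0\in H^s(\mathbb{R})$, $u_0\not\equiv0$, is such that $u_0(x)=o(e^{-\beta_\gamma|x|})$ as $|x|\to\infty$, then the corresponding solution of the rod equation on $\mathbb{R}$ with parameter $\gamma$ must blow up in finite time.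
   Context: The rod equation on $\mathbb{R}$ with parameter $\gamma$ is $$u_t+\gamma uu_x=-\partial_x p*\Bigl(\tfrac{3-\gamma}{2}u^2+\tfrac{\gamma}{2}u_x^2\Bigr),\quad x\in\mathbb{R},\qquad u(0,x)=u_0(x),$$ where $p(x)=\frac12e^{-|x|}$ is the kernel of $(1-\partial_x^2)^{-1}$ on $\mathbb{R}$ and $*$ is convolution on $\mathbb{R}$. For $u_0\in H^s(\mathbb{R})$, $s>3/2$, there are a maximal time $0<T^*\le\infty$ and a unique solution in $C([0,T^* ),H^s(\mathbb{R}))\cap C^1([0,T^* ),H^{s-1}(\mathbb{R}))$; "blows up in finite time" means $T^*<\infty$. *)

theory Defs
  imports "HOL-Analysis.Analysis" "HOL-Library.Landau_Symbols"
begin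

definition square_integrable :: "(real \<Rightarrow> 'a::{real_normed_vector, second_countable_topology, banach}) \<Rightarrow> bool"
  where "square_integrable f \<longleftrightarrow>
    f \<in> borel_measurable lborel \<and> integrable lborel (\<lambda>x. (norm (f x))\<^sup>2)"

definition truncated_fourier :: "(real \<Rightarrow> real) \<Rightarrow> real \<Rightarrow> real \<Rightarrow> complex"
  where "truncated_fourier f R \<xi> = (LINT x:{-R..R}|lborel. cis (-(\<xi> * x)) * complex_of_real (f x))"

text \<open>
  The Fourier--Plancherel transform of \<open>f\<close> in \<open>L\<^sup>2\<close>, as the \<open>L\<^sup>2\<close> limit of the truncated
  Fourier integrals. It is unique only up to null sets, hence the relational form.
\<close>

definition is_L2_fourier :: "(real \<Rightarrow> real) \<Rightarrow> (real \<Rightarrow> complex) \<Rightarrow> bool"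
  where "is_L2_fourier f g \<longleftrightarrow> square_integrable g \<and>
    (\<lambda>n::nat. \<integral>\<^sup>+\<xi>. ennreal ((cmod (truncated_fourier f (real n) \<xi> - g \<xi>))\<^sup>2) \<partial>lborel)
      \<longlonglongrightarrow> 0"

text \<open>
  Real-valued \<open>H\<^sup>s(\<real>)\<close> for \<open>s \<ge> 0\<close>, the only range used below. Elements are functions, not
  classes modulo almost everywhere equality. The norm does not depend on the choice of the
  representative of the Fourier transform.
\<close>

definition sobolev_space :: "real \<Rightarrow> (real \<Rightarrow> real) set"
  where "sobolev_space s = {f. square_integrable f \<and>
    (\<exists>g. is_L2_fourier f g \<and> integrable lborel (\<lambda>\<xi>. (1 + \<xi>\<^sup>2) powr s * (cmod (g \<xi>))\<^sup>2))}"

definition sobolev_norm :: "real \<Rightarrow> (real \<Rightarrow> real) \<Rightarrow> real"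
  where "sobolev_norm s f =
    sqrt (LINT \<xi>|lborel. (1 + \<xi>\<^sup>2) powr s * (cmod ((SOME g. is_L2_fourier f g) \<xi>))\<^sup>2)"

definition C0_sobolev :: "real set \<Rightarrow> real \<Rightarrow> (real \<Rightarrow> real \<Rightarrow> real) \<Rightarrow> bool"
  where "C0_sobolev I s u \<longleftrightarrow> (\<forall>t\<in>I. u t \<in> sobolev_space s \<and>
    ((\<lambda>\<tau>. sobolev_norm s (\<lambda>x. u \<tau> x - u t x)) \<longlongrightarrow> 0) (at t within I))"

definition has_sobolev_time_derivative ::
    "real set \<Rightarrow> real \<Rightarrow> (real \<Rightarrow> real \<Rightarrow> real) \<Rightarrow> (real \<Rightarrow> real \<Rightarrow> real) \<Rightarrow> bool"
  where "has_sobolev_time_derivative I s u v \<longleftrightarrow>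
    (\<forall>t\<in>I. u t \<in> sobolev_space s \<and> v t \<in> sobolev_space s \<and>
      ((\<lambda>\<tau>. sobolev_norm s (\<lambda>x. (u \<tau> x - u t x) / (\<tau> - t) - v t x)) \<longlongrightarrow> 0) (at t within I))"

definition convolution :: "(real \<Rightarrow> real) \<Rightarrow> (real \<Rightarrow> real) \<Rightarrow> real \<Rightarrow> real"
  where "convolution f g x = (LINT y|lborel. f (x - y) * g y)"

definition rod_kernel :: "real \<Rightarrow> real"
  where "rod_kernel x = exp (- \<bar>x\<bar>) / 2"

definition time_interval :: "ereal \<Rightarrow> real set"
  where "time_interval T = {t. 0 \<le> t \<and> ereal t < T}"

text \<open>
  Solutions in \<open>C([0,T), H\<^sup>s) \<inter> C\<^sup>1([0,T), H\<^sup>s\<^sup>-\<^sup>1)\<close> with \<open>s > 3/2\<close> and \<open>T \<le> \<infinity>\<close>. Each \<open>u t\<close> is taken to be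
  the continuous representative of its class; it is then continuously differentiable by Sobolev
  embedding, so that \<open>deriv (u t)\<close> is the classical derivative. The time derivative \<open>v\<close> is an
  element of \<open>H\<^sup>s\<^sup>-\<^sup>1\<close>, where the equation is an identity almost everywhere in space.
\<close>

definition rod_solution :: "real \<Rightarrow> real \<Rightarrow> ereal \<Rightarrow> (real \<Rightarrow> real \<Rightarrow> real) \<Rightarrow> bool"
  where "rod_solution \<gamma> s T u \<longleftrightarrow>
    C0_sobolev (time_interval T) s u \<and>
    (\<forall>t\<in>time_interval T. continuous_on UNIV (u t)) \<and>
    (\<exists>v. C0_sobolev (time_interval T) (s - 1) v \<and>
      has_sobolev_time_derivative (time_interval T) (s - 1) u v \<and>
      (\<forall>t\<in>time_interval T. AE x in lborel.
        v t x + \<gamma> * u t x * deriv (u t) x =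
        - deriv (convolution rod_kernel
            (\<lambda>y. (3 - \<gamma>) / 2 * (u t y)\<^sup>2 + \<gamma> / 2 * (deriv (u t) y)\<^sup>2)) x))"

text \<open>
  \<open>u\<close> is the maximal solution with datum \<open>u0\<close> (attained as an element of \<open>H\<^sup>s\<close>) and \<open>T\<close> its
  maximal time: no solution extends \<open>u\<close> beyond \<open>T\<close>.
\<close>

definition rod_maximal_solution ::
    "real \<Rightarrow> real \<Rightarrow> (real \<Rightarrow> real) \<Rightarrow> ereal \<Rightarrow> (real \<Rightarrow> real \<Rightarrow> real) \<Rightarrow> bool"
  where "rod_maximal_solution \<gamma> s u0 T u \<longleftrightarrow>
    0 < T \<and> rod_solution \<gamma> s T u \<and> (AE x in lborel. u 0 x = u0 x) \<and>
    (\<forall>T' w. rod_solution \<gamma> s T' w \<and> T \<le> T' \<and> (\<forall>t\<in>time_interval T. w t = u t) \<longrightarrow> T' = T)"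

definition rod_beta :: "real \<Rightarrow> real"
  where "rod_beta \<gamma> = sqrt (- 1 / 2 + 3 / \<gamma> - sqrt (12 - 3 * \<gamma>) / (2 * sqrt \<gamma>))"

end

theory Submission
  imports "HOL-Probability.Characteristic_Functions" Defs
begin

text \<open>
  Sobolev embedding makes a global solution classical: \<open>u t\<close> is \<open>C\<^sup>1\<close> in space and differentiable in
  time uniformly in space. Along a characteristic \<open>q' = \<gamma> u(t, q)\<close>, writing \<open>p * source = Pl + Pr\<close> for the
  contributions of the two half-lines,
  \<open>u' = Pl - Pr\<close> and \<open>ux' = source - Pl - Pr - \<gamma> ux\<^sup>2\<close>.
  The number \<open>b\<close> with \<open>b\<^sup>2 + b = (3 - \<gamma>) / \<gamma>\<close> satisfies \<open>\<bar>b\<bar> = \<beta>\<close>, and completing a square gives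
  \<open>Pl, Pr \<ge> \<gamma>/4 b u\<^sup>2\<close>. Since \<open>\<beta> \<le> 1\<close>, the quantities \<open>A = \<beta> u - ux\<close> and \<open>B = \<beta> u + ux\<close> then satisfy
  \<open>A' \<ge> - \<gamma>/2 A B\<close> and \<open>B' \<le> \<gamma>/2 A B\<close>, which is incompatible with \<open>A > 0 > B\<close> on an unbounded time
  interval. So a global solution has \<open>ux \<ge> - \<beta> \<bar>u\<bar>\<close> everywhere: \<open>exp (\<beta> x) u\<close> increases to the right of a
  point where \<open>u > 0\<close>, and \<open>exp (- \<beta> x) u\<close> increases up to a point where \<open>u < 0\<close>. Finally, the equations
  along characteristics and a Gronwall argument show that a solution vanishing at one time is zero.
\<close>

section \<open>Sobolev spaces and the Plancherel transform\<close>

text \<open>The exponent comes from the square. The derivative of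
  \<open>exp x * (Pl - c * u^2)\<close> is \<open>exp x\<close> times
  \<open>source / 2 - c * (u^2 + 2 * u * ux)\<close>; for \<open>c = \<gamma> * b / 4\<close> the
  latter factor is \<open>\<gamma> / 4\<close> times a perfect square exactly when \<open>b\<close>
  solves the quadratic equation above, and letting the left end go to minus infinity gives the
  bound. The number \<open>b\<close> is negative for \<open>\<gamma> > 3\<close>, so the bounds
  themselves may be negative; in the inequalities for \<open>A\<close> and \<open>B\<close> the
  terms linear in \<open>b\<close> cancel and only \<open>b^2 = \<beta>^2\<close> survives.
  \<open>Pl\<close> and \<open>Pr\<close> must be bounded separately because they enter with the
  weights \<open>1 + \<beta>\<close> and \<open>1 - \<beta>\<close>, which have to be nonnegative.
  The other obstacles concern regularity. Membership in \<open>H^s\<close> is expressed by L^2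
  limits of truncated Fourier integrals, so uniform bounds in space require a pointwise inversion
  formula. The equation holds only almost everywhere, so the time derivative is first replaced by a
  continuous representative. Vanishing must be carried to earlier as well as later times, hence
  estimates symmetric in \<open>t - t0\<close>.\<close>

lemma Cauchy_Schwarz_lebesgue_integral:
  fixes f g :: "'a \<Rightarrow> real"
  assumes [measurable]: "f \<in> borel_measurable M" "g \<in> borel_measurable M"
    and f: "integrable M (\<lambda>x. (f x)\<^sup>2)" and g: "integrable M (\<lambda>x. (g x)\<^sup>2)"
  shows "integrable M (\<lambda>x. \<bar>f x * g x\<bar>)"
    and "(\<integral>x. \<bar>f x * g x\<bar> \<partial>M) \<le> sqrt (\<integral>x. (f x)\<^sup>2 \<partial>M) * sqrt (\<integral>x. (g x)\<^sup>2 \<partial>M)"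
proof -
  show fg: "integrable M (\<lambda>x. \<bar>f x * g x\<bar>)"
  proof (rule Bochner_Integration.integrable_bound[of M "\<lambda>x. (f x)\<^sup>2 + (g x)\<^sup>2"])
    have "\<bar>a * b\<bar> \<le> a\<^sup>2 + b\<^sup>2" for a b :: real
    proof -
      have "2 * \<bar>a * b\<bar> \<le> a\<^sup>2 + b\<^sup>2"
        using sum_squares_bound[of "\<bar>a\<bar>" "\<bar>b\<bar>"] by (simp add: abs_mult mult.assoc)
      then show ?thesis by linarith
    qed
    then show "AE x in M. norm \<bar>f x * g x\<bar> \<le> norm ((f x)\<^sup>2 + (g x)\<^sup>2)" by simp
  qed (use f g in auto)
  define a b c where "a = (\<integral>x. (f x)\<^sup>2 \<partial>M)" and "b = (\<integral>x. (g x)\<^sup>2 \<partial>M)" and "c = (\<integral>x. \<bar>f x * g x\<bar> \<partial>M)"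
  have a0: "0 \<le> a" and b0: "0 \<le> b" and c0: "0 \<le> c"
    unfolding a_def b_def c_def by (auto intro!: integral_nonneg_AE)
  \<comment> \<open>The integral of \<open>(\<bar>f\<bar> - t * \<bar>g\<bar>)^2\<close> is
    nonnegative for every \<open>t\<close>. The minimizer \<open>t = c / b\<close> gives
    \<open>c^2 \<le> a * b\<close>; if \<open>b = 0\<close> the expression is affine in
    \<open>t\<close>, and \<open>t = (a + 1) / c\<close> would make it negative.\<close>
  have q: "0 \<le> a - 2 * t * c + t\<^sup>2 * b" for t
  proof -
    have "0 \<le> (\<integral>x. (\<bar>f x\<bar> - t * \<bar>g x\<bar>)\<^sup>2 \<partial>M)" by (auto intro!: integral_nonneg_AE)
    also have "\<dots> = (\<integral>x. (f x)\<^sup>2 - 2 * t * \<bar>f x * g x\<bar> + t\<^sup>2 * (g x)\<^sup>2 \<partial>M)"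
      by (intro Bochner_Integration.integral_cong) (auto simp: power2_eq_square algebra_simps abs_mult)
    also have "\<dots> = a - 2 * t * c + t\<^sup>2 * b"
      unfolding a_def b_def c_def using f g fg by simp
    finally show ?thesis .
  qed
  have "c\<^sup>2 \<le> a * b"
  proof (cases "b = 0")
    case True
    have "c = 0"
    proof (rule ccontr)
      assume "c \<noteq> 0"
      then have "a - 2 * ((a + 1) / c) * c = - a - 2" by (simp add: field_simps)
      with q[of "(a + 1) / c"] True a0 show False by simp
    qed
    with True show ?thesis by simp
  next
    case False
    with b0 have b: "b > 0" by simp
    have "a - 2 * (c / b) * c + (c / b)\<^sup>2 * b = (a * b - c\<^sup>2) / b"
      using b by (simp add: field_simps power2_eq_square)
    with q[of "c / b"] b show ?thesis by (simp add: zero_le_divide_iff)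
  qed
  then have "c \<le> sqrt (a * b)" by (rule real_le_rsqrt)
  then show "(\<integral>x. \<bar>f x * g x\<bar> \<partial>M) \<le> sqrt (\<integral>x. (f x)\<^sup>2 \<partial>M) * sqrt (\<integral>x. (g x)\<^sup>2 \<partial>M)"
    by (simp add: a_def b_def c_def real_sqrt_mult)
qed

lemma cmod_add_square_le: "(cmod (a + b))\<^sup>2 \<le> 2 * (cmod a)\<^sup>2 + 2 * (cmod b)\<^sup>2"
proof -
  have "(cmod (a + b))\<^sup>2 \<le> (cmod a + cmod b)\<^sup>2" by (intro power_mono norm_triangle_ineq) simp
  also have "\<dots> \<le> 2 * (cmod a)\<^sup>2 + 2 * (cmod b)\<^sup>2"
    using sum_squares_bound[of "cmod a" "cmod b"] by (simp add: power2_sum)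
  finally show ?thesis .
qed

lemma borel_measurable_cis [measurable]: "cis \<in> borel_measurable borel"
  by (intro borel_measurable_continuous_onI continuous_intros)

lemma borel_measurable_truncated_fourier [measurable]:
  assumes [measurable]: "f \<in> borel_measurable lborel"
  shows "truncated_fourier f R \<in> borel_measurable lborel"
proof -
  have "(\<lambda>\<xi>. LINT x|lborel. indicator {-R..R} x *\<^sub>R (cis (-(\<xi> * x)) * complex_of_real (f x))) \<in> borel_measurable lborel"
    by measurable
  then show ?thesis by (simp add: truncated_fourier_def[abs_def] set_lebesgue_integral_def)
qed

lemma square_integrable_imp_set_integrable:
  fixes f :: "real \<Rightarrow> real"
  assumes "square_integrable f"
  shows "set_integrable lborel {a..b} f"
proof -
  have [measurable]: "f \<in> borel_measurable lborel" and f: "integrable lborel (\<lambda>x. (f x)\<^sup>2)"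
    using assms by (auto simp: square_integrable_def)
  have i: "integrable lborel (\<lambda>x::real. indicator {a..b} x :: real)"
    by (rule integrable_real_indicator) (auto simp: emeasure_lborel_Icc_eq)
  show ?thesis unfolding set_integrable_def
  proof (rule Bochner_Integration.integrable_bound[of lborel "\<lambda>x. indicator {a..b} x + (f x)\<^sup>2"])
    have "\<bar>t\<bar> \<le> 1 + t\<^sup>2" for t :: real
      using sum_squares_bound[of "\<bar>t\<bar>" 1] by simp
    then show "AE x in lborel. norm (indicator {a..b} x *\<^sub>R f x) \<le> norm (indicator {a..b} x + (f x)\<^sup>2)"
      by (auto simp: indicator_def)
  qed (use f i in auto)
qed

lemma set_integrable_truncated_fourier:
  assumes "square_integrable f"
  shows "set_integrable lborel {a..b} (\<lambda>x. cis (-(\<xi> * x)) * complex_of_real (f x))"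
proof -
  have [measurable]: "f \<in> borel_measurable lborel"
    using assms by (auto simp: square_integrable_def)
  show ?thesis
    using square_integrable_imp_set_integrable[OF assms, of a b]
    unfolding set_integrable_def
    by (rule Bochner_Integration.integrable_bound) (auto simp: norm_mult)
qed

lemma truncated_fourier_diff:
  assumes "square_integrable f" "square_integrable h"
  shows "truncated_fourier (\<lambda>x. f x - h x) R \<xi> = truncated_fourier f R \<xi> - truncated_fourier h R \<xi>"
  unfolding truncated_fourier_def
  by (subst set_integral_diff(2)[symmetric])
    (auto intro!: set_integrable_truncated_fourier assms simp: right_diff_distrib)

lemma truncated_fourier_scale:
  "truncated_fourier (\<lambda>x. c * f x) R \<xi> = complex_of_real c * truncated_fourier f R \<xi>"
  unfolding truncated_fourier_def set_lebesgue_integral_def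
  by (subst integral_mult_right_zero[symmetric]) (simp add: mult_ac scaleR_conv_of_real)

lemma truncated_fourier_cong_AE:
  assumes [measurable]: "f \<in> borel_measurable lborel" "h \<in> borel_measurable lborel"
    and "AE x in lborel. f x = h x"
  shows "truncated_fourier f R \<xi> = truncated_fourier h R \<xi>"
proof -
  show ?thesis
    unfolding truncated_fourier_def set_lebesgue_integral_def
    using assms(3) by (intro integral_cong_AE) auto
qed

lemma square_integrable_diff:
  assumes "square_integrable f" "square_integrable g"
  shows "square_integrable (\<lambda>x. f x - g x :: complex)"
proof -
  have [measurable]: "f \<in> borel_measurable lborel" "g \<in> borel_measurable lborel"
    using assms by (auto simp: square_integrable_def)
  have "integrable lborel (\<lambda>x. (cmod (f x - g x))\<^sup>2)"
  proof (rule Bochner_Integration.integrable_bound)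
    show "integrable lborel (\<lambda>x. 2 * (cmod (f x))\<^sup>2 + 2 * (cmod (g x))\<^sup>2)"
      using assms by (auto simp: square_integrable_def)
    show "AE x in lborel. norm ((cmod (f x - g x))\<^sup>2) \<le> norm (2 * (cmod (f x))\<^sup>2 + 2 * (cmod (g x))\<^sup>2)"
      using cmod_add_square_le[of "f _" "- g _"] by auto
  qed measurable
  then show ?thesis by (auto simp: square_integrable_def)
qed

lemma square_integrable_real_diff:
  assumes "square_integrable f" "square_integrable g"
  shows "square_integrable (\<lambda>x. f x - g x :: real)"
proof -
  have [measurable]: "f \<in> borel_measurable lborel" "g \<in> borel_measurable lborel"
    using assms by (auto simp: square_integrable_def)
  have "square_integrable (\<lambda>x. complex_of_real (f x) - complex_of_real (g x))"
    using assms by (intro square_integrable_diff) (auto simp: square_integrable_def)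
  then show ?thesis by (auto simp: square_integrable_def simp flip: of_real_diff)
qed

lemma nn_integral_cmod_add_square_le:
  assumes [measurable]: "f \<in> borel_measurable M" "g \<in> borel_measurable M"
  shows "(\<integral>\<^sup>+x. ennreal ((cmod (f x + g x))\<^sup>2) \<partial>M)
    \<le> 2 * (\<integral>\<^sup>+x. ennreal ((cmod (f x))\<^sup>2) \<partial>M) + 2 * (\<integral>\<^sup>+x. ennreal ((cmod (g x))\<^sup>2) \<partial>M)"
proof -
  have "(\<integral>\<^sup>+x. ennreal ((cmod (f x + g x))\<^sup>2) \<partial>M)
    \<le> (\<integral>\<^sup>+x. 2 * ennreal ((cmod (f x))\<^sup>2) + 2 * ennreal ((cmod (g x))\<^sup>2) \<partial>M)"
  proof (intro nn_integral_mono)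
    fix x
    have "ennreal ((cmod (f x + g x))\<^sup>2) \<le> ennreal (2 * (cmod (f x))\<^sup>2 + 2 * (cmod (g x))\<^sup>2)"
      by (intro ennreal_leI cmod_add_square_le)
    also have "\<dots> = 2 * ennreal ((cmod (f x))\<^sup>2) + 2 * ennreal ((cmod (g x))\<^sup>2)"
      by (simp add: ennreal_plus ennreal_mult)
    finally show "ennreal ((cmod (f x + g x))\<^sup>2) \<le> 2 * ennreal ((cmod (f x))\<^sup>2) + 2 * ennreal ((cmod (g x))\<^sup>2)" .
  qed
  also have "\<dots> = 2 * (\<integral>\<^sup>+x. ennreal ((cmod (f x))\<^sup>2) \<partial>M) + 2 * (\<integral>\<^sup>+x. ennreal ((cmod (g x))\<^sup>2) \<partial>M)"
    by (subst nn_integral_add) (auto simp: nn_integral_cmult)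
  finally show ?thesis .
qed

lemma is_L2_fourier_diff:
  assumes f: "square_integrable f" "is_L2_fourier f g" and h: "square_integrable h" "is_L2_fourier h k"
  shows "is_L2_fourier (\<lambda>x. f x - h x) (\<lambda>\<xi>. g \<xi> - k \<xi>)"
proof -
  have [measurable]: "f \<in> borel_measurable lborel" "h \<in> borel_measurable lborel"
    "g \<in> borel_measurable lborel" "k \<in> borel_measurable lborel"
    using assms by (auto simp: square_integrable_def is_L2_fourier_def)
  let ?F = "\<lambda>f g n. \<integral>\<^sup>+\<xi>. ennreal ((cmod (truncated_fourier f (real n) \<xi> - g \<xi>))\<^sup>2) \<partial>lborel"
  have lim: "(\<lambda>n. 2 * ?F f g n + 2 * ?F h k n) \<longlonglongrightarrow> 2 * 0 + 2 * 0"
    using assms by (intro tendsto_add ennreal_tendsto_cmult) (auto simp: is_L2_fourier_def)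
  have "?F (\<lambda>x. f x - h x) (\<lambda>\<xi>. g \<xi> - k \<xi>) n \<le> 2 * ?F f g n + 2 * ?F h k n" for n
  proof -
    have "?F (\<lambda>x. f x - h x) (\<lambda>\<xi>. g \<xi> - k \<xi>) n
      = (\<integral>\<^sup>+\<xi>. ennreal ((cmod ((truncated_fourier f (real n) \<xi> - g \<xi>) + (k \<xi> - truncated_fourier h (real n) \<xi>)))\<^sup>2) \<partial>lborel)"
      using f h by (simp add: truncated_fourier_diff algebra_simps)
    also have "\<dots> \<le> 2 * ?F f g n + 2 * (\<integral>\<^sup>+\<xi>. ennreal ((cmod (k \<xi> - truncated_fourier h (real n) \<xi>))\<^sup>2) \<partial>lborel)"
      by (intro nn_integral_cmod_add_square_le) measurable
    finally show ?thesis by (simp add: norm_minus_commute)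
  qed
  then have "?F (\<lambda>x. f x - h x) (\<lambda>\<xi>. g \<xi> - k \<xi>) \<longlonglongrightarrow> 0"
    using lim by (intro tendsto_sandwich[OF _ _ tendsto_const lim[simplified]]) auto
  then show ?thesis
    using f h by (auto simp: is_L2_fourier_def intro: square_integrable_diff)
qed

lemma is_L2_fourier_scale:
  assumes "square_integrable f" "is_L2_fourier f g"
  shows "is_L2_fourier (\<lambda>x. c * f x) (\<lambda>\<xi>. complex_of_real c * g \<xi>)"
proof -
  have [measurable]: "f \<in> borel_measurable lborel" "g \<in> borel_measurable lborel"
    and g: "integrable lborel (\<lambda>x. (cmod (g x))\<^sup>2)"
    using assms by (auto simp: square_integrable_def is_L2_fourier_def)
  let ?F = "\<lambda>f g n. \<integral>\<^sup>+\<xi>. ennreal ((cmod (truncated_fourier f (real n) \<xi> - g \<xi>))\<^sup>2) \<partial>lborel"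
  have "?F (\<lambda>x. c * f x) (\<lambda>\<xi>. complex_of_real c * g \<xi>) n = ennreal (c\<^sup>2) * ?F f g n" for n
  proof -
    have "ennreal ((cmod (truncated_fourier (\<lambda>x. c * f x) (real n) \<xi> - complex_of_real c * g \<xi>))\<^sup>2)
       = ennreal (c\<^sup>2) * ennreal ((cmod (truncated_fourier f (real n) \<xi> - g \<xi>))\<^sup>2)" for \<xi>
      unfolding truncated_fourier_scale right_diff_distrib[symmetric] norm_mult power_mult_distrib
      by (simp add: ennreal_mult)
    then show ?thesis by (simp add: nn_integral_cmult)
  qed
  moreover have "(\<lambda>n. ennreal (c\<^sup>2) * ?F f g n) \<longlonglongrightarrow> ennreal (c\<^sup>2) * 0"
    using assms by (intro ennreal_tendsto_cmult) (auto simp: is_L2_fourier_def)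
  ultimately show ?thesis
    using g by (auto simp: is_L2_fourier_def square_integrable_def norm_mult power_mult_distrib)
qed

text \<open>The difference \<open>g - h\<close> is a transform of \<open>f - f = 0\<close>, whose
  truncated integrals vanish. The sequence of errors is then constantly the squared L^2 norm of
  \<open>g - h\<close>, and it tends to 0.\<close>

lemma is_L2_fourier_unique:
  assumes "square_integrable f" "is_L2_fourier f g" "is_L2_fourier f h"
  shows "AE \<xi> in lborel. g \<xi> = h \<xi>"
proof -
  have [measurable]: "g \<in> borel_measurable lborel" "h \<in> borel_measurable lborel"
    using assms by (auto simp: square_integrable_def is_L2_fourier_def)
  have "is_L2_fourier (\<lambda>x. f x - f x) (\<lambda>\<xi>. g \<xi> - h \<xi>)"
    by (intro is_L2_fourier_diff assms)
  then have "(\<lambda>n::nat. \<integral>\<^sup>+\<xi>. ennreal ((cmod (g \<xi> - h \<xi>))\<^sup>2) \<partial>lborel) \<longlonglongrightarrow> 0"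
    by (simp add: is_L2_fourier_def truncated_fourier_def norm_minus_commute)
  then have "(\<integral>\<^sup>+\<xi>. ennreal ((cmod (g \<xi> - h \<xi>))\<^sup>2) \<partial>lborel) = 0"
    by (simp add: LIMSEQ_const_iff)
  then have "AE \<xi> in lborel. ennreal ((cmod (g \<xi> - h \<xi>))\<^sup>2) = 0"
    by (subst (asm) nn_integral_0_iff_AE) auto
  then show ?thesis by eventually_elim simp
qed

text \<open>Reconciles two encodings: membership asks for some transform with finite weighted norm,
  while \<open>sobolev_norm\<close> uses the one chosen by \<open>SOME\<close>. Almost everywhere
  uniqueness moves the integrability to the chosen transform, so that one \<open>g\<close> serves
  both.\<close>

lemma sobolev_spaceE:
  assumes "f \<in> sobolev_space s"
  obtains g where "square_integrable f" "is_L2_fourier f g"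
    "integrable lborel (\<lambda>\<xi>. (1 + \<xi>\<^sup>2) powr s * (cmod (g \<xi>))\<^sup>2)"
    "sobolev_norm s f = sqrt (LINT \<xi>|lborel. (1 + \<xi>\<^sup>2) powr s * (cmod (g \<xi>))\<^sup>2)"
proof -
  obtain h where f: "square_integrable f" and h: "is_L2_fourier f h"
    and i: "integrable lborel (\<lambda>\<xi>. (1 + \<xi>\<^sup>2) powr s * (cmod (h \<xi>))\<^sup>2)"
    using assms by (auto simp: sobolev_space_def)
  define g where "g = (SOME g. is_L2_fourier f g)"
  have g: "is_L2_fourier f g" unfolding g_def using h by (rule someI[where P = "is_L2_fourier f"])
  have [measurable]: "g \<in> borel_measurable lborel" "h \<in> borel_measurable lborel"
    using g h by (auto simp: square_integrable_def is_L2_fourier_def)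
  have "AE \<xi> in lborel. h \<xi> = g \<xi>" by (rule is_L2_fourier_unique[OF f h g])
  then have "integrable lborel (\<lambda>\<xi>. (1 + \<xi>\<^sup>2) powr s * (cmod (g \<xi>))\<^sup>2)"
    using i by (subst integrable_cong_AE[of _ _ "\<lambda>\<xi>. (1 + \<xi>\<^sup>2) powr s * (cmod (h \<xi>))\<^sup>2"]) auto
  then show ?thesis using that f g by (auto simp: sobolev_norm_def g_def)
qed

lemma sobolev_space_diff:
  assumes "f \<in> sobolev_space s" "h \<in> sobolev_space s"
  shows "(\<lambda>x. f x - h x) \<in> sobolev_space s"
proof -
  obtain g k where f: "square_integrable f" "is_L2_fourier f g"
    and ig: "integrable lborel (\<lambda>\<xi>. (1 + \<xi>\<^sup>2) powr s * (cmod (g \<xi>))\<^sup>2)"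
    and h: "square_integrable h" "is_L2_fourier h k"
    and ik: "integrable lborel (\<lambda>\<xi>. (1 + \<xi>\<^sup>2) powr s * (cmod (k \<xi>))\<^sup>2)"
    using assms by (auto simp: sobolev_space_def)
  have [measurable]: "g \<in> borel_measurable lborel" "k \<in> borel_measurable lborel"
    using f h by (auto simp: square_integrable_def is_L2_fourier_def)
  have "integrable lborel (\<lambda>\<xi>. (1 + \<xi>\<^sup>2) powr s * (cmod (g \<xi> - k \<xi>))\<^sup>2)"
  proof (rule Bochner_Integration.integrable_bound)
    show "integrable lborel (\<lambda>\<xi>. 2 * ((1 + \<xi>\<^sup>2) powr s * (cmod (g \<xi>))\<^sup>2) + 2 * ((1 + \<xi>\<^sup>2) powr s * (cmod (k \<xi>))\<^sup>2))"
      using ig ik by auto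
    have "(1 + \<xi>\<^sup>2) powr s * (cmod (g \<xi> - k \<xi>))\<^sup>2
        \<le> 2 * ((1 + \<xi>\<^sup>2) powr s * (cmod (g \<xi>))\<^sup>2) + 2 * ((1 + \<xi>\<^sup>2) powr s * (cmod (k \<xi>))\<^sup>2)" for \<xi>
      using mult_left_mono[OF cmod_add_square_le[of "g \<xi>" "- k \<xi>"], of "(1 + \<xi>\<^sup>2) powr s"]
      by (simp add: algebra_simps)
    then show "AE \<xi> in lborel. norm ((1 + \<xi>\<^sup>2) powr s * (cmod (g \<xi> - k \<xi>))\<^sup>2)
      \<le> norm (2 * ((1 + \<xi>\<^sup>2) powr s * (cmod (g \<xi>))\<^sup>2) + 2 * ((1 + \<xi>\<^sup>2) powr s * (cmod (k \<xi>))\<^sup>2))"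
      by (auto intro!: AE_I2 order_trans[OF _ abs_ge_self])
  qed measurable
  then show ?thesis
    using is_L2_fourier_diff[OF f h] square_integrable_real_diff[OF f(1) h(1)]
    by (auto simp: sobolev_space_def)
qed

lemma sobolev_space_scale:
  assumes "f \<in> sobolev_space s"
  shows "(\<lambda>x. c * f x) \<in> sobolev_space s"
proof -
  obtain g where f: "square_integrable f" "is_L2_fourier f g"
    and ig: "integrable lborel (\<lambda>\<xi>. (1 + \<xi>\<^sup>2) powr s * (cmod (g \<xi>))\<^sup>2)"
    using assms by (auto simp: sobolev_space_def)
  have "integrable lborel (\<lambda>\<xi>. c\<^sup>2 * ((1 + \<xi>\<^sup>2) powr s * (cmod (g \<xi>))\<^sup>2))"
    using ig by auto
  then have "integrable lborel (\<lambda>\<xi>. (1 + \<xi>\<^sup>2) powr s * (cmod (complex_of_real c * g \<xi>))\<^sup>2)"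
    by (simp add: norm_mult power_mult_distrib mult_ac)
  moreover have "square_integrable (\<lambda>x. c * f x)"
    using f by (auto simp: square_integrable_def power_mult_distrib)
  ultimately show ?thesis
    using is_L2_fourier_scale[OF f] by (auto simp: sobolev_space_def)
qed

text \<open>An equality of predicates, so that the \<open>SOME\<close> in
  \<open>sobolev_norm\<close> selects the same transform for both functions.\<close>

lemma is_L2_fourier_cong_AE:
  assumes "f \<in> borel_measurable lborel" "h \<in> borel_measurable lborel" "AE x in lborel. f x = h x"
  shows "is_L2_fourier f = is_L2_fourier h"
  by (intro ext) (simp add: is_L2_fourier_def truncated_fourier_cong_AE[OF assms])

lemma sobolev_norm_cong_AE:
  assumes "f \<in> borel_measurable lborel" "h \<in> borel_measurable lborel" "AE x in lborel. f x = h x"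
  shows "sobolev_norm s f = sobolev_norm s h"
  by (simp add: sobolev_norm_def is_L2_fourier_cong_AE[OF assms])

lemma sobolev_space_cong_AE:
  assumes [measurable]: "h \<in> borel_measurable lborel"
    and eq: "AE x in lborel. f x = h x" and f: "f \<in> sobolev_space s"
  shows "h \<in> sobolev_space s"
proof -
  have [measurable]: "f \<in> borel_measurable lborel" and i: "integrable lborel (\<lambda>x. (f x)\<^sup>2)"
    using f by (auto simp: sobolev_space_def square_integrable_def)
  have "integrable lborel (\<lambda>x. (h x)\<^sup>2)"
    using i eq by (subst integrable_cong_AE[of _ _ "\<lambda>x. (f x)\<^sup>2"]) auto
  then have "square_integrable h" by (auto simp: square_integrable_def)
  then show ?thesis
    using f is_L2_fourier_cong_AE[OF _ _ eq] by (auto simp: sobolev_space_def)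
qed

section \<open>Fourier inversion\<close>

text \<open>Since \<open>(1 + \<bar>x\<bar>)^2 \<le> 2 * (1 + x^2)\<close>, the integrand is at most
  \<open>2 powr s * (1 + \<bar>x\<bar>) powr (- (2 * s))\<close>. The half-line piece
  \<open>k\<close> has an explicit antiderivative, and its reflection covers negative
  \<open>x\<close>.\<close>

lemma integrable_one_plus_square_powr:
  fixes s :: real
  assumes "s > 1 / 2"
  shows "integrable lborel (\<lambda>x. (1 + x\<^sup>2) powr (- s))"
proof -
  define k :: "real \<Rightarrow> real" where "k x = indicator {0..} x *\<^sub>R (1 + x) powr (- (2 * s))" for x
  have kint: "integrable lborel k"
  proof -
    have "(\<integral>\<^sup>+x. ennreal ((1 + x) powr (- (2 * s))) * indicator {0..} x \<partial>lborel)
        = ennreal (0 - (1 + 0) powr (1 - 2 * s) / (1 - 2 * s))"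
    proof (rule nn_integral_FTC_atLeast)
      fix x :: real assume "0 \<le> x"
      then show "((\<lambda>x. (1 + x) powr (1 - 2 * s) / (1 - 2 * s)) has_real_derivative (1 + x) powr (- (2 * s))) (at x)"
        using assms DERIV_cdivide[OF DERIV_fun_powr[of "\<lambda>x. 1 + x" 1 x "1 - 2 * s"], of "1 - 2 * s"]
        by (auto intro!: derivative_eq_intros)
    next
      have "filterlim (\<lambda>x::real. 1 + x) at_top at_top"
        by (intro filterlim_tendsto_add_at_top[OF tendsto_const] filterlim_ident)
      then have "((\<lambda>x. (1 + x) powr (1 - 2 * s)) \<longlongrightarrow> 0) at_top"
        using assms by (intro tendsto_neg_powr) auto
      then show "((\<lambda>x. (1 + x) powr (1 - 2 * s) / (1 - 2 * s)) \<longlongrightarrow> 0) at_top"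
        using tendsto_divide[OF _ tendsto_const, of _ 0 at_top "1 - 2 * s"] assms by fastforce
    qed auto
    then have "(\<integral>\<^sup>+x. ennreal (norm (k x)) \<partial>lborel) < \<infinity>"
      by (subst nn_integral_cong[where v = "\<lambda>x. ennreal ((1 + x) powr (- (2 * s))) * indicator {0..} x"])
        (auto simp: k_def indicator_def)
    then show ?thesis unfolding k_def by (intro integrableI_bounded) auto
  qed
  have "integrable lborel (\<lambda>x. k (0 + (-1) * x))"
    by (rule lborel_integrable_real_affine[OF kint]) simp
  then have "integrable lborel (\<lambda>x. 2 powr s * (k x + k (- x)))"
    using kint by simp
  then show ?thesis
  proof (rule Bochner_Integration.integrable_bound)
    have "(1 + x\<^sup>2) powr (- s) \<le> 2 powr s * (k x + k (- x))" for x :: real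
    proof -
      have "(1 + \<bar>x\<bar>)\<^sup>2 / 2 \<le> 1 + x\<^sup>2"
        using sum_squares_bound[of 1 "\<bar>x\<bar>"] by (simp add: power2_sum)
      then have "(1 + x\<^sup>2) powr (- s) \<le> ((1 + \<bar>x\<bar>)\<^sup>2 / 2) powr (- s)"
        using assms by (intro powr_mono2') auto
      also have "\<dots> = 2 powr s * (1 + \<bar>x\<bar>) powr (- (2 * s))"
      proof -
        have "(1 + \<bar>x\<bar>)\<^sup>2 powr s = (1 + \<bar>x\<bar>) powr (2 * s)"
          using powr_powr[of "1 + \<bar>x\<bar>" 2 s] by simp
        then show ?thesis
          by (simp add: powr_divide powr_minus divide_simps add_pos_nonneg add_nonneg_eq_0_iff)
      qed
      also have "\<dots> \<le> 2 powr s * (k x + k (- x))"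
        by (auto simp: k_def indicator_def)
      finally show ?thesis .
    qed
    then show "AE x in lborel. norm ((1 + x\<^sup>2) powr (- s)) \<le> norm (2 powr s * (k x + k (- x)))"
      by (auto intro!: AE_I2 order_trans[OF _ abs_ge_self])
  qed measurable
qed

text \<open>The characteristic function of the standard normal distribution, rescaled by
  \<open>\<sigma>\<close>. The Gaussian factor serves as the regularization in Fourier
  inversion.\<close>

lemma gaussian_fourier:
  fixes \<sigma> d :: real
  assumes "\<sigma> > 0"
  shows "integrable lborel (\<lambda>\<xi>. exp (- ((\<sigma> * \<xi>)\<^sup>2) / 2))"
    and "(LINT \<xi>|lborel. cis (\<xi> * d) * complex_of_real (exp (- ((\<sigma> * \<xi>)\<^sup>2) / 2)))
      = complex_of_real (2 * pi * normal_density 0 \<sigma> d)"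
proof -
  have "integrable lborel (\<lambda>x. sqrt (2 * pi) * std_normal_density (0 + \<sigma> * x))"
    using assms by (intro integrable_mult_right lborel_integrable_real_affine) auto
  then show "integrable lborel (\<lambda>\<xi>. exp (- ((\<sigma> * \<xi>)\<^sup>2) / 2))"
    by (simp add: std_normal_density_def)
  have c: "(LINT x|lborel. std_normal_density x *\<^sub>R cis (t * x)) = complex_of_real (exp (- (t\<^sup>2) / 2))" for t
  proof -
    have "char std_normal_distribution t = (LINT x|lborel. std_normal_density x *\<^sub>R cis (t * x))"
      unfolding char_def
      by (subst integral_density) (auto simp: cis_conv_exp)
    then show ?thesis by (simp add: char_std_normal_distribution)
  qed
  have "(LINT \<xi>|lborel. cis (\<xi> * d) * complex_of_real (exp (- ((\<sigma> * \<xi>)\<^sup>2) / 2)))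
     = \<bar>1 / \<sigma>\<bar> *\<^sub>R (LINT z|lborel. cis ((0 + 1 / \<sigma> * z) * d) * complex_of_real (exp (- ((\<sigma> * (0 + 1 / \<sigma> * z))\<^sup>2) / 2)))"
    using assms by (intro lborel_integral_real_affine) auto
  also have "\<dots> = (1 / \<sigma>) *\<^sub>R (LINT z|lborel. complex_of_real (sqrt (2 * pi)) * (std_normal_density z *\<^sub>R cis (d / \<sigma> * z)))"
    using assms by (simp add: std_normal_density_def scaleR_conv_of_real mult_ac)
  also have "\<dots> = complex_of_real (sqrt (2 * pi) / \<sigma> * exp (- ((d / \<sigma>)\<^sup>2) / 2))"
    using c[of "d / \<sigma>"] by (subst integral_mult_right_zero) (simp add: scaleR_conv_of_real)
  also have "sqrt (2 * pi) / \<sigma> * exp (- ((d / \<sigma>)\<^sup>2) / 2) = 2 * pi * normal_density 0 \<sigma> d"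
    using assms by (simp add: normal_density_def real_sqrt_mult power_divide field_simps)
  finally show "(LINT \<xi>|lborel. cis (\<xi> * d) * complex_of_real (exp (- ((\<sigma> * \<xi>)\<^sup>2) / 2)))
      = complex_of_real (2 * pi * normal_density 0 \<sigma> d)" .
qed

text \<open>Fubini. On the bounded interval of truncation a square integrable \<open>f\<close> is
  integrable, so the double integral converges absolutely.\<close>

lemma truncated_fourier_multiplication_formula:
  fixes \<phi> :: "real \<Rightarrow> complex"
  assumes f: "square_integrable f" and \<phi>: "integrable lborel \<phi>"
  shows "(LINT \<xi>|lborel. truncated_fourier f R \<xi> * \<phi> \<xi>)
    = (LINT y|lborel. indicator {-R..R} y *\<^sub>R (complex_of_real (f y) * (LINT \<xi>|lborel. cis (- (\<xi> * y)) * \<phi> \<xi>)))"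
proof -
  have [measurable]: "f \<in> borel_measurable lborel" "\<phi> \<in> borel_measurable lborel"
    using f \<phi> by (auto simp: square_integrable_def)
  define k where "k \<xi> y = indicator {-R..R} y *\<^sub>R (complex_of_real (f y) * (cis (- (\<xi> * y)) * \<phi> \<xi>))" for \<xi> y
  have fi: "integrable lborel (\<lambda>y. indicator {-R..R} y *\<^sub>R f y)"
    using square_integrable_imp_set_integrable[OF f] by (simp add: set_integrable_def)
  have "integrable (lborel \<Otimes>\<^sub>M lborel) (\<lambda>(\<xi>, y). k \<xi> y)"
  proof (rule Bochner_Integration.integrable_bound)
    show "integrable (lborel \<Otimes>\<^sub>M lborel) (\<lambda>(\<xi>, y). \<phi> \<xi> * complex_of_real (indicator {-R..R} y *\<^sub>R f y))"
    proof (rule lborel_pair.Fubini_integrable)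
      show "AE \<xi> in lborel. integrable lborel (\<lambda>y. case (\<xi>, y) of (\<xi>, y) \<Rightarrow> \<phi> \<xi> * complex_of_real (indicator {-R..R} y *\<^sub>R f y))"
        using integrable_mult_right[OF integrable_of_real[OF fi, where 'a = complex]] by simp
      have "integrable lborel (\<lambda>\<xi>. norm (\<phi> \<xi>) * (LINT y|lborel. norm (indicator {-R..R} y *\<^sub>R f y)))"
        using \<phi> by (intro integrable_mult_left integrable_norm)
      then show "integrable lborel (\<lambda>\<xi>. LINT y|lborel. norm (case (\<xi>, y) of (\<xi>, y) \<Rightarrow> \<phi> \<xi> * complex_of_real (indicator {-R..R} y *\<^sub>R f y)))"
        by (simp add: norm_mult abs_mult)
    qed measurable
    show "AE z in lborel \<Otimes>\<^sub>M lborel. norm (case z of (\<xi>, y) \<Rightarrow> k \<xi> y)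
      \<le> norm (case z of (\<xi>, y) \<Rightarrow> \<phi> \<xi> * complex_of_real (indicator {-R..R} y *\<^sub>R f y))"
      by (auto simp: k_def norm_mult indicator_def)
  qed (unfold k_def, measurable)
  then have "(LINT y|lborel. LINT \<xi>|lborel. k \<xi> y) = (LINT \<xi>|lborel. LINT y|lborel. k \<xi> y)"
    by (rule lborel_pair.Fubini_integral)
  moreover have "(LINT \<xi>|lborel. k \<xi> y)
     = indicator {-R..R} y *\<^sub>R (complex_of_real (f y) * (LINT \<xi>|lborel. cis (- (\<xi> * y)) * \<phi> \<xi>))" for y
    unfolding k_def by (simp add: integral_scaleR_right integral_mult_right_zero)
  moreover have "(LINT y|lborel. k \<xi> y) = truncated_fourier f R \<xi> * \<phi> \<xi>" for \<xi>
    unfolding k_def truncated_fourier_def set_lebesgue_integral_def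
    by (subst integral_mult_left_zero[symmetric]) (simp add: mult_ac)
  ultimately show ?thesis by simp
qed

text \<open>The multiplication formula is applied to a modulated Gaussian and the truncation is
  removed: on the Fourier side by L^2 convergence and Cauchy-Schwarz, on the space side by dominated
  convergence.\<close>

lemma L2_fourier_gaussian_average:
  assumes f: "square_integrable f" and g: "is_L2_fourier f g" and \<sigma>: "\<sigma> > 0"
  shows "(LINT \<xi>|lborel. g \<xi> * (cis (\<xi> * x) * complex_of_real (exp (- ((\<sigma> * \<xi>)\<^sup>2) / 2))))
    = complex_of_real (2 * pi * (LINT y|lborel. f y * normal_density x \<sigma> y))"
proof -
  define \<phi> where "\<phi> \<xi> = cis (\<xi> * x) * complex_of_real (exp (- ((\<sigma> * \<xi>)\<^sup>2) / 2))" for \<xi>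
  have [measurable]: "\<phi> \<in> borel_measurable lborel" unfolding \<phi>_def by measurable
  have [measurable]: "f \<in> borel_measurable lborel" "g \<in> borel_measurable lborel"
    and f2: "integrable lborel (\<lambda>x. (f x)\<^sup>2)" and g2: "integrable lborel (\<lambda>x. (cmod (g x))\<^sup>2)"
    using f g by (auto simp: square_integrable_def is_L2_fourier_def)
  have \<phi>1: "integrable lborel \<phi>"
    using gaussian_fourier(1)[OF \<sigma>]
    by (rule Bochner_Integration.integrable_bound) (auto simp: \<phi>_def norm_mult)
  have \<phi>2: "integrable lborel (\<lambda>\<xi>. (cmod (\<phi> \<xi>))\<^sup>2)"
    using gaussian_fourier(1)[OF \<sigma>]
    by (rule Bochner_Integration.integrable_bound)
      (auto simp: \<phi>_def norm_mult power2_eq_square[of "exp _"] intro!: AE_I2 mult_left_le)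
  have hat: "(LINT \<xi>|lborel. cis (- (\<xi> * y)) * \<phi> \<xi>) = complex_of_real (2 * pi * normal_density x \<sigma> y)" for y
  proof -
    have "(LINT \<xi>|lborel. cis (- (\<xi> * y)) * \<phi> \<xi>)
      = (LINT \<xi>|lborel. cis (\<xi> * (x - y)) * complex_of_real (exp (- ((\<sigma> * \<xi>)\<^sup>2) / 2)))"
      by (intro Bochner_Integration.integral_cong)
        (auto simp: \<phi>_def cis_mult algebra_simps simp flip: mult.assoc)
    also have "\<dots> = complex_of_real (2 * pi * normal_density 0 \<sigma> (x - y))"
      by (rule gaussian_fourier(2)[OF \<sigma>])
    also have "normal_density 0 \<sigma> (x - y) = normal_density x \<sigma> y"
      by (simp add: normal_density_def power2_commute)
    finally show ?thesis .
  qed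
  define D where "D n = (\<integral>\<^sup>+\<xi>. ennreal ((cmod (truncated_fourier f (real n) \<xi> - g \<xi>))\<^sup>2) \<partial>lborel)" for n
  have D: "D \<longlonglongrightarrow> 0" using g unfolding D_def[abs_def] by (simp add: is_L2_fourier_def)
  have g\<phi>: "integrable lborel (\<lambda>\<xi>. g \<xi> * \<phi> \<xi>)"
    using Cauchy_Schwarz_lebesgue_integral(1)[of "\<lambda>\<xi>. cmod (g \<xi>)" lborel "\<lambda>\<xi>. cmod (\<phi> \<xi>)"] g2 \<phi>2
    by (intro integrable_norm_cancel[of lborel "\<lambda>\<xi>. g \<xi> * \<phi> \<xi>"]) (auto simp: norm_mult)
  define c where "c = sqrt (LINT \<xi>|lborel. (cmod (\<phi> \<xi>))\<^sup>2)"
  \<comment> \<open>\<open>D n\<close> is an extended nonnegative integral; only where it is finite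
    can Cauchy-Schwarz for real integrals be applied to the error.\<close>
  have "eventually (\<lambda>n. D n < \<infinity>) sequentially"
    using D by (rule order_tendstoD) simp
  then have bound: "eventually (\<lambda>n. norm ((LINT \<xi>|lborel. truncated_fourier f (real n) \<xi> * \<phi> \<xi>) - (LINT \<xi>|lborel. g \<xi> * \<phi> \<xi>))
      \<le> sqrt (enn2real (D n)) * c) sequentially"
  proof eventually_elim
    case (elim n)
    let ?d = "\<lambda>\<xi>. truncated_fourier f (real n) \<xi> - g \<xi>"
    have d2: "integrable lborel (\<lambda>\<xi>. (cmod (?d \<xi>))\<^sup>2)"
      using elim unfolding D_def by (intro integrableI_bounded) auto
    have D2: "(LINT \<xi>|lborel. (cmod (?d \<xi>))\<^sup>2) = enn2real (D n)"
      unfolding D_def by (subst integral_eq_nn_integral) auto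
    note CS = Cauchy_Schwarz_lebesgue_integral[of "\<lambda>\<xi>. cmod (?d \<xi>)" lborel "\<lambda>\<xi>. cmod (\<phi> \<xi>)", simplified, OF d2 \<phi>2]
    have d\<phi>: "integrable lborel (\<lambda>\<xi>. ?d \<xi> * \<phi> \<xi>)"
      using CS(1) by (intro integrable_norm_cancel[of lborel "\<lambda>\<xi>. ?d \<xi> * \<phi> \<xi>"]) (auto simp: norm_mult)
    have "integrable lborel (\<lambda>\<xi>. ?d \<xi> * \<phi> \<xi> + g \<xi> * \<phi> \<xi>)"
      using d\<phi> g\<phi> by (rule Bochner_Integration.integrable_add)
    then have t\<phi>: "integrable lborel (\<lambda>\<xi>. truncated_fourier f (real n) \<xi> * \<phi> \<xi>)"
      by (simp add: algebra_simps)
    have "norm ((LINT \<xi>|lborel. truncated_fourier f (real n) \<xi> * \<phi> \<xi>) - (LINT \<xi>|lborel. g \<xi> * \<phi> \<xi>))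
      = norm (LINT \<xi>|lborel. ?d \<xi> * \<phi> \<xi>)"
      using t\<phi> g\<phi> by (simp add: left_diff_distrib)
    also have "\<dots> \<le> (LINT \<xi>|lborel. cmod (?d \<xi>) * cmod (\<phi> \<xi>))"
      by (rule order_trans[OF integral_norm_bound]) (simp add: norm_mult)
    also have "\<dots> \<le> sqrt (enn2real (D n)) * c"
      using CS(2) by (simp add: D2 c_def)
    finally show ?case .
  qed
  have "(\<lambda>n. sqrt (enn2real (D n)) * c) \<longlonglongrightarrow> sqrt (enn2real 0) * c"
    using D by (intro tendsto_intros tendsto_enn2real) auto
  then have "(\<lambda>n. (LINT \<xi>|lborel. truncated_fourier f (real n) \<xi> * \<phi> \<xi>) - (LINT \<xi>|lborel. g \<xi> * \<phi> \<xi>)) \<longlonglongrightarrow> 0"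
    using bound by (intro Lim_null_comparison[OF bound]) simp
  then have lim1: "(\<lambda>n. (LINT \<xi>|lborel. truncated_fourier f (real n) \<xi> * \<phi> \<xi>)) \<longlonglongrightarrow> (LINT \<xi>|lborel. g \<xi> * \<phi> \<xi>)"
    by (simp add: LIM_zero_iff)
  have nd2: "integrable lborel (\<lambda>y. (normal_density x \<sigma> y)\<^sup>2)"
  proof (rule Bochner_Integration.integrable_bound)
    show "integrable lborel (\<lambda>y. (1 / sqrt (2 * pi * \<sigma>\<^sup>2)) * normal_density x \<sigma> y)"
      using \<sigma> by (intro integrable_mult_right integrable_normal_density)
    have "normal_density x \<sigma> y \<le> 1 / sqrt (2 * pi * \<sigma>\<^sup>2)" for y
      unfolding normal_density_def using \<sigma> by (intro mult_left_le) auto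
    then have "(normal_density x \<sigma> y)\<^sup>2 \<le> 1 / sqrt (2 * pi * \<sigma>\<^sup>2) * normal_density x \<sigma> y" for y
      unfolding power2_eq_square[of "normal_density x \<sigma> y"] by (intro mult_right_mono) auto
    then show "AE y in lborel. norm ((normal_density x \<sigma> y)\<^sup>2) \<le> norm (1 / sqrt (2 * pi * \<sigma>\<^sup>2) * normal_density x \<sigma> y)"
      by (auto intro!: AE_I2 order_trans[OF _ abs_ge_self])
  qed measurable
  have fnd: "integrable lborel (\<lambda>y. f y * normal_density x \<sigma> y)"
    using Cauchy_Schwarz_lebesgue_integral(1)[of f lborel "normal_density x \<sigma>"] f2 nd2
    by (intro integrable_norm_cancel[of lborel "\<lambda>y. f y * normal_density x \<sigma> y"]) auto
  have "(\<lambda>n. LINT y|lborel. indicator {- real n..real n} y *\<^sub>R (complex_of_real (2 * pi * (f y * normal_density x \<sigma> y))))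
     \<longlonglongrightarrow> (LINT y|lborel. complex_of_real (2 * pi * (f y * normal_density x \<sigma> y)))"
  proof (rule integral_dominated_convergence)
    show "integrable lborel (\<lambda>y. norm (complex_of_real (2 * pi * (f y * normal_density x \<sigma> y))))"
      using fnd by (intro integrable_norm integrable_of_real integrable_mult_right)
    show "AE y in lborel. (\<lambda>n. indicator {- real n..real n} y *\<^sub>R (complex_of_real (2 * pi * (f y * normal_density x \<sigma> y))))
      \<longlonglongrightarrow> complex_of_real (2 * pi * (f y * normal_density x \<sigma> y))"
    proof (intro AE_I2)
      fix y :: real
      obtain N :: nat where N: "\<bar>y\<bar> \<le> real N" using real_arch_simple by blast
      have "eventually (\<lambda>n. indicator {- real n..real n} y *\<^sub>R (complex_of_real (2 * pi * (f y * normal_density x \<sigma> y)))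
        = complex_of_real (2 * pi * (f y * normal_density x \<sigma> y))) sequentially"
        using eventually_ge_at_top[of N] by eventually_elim (use N in \<open>auto simp: indicator_def\<close>)
      then show "(\<lambda>n. indicator {- real n..real n} y *\<^sub>R (complex_of_real (2 * pi * (f y * normal_density x \<sigma> y))))
        \<longlonglongrightarrow> complex_of_real (2 * pi * (f y * normal_density x \<sigma> y))"
        by (rule tendsto_eventually)
    qed
  qed (auto simp: indicator_def)
  moreover have "(LINT \<xi>|lborel. truncated_fourier f (real n) \<xi> * \<phi> \<xi>)
    = (LINT y|lborel. indicator {- real n..real n} y *\<^sub>R (complex_of_real (2 * pi * (f y * normal_density x \<sigma> y))))" for n
    unfolding truncated_fourier_multiplication_formula[OF f \<phi>1] hat
    by (intro Bochner_Integration.integral_cong) auto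
  ultimately have "(LINT \<xi>|lborel. g \<xi> * \<phi> \<xi>) = (LINT y|lborel. complex_of_real (2 * pi * (f y * normal_density x \<sigma> y)))"
    using lim1 by (simp add: LIMSEQ_unique)
  then show ?thesis by (simp only: \<phi>_def integral_complex_of_real integral_mult_right_zero)
qed

text \<open>From \<open>1 + z \<le> exp z\<close>. The form of the bound matters: a factor
  \<open>\<sigma>\<close> that tends to 0, times a square integrable function of \<open>y\<close>
  that does not depend on \<open>\<sigma>\<close>.\<close>

lemma normal_density_le:
  assumes "\<sigma> > 0" "\<bar>y - x\<bar> \<ge> 1"
  shows "normal_density x \<sigma> y \<le> 2 * \<sigma> / (1 + (y - x)\<^sup>2)"
proof -
  define d where "d = (y - x)\<^sup>2"
  have d1: "d \<ge> 1" using assms(2) unfolding d_def by (metis one_le_power power2_abs)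
  have "1 + d / (2 * \<sigma>\<^sup>2) \<le> exp (d / (2 * \<sigma>\<^sup>2))" by (rule exp_ge_add_one_self)
  then have "exp (- (d / (2 * \<sigma>\<^sup>2))) \<le> 1 / (d / (2 * \<sigma>\<^sup>2))"
    using d1 assms(1) unfolding exp_minus inverse_eq_divide by (intro divide_left_mono) (linarith | simp)+
  also have "\<dots> = 2 * \<sigma>\<^sup>2 / d" by simp
  finally have e: "exp (- (d / (2 * \<sigma>\<^sup>2))) \<le> 2 * \<sigma>\<^sup>2 / d" .
  have "2 * \<sigma> \<le> sqrt (2 * pi * \<sigma>\<^sup>2)"
    using assms(1) pi_ge_two by (intro real_le_rsqrt) (simp add: power_mult_distrib)
  then have "1 / sqrt (2 * pi * \<sigma>\<^sup>2) \<le> 1 / (2 * \<sigma>)"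
    using assms(1) by (intro divide_left_mono) auto
  then have "normal_density x \<sigma> y \<le> 1 / (2 * \<sigma>) * (2 * \<sigma>\<^sup>2 / d)"
    unfolding normal_density_def using e assms(1) d1
    by (intro mult_mono) (auto simp: d_def)
  also have "\<dots> = \<sigma> / d" using assms(1) by (simp add: power2_eq_square)
  also have "\<dots> \<le> 2 * \<sigma> / (1 + d)" using d1 assms(1) by (simp add: field_simps)
  finally show ?thesis by (simp add: d_def)
qed

text \<open>The average is split at distance 1 from \<open>x\<close>. Nearby \<open>f\<close> is
  bounded, and after rescaling by \<open>\<sigma> n\<close> dominated convergence applies; the far
  part tends to 0 by the decay of the Gaussian.\<close>

lemma gaussian_average_tendsto:
  assumes cont: "continuous_on UNIV f" and f: "square_integrable f"
  shows "(\<lambda>n. LINT y|lborel. f y * normal_density x (1 / real (Suc n)) y) \<longlonglongrightarrow> f x"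
proof -
  have [measurable]: "f \<in> borel_measurable lborel" and f2: "integrable lborel (\<lambda>x. (f x)\<^sup>2)"
    using f by (auto simp: square_integrable_def)
  define \<sigma> :: "nat \<Rightarrow> real" where "\<sigma> n = 1 / real (Suc n)" for n
  have \<sigma>0: "\<sigma> n > 0" for n by (simp add: \<sigma>_def)
  have \<sigma>lim: "\<sigma> \<longlonglongrightarrow> 0" unfolding \<sigma>_def[abs_def] using LIMSEQ_inverse_real_of_nat by (simp add: inverse_eq_divide)
  let ?I = "\<lambda>y. indicator {x-1..x+1} y :: real"
  have "bounded (f ` {x-1..x+1})"
    by (intro compact_imp_bounded compact_continuous_image continuous_on_subset[OF cont]) auto
  then obtain B where B: "\<And>y. y \<in> {x-1..x+1} \<Longrightarrow> \<bar>f y\<bar> \<le> B"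
    by (metis bounded_iff imageI real_norm_def)
  then have B0: "0 \<le> B" by (metis abs_ge_zero atLeastAtMost_iff diff_le_eq le_add_same_cancel1 order_trans zero_le_one)
  define J where "J y = 1 / (1 + (y - x)\<^sup>2)" for y
  have J2: "integrable lborel (\<lambda>y. (J y)\<^sup>2)"
  proof -
    have "integrable lborel (\<lambda>y. (1 + (- x + 1 * y)\<^sup>2) powr (- 2))"
      by (rule lborel_integrable_real_affine[OF integrable_one_plus_square_powr]) auto
    then show ?thesis
      by (simp add: J_def powr_minus power_divide inverse_eq_divide add_pos_nonneg)
  qed
  have fJ: "integrable lborel (\<lambda>y. \<bar>f y * J y\<bar>)"
    by (intro Cauchy_Schwarz_lebesgue_integral(1) f2 J2) (auto simp: J_def)
  have near_eq: "(LINT y|lborel. ?I y * f y * normal_density x (\<sigma> n) y)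
     = (LINT z|lborel. ?I (x + \<sigma> n * z) * f (x + \<sigma> n * z) * std_normal_density z)" for n
  proof -
    have "(LINT y|lborel. ?I y * f y * normal_density x (\<sigma> n) y)
      = \<bar>\<sigma> n\<bar> *\<^sub>R (LINT z|lborel. ?I (x + \<sigma> n * z) * f (x + \<sigma> n * z) * normal_density x (\<sigma> n) (x + \<sigma> n * z))"
      using \<sigma>0[of n] by (intro lborel_integral_real_affine) auto
    also have "\<dots> = (LINT z|lborel. \<sigma> n * (?I (x + \<sigma> n * z) * f (x + \<sigma> n * z) * normal_density x (\<sigma> n) (x + \<sigma> n * z)))"
      using \<sigma>0[of n] by simp
    also have "\<dots> = (LINT z|lborel. ?I (x + \<sigma> n * z) * f (x + \<sigma> n * z) * std_normal_density z)"
    proof (intro Bochner_Integration.integral_cong refl)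
      fix z
      have "\<sigma> n * normal_density x (\<sigma> n) (x + \<sigma> n * z) = std_normal_density z"
        using \<sigma>0[of n] by (simp add: normal_density_def real_sqrt_mult power_mult_distrib)
      then show "\<sigma> n * (?I (x + \<sigma> n * z) * f (x + \<sigma> n * z) * normal_density x (\<sigma> n) (x + \<sigma> n * z))
        = ?I (x + \<sigma> n * z) * f (x + \<sigma> n * z) * std_normal_density z" by (metis mult.commute mult.assoc)
    qed
    finally show ?thesis .
  qed
  have near: "(\<lambda>n. LINT y|lborel. ?I y * f y * normal_density x (\<sigma> n) y) \<longlonglongrightarrow> f x"
  proof -
    have "(\<lambda>n. LINT z|lborel. ?I (x + \<sigma> n * z) * f (x + \<sigma> n * z) * std_normal_density z)
      \<longlonglongrightarrow> (LINT z|lborel. f x * std_normal_density z)"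
    proof (rule integral_dominated_convergence)
      show "integrable lborel (\<lambda>z. B * std_normal_density z)" by simp
      show "AE z in lborel. (\<lambda>n. ?I (x + \<sigma> n * z) * f (x + \<sigma> n * z) * std_normal_density z) \<longlonglongrightarrow> f x * std_normal_density z"
      proof (intro AE_I2 tendsto_mult tendsto_const)
        fix z
        have l: "(\<lambda>n. x + \<sigma> n * z) \<longlonglongrightarrow> x"
          using tendsto_add[OF tendsto_const tendsto_mult[OF \<sigma>lim tendsto_const]] by fastforce
        have "isCont f x" using cont by (simp add: continuous_on_eq_continuous_at)
        then have l2: "(\<lambda>n. f (x + \<sigma> n * z)) \<longlonglongrightarrow> f x" using l by (rule isCont_tendsto_compose)
        have "eventually (\<lambda>n. x + \<sigma> n * z \<in> {x-1<..<x+1}) sequentially"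
          by (rule topological_tendstoD[OF l]) auto
        then have "eventually (\<lambda>n. f (x + \<sigma> n * z) = ?I (x + \<sigma> n * z) * f (x + \<sigma> n * z)) sequentially"
          by eventually_elim (auto simp: indicator_def)
        then show "(\<lambda>n. ?I (x + \<sigma> n * z) * f (x + \<sigma> n * z)) \<longlonglongrightarrow> f x"
          using l2 by (rule Lim_transform_eventually[rotated])
      qed
      show "AE z in lborel. norm (?I (x + \<sigma> n * z) * f (x + \<sigma> n * z) * std_normal_density z) \<le> B * std_normal_density z" for n
        using B B0 by (auto simp: indicator_def abs_mult intro!: mult_right_mono)
    qed measurable
    then show ?thesis by (simp add: near_eq)
  qed
  \<comment> \<open>Far from \<open>x\<close> nothing but square integrability of \<open>f\<close>
    is known. \<open>J\<close> is square integrable too, so \<open>f * J\<close> is integrable by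
    Cauchy-Schwarz, and the factor \<open>2 * \<sigma> n\<close> forces the limit 0.\<close>
  have farb: "\<bar>(1 - ?I y) * f y * normal_density x (\<sigma> n) y\<bar> \<le> (2 * \<sigma> n) * \<bar>f y * J y\<bar>" for n y
  proof (cases "y \<in> {x-1..x+1}")
    case False
    then have "normal_density x (\<sigma> n) y \<le> 2 * \<sigma> n * J y"
      using normal_density_le[OF \<sigma>0[of n], of y x] by (auto simp: J_def)
    moreover have "J y \<ge> 0" by (simp add: J_def)
    ultimately show ?thesis using False mult_left_mono[of "normal_density x (\<sigma> n) y" "2 * \<sigma> n * J y" "\<bar>f y\<bar>"]
      by (simp add: abs_mult mult_ac)
  next
    case True
    then show ?thesis using \<sigma>0[of n] by (simp add: indicator_def)
  qed
  have fari: "integrable lborel (\<lambda>y. (1 - ?I y) * f y * normal_density x (\<sigma> n) y)" for n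
    using integrable_mult_right[OF fJ, of "2 * \<sigma> n"]
    by (rule Bochner_Integration.integrable_bound) (use farb in \<open>auto intro!: AE_I2 order_trans[OF _ abs_ge_self]\<close>)
  have far: "(\<lambda>n. LINT y|lborel. (1 - ?I y) * f y * normal_density x (\<sigma> n) y) \<longlonglongrightarrow> 0"
  proof (rule Lim_null_comparison)
    show "eventually (\<lambda>n. norm (LINT y|lborel. (1 - ?I y) * f y * normal_density x (\<sigma> n) y)
      \<le> 2 * \<sigma> n * (LINT y|lborel. \<bar>f y * J y\<bar>)) sequentially"
    proof (intro always_eventually allI)
      fix n
      have "norm (LINT y|lborel. (1 - ?I y) * f y * normal_density x (\<sigma> n) y)
        \<le> (LINT y|lborel. \<bar>(1 - ?I y) * f y * normal_density x (\<sigma> n) y\<bar>)"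
        by (rule order_trans[OF integral_norm_bound]) simp
      also have "\<dots> \<le> (LINT y|lborel. (2 * \<sigma> n) * \<bar>f y * J y\<bar>)"
        using farb by (intro integral_mono integrable_mult_right fJ integrable_abs fari)
      finally show "norm (LINT y|lborel. (1 - ?I y) * f y * normal_density x (\<sigma> n) y)
        \<le> 2 * \<sigma> n * (LINT y|lborel. \<bar>f y * J y\<bar>)" by simp
    qed
    show "(\<lambda>n. 2 * \<sigma> n * (LINT y|lborel. \<bar>f y * J y\<bar>)) \<longlonglongrightarrow> 0"
      using tendsto_mult[OF tendsto_mult[OF tendsto_const \<sigma>lim] tendsto_const] by fastforce
  qed
  have neari: "integrable lborel (\<lambda>y. ?I y * f y * normal_density x (\<sigma> n) y)" for n
  proof (rule Bochner_Integration.integrable_bound)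
    show "integrable lborel (\<lambda>y. B * normal_density x (\<sigma> n) y)" using \<sigma>0 by simp
    show "AE y in lborel. norm (?I y * f y * normal_density x (\<sigma> n) y) \<le> norm (B * normal_density x (\<sigma> n) y)"
      using B B0 by (auto simp: indicator_def abs_mult intro!: mult_right_mono)
  qed measurable
  have "(LINT y|lborel. f y * normal_density x (\<sigma> n) y)
    = (LINT y|lborel. ?I y * f y * normal_density x (\<sigma> n) y) + (LINT y|lborel. (1 - ?I y) * f y * normal_density x (\<sigma> n) y)" for n
    by (subst Bochner_Integration.integral_add[symmetric, OF neari fari]) (simp add: algebra_simps)
  then show ?thesis using tendsto_add[OF near far] by (simp add: \<sigma>_def)
qed

text \<open>Gaussian averages of \<open>f\<close> converge to \<open>f x\<close> by continuity, and
  their Fourier form converges to the inverse integral by integrability of \<open>g\<close>. Taking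
  real parts gives a formula with real integrands, which can be differentiated in
  \<open>x\<close>.\<close>

lemma L2_fourier_inversion:
  assumes cont: "continuous_on UNIV f" and f: "square_integrable f"
    and g: "is_L2_fourier f g" and gi: "integrable lborel g"
  shows "f x = (LINT \<xi>|lborel. Re (g \<xi>) * cos (\<xi> * x) - Im (g \<xi>) * sin (\<xi> * x)) / (2 * pi)"
proof -
  have [measurable]: "g \<in> borel_measurable lborel" using gi by auto
  define G where "G n \<xi> = g \<xi> * (cis (\<xi> * x) * complex_of_real (exp (- ((1 / real (Suc n) * \<xi>)\<^sup>2) / 2)))" for n \<xi>
  have lim: "(\<lambda>n. LINT \<xi>|lborel. G n \<xi>) \<longlonglongrightarrow> (LINT \<xi>|lborel. g \<xi> * cis (\<xi> * x))"
  proof (rule integral_dominated_convergence)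
    show "integrable lborel (\<lambda>\<xi>. norm (g \<xi>))" using gi by (rule integrable_norm)
    show "AE \<xi> in lborel. (\<lambda>n. G n \<xi>) \<longlonglongrightarrow> g \<xi> * cis (\<xi> * x)"
    proof (intro AE_I2)
      fix \<xi> :: real
      have "(\<lambda>n. 1 / real (Suc n)) \<longlonglongrightarrow> 0"
        using LIMSEQ_inverse_real_of_nat by (simp add: inverse_eq_divide)
      then have "(\<lambda>n. G n \<xi>) \<longlonglongrightarrow> g \<xi> * (cis (\<xi> * x) * complex_of_real (exp (- ((0 * \<xi>)\<^sup>2) / 2)))"
        unfolding G_def by (intro tendsto_intros) auto
      then show "(\<lambda>n. G n \<xi>) \<longlonglongrightarrow> g \<xi> * cis (\<xi> * x)" by simp
    qed
    show "AE \<xi> in lborel. norm (G n \<xi>) \<le> norm (g \<xi>)" for n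
      by (auto simp: G_def norm_mult intro!: AE_I2 mult_left_le)
  qed (auto simp: G_def)
  have eq: "(LINT \<xi>|lborel. G n \<xi>) = complex_of_real (2 * pi * (LINT y|lborel. f y * normal_density x (1 / real (Suc n)) y))" for n
    unfolding G_def by (rule L2_fourier_gaussian_average[OF f g]) simp
  have "(\<lambda>n. complex_of_real (2 * pi * (LINT y|lborel. f y * normal_density x (1 / real (Suc n)) y)))
    \<longlonglongrightarrow> complex_of_real (2 * pi * f x)"
    by (intro tendsto_intros gaussian_average_tendsto cont f)
  then have "complex_of_real (2 * pi * f x) = (LINT \<xi>|lborel. g \<xi> * cis (\<xi> * x))"
    by (rule LIMSEQ_unique) (rule lim[unfolded eq])
  then have "2 * pi * f x = Re (LINT \<xi>|lborel. g \<xi> * cis (\<xi> * x))" by (metis Re_complex_of_real)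
  also have "\<dots> = (LINT \<xi>|lborel. Re (g \<xi> * cis (\<xi> * x)))"
  proof (rule integral_Re[symmetric])
    show "integrable lborel (\<lambda>\<xi>. g \<xi> * cis (\<xi> * x))"
      using gi by (rule Bochner_Integration.integrable_bound) (auto simp: norm_mult)
  qed
  finally show ?thesis by (simp add: field_simps)
qed

section \<open>Sobolev embedding\<close>

text \<open>By the mean value inequality the difference quotients are dominated by \<open>B\<close>,
  so dominated convergence applies along every sequence of increments.\<close>

lemma has_real_derivative_integral_dominated:
  fixes k :: "real \<Rightarrow> 'a \<Rightarrow> real"
  assumes int: "\<And>x. integrable M (k x)"
    and der: "\<And>x \<xi>. ((\<lambda>x. k x \<xi>) has_real_derivative k' x \<xi>) (at x)"
    and meas: "\<And>x. k' x \<in> borel_measurable M"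
    and B: "integrable M B" and bound: "\<And>x \<xi>. \<bar>k' x \<xi>\<bar> \<le> B \<xi>"
  shows "((\<lambda>x. \<integral>\<xi>. k x \<xi> \<partial>M) has_real_derivative (\<integral>\<xi>. k' x \<xi> \<partial>M)) (at x)"
  unfolding DERIV_def tendsto_at_iff_sequentially comp_def
proof (intro allI impI)
  fix X :: "nat \<Rightarrow> real"
  assume X0: "\<forall>i. X i \<in> UNIV - {0}" and X: "X \<longlonglongrightarrow> 0"
  have [measurable]: "k x \<in> borel_measurable M" for x using int by auto
  have "(\<lambda>i. \<integral>\<xi>. (k (x + X i) \<xi> - k x \<xi>) / X i \<partial>M) \<longlonglongrightarrow> (\<integral>\<xi>. k' x \<xi> \<partial>M)"
  proof (rule integral_dominated_convergence[OF meas _ B])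
    show "AE \<xi> in M. (\<lambda>i. (k (x + X i) \<xi> - k x \<xi>) / X i) \<longlonglongrightarrow> k' x \<xi>"
      using der X X0 unfolding DERIV_def tendsto_at_iff_sequentially comp_def by auto
    show "AE \<xi> in M. norm ((k (x + X i) \<xi> - k x \<xi>) / X i) \<le> B \<xi>" for i
    proof (intro AE_I2)
      fix \<xi>
      have "norm (k (x + X i) \<xi> - k x \<xi>) \<le> B \<xi> * norm (x + X i - x)"
      proof (rule differentiable_bound[OF convex_UNIV])
        show "((\<lambda>x. k x \<xi>) has_derivative (*) (k' z \<xi>)) (at z within UNIV)" for z
          using der[of \<xi> z] by (simp add: has_field_derivative_def)
        show "onorm ((*) (k' z \<xi>)) \<le> B \<xi>" for z
          using bound[of z \<xi>] by (intro onorm_le) (auto simp: abs_mult intro!: mult_right_mono)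
      qed auto
      then show "norm ((k (x + X i) \<xi> - k x \<xi>) / X i) \<le> B \<xi>"
        using X0 by (auto simp: divide_simps mult.commute)
    qed
  qed measurable
  then show "(\<lambda>i. ((\<integral>\<xi>. k (x + X i) \<xi> \<partial>M) - (\<integral>\<xi>. k x \<xi> \<partial>M)) / X i) \<longlonglongrightarrow> (\<integral>\<xi>. k' x \<xi> \<partial>M)"
    by (simp add: int)
qed

lemma continuous_on_integral_dominated:
  fixes k :: "real \<Rightarrow> 'a \<Rightarrow> real"
  assumes cont: "\<And>\<xi>. continuous_on UNIV (\<lambda>x. k x \<xi>)"
    and meas: "\<And>x. k x \<in> borel_measurable M"
    and B: "integrable M B" and bound: "\<And>x \<xi>. \<bar>k x \<xi>\<bar> \<le> B \<xi>"
  shows "continuous_on UNIV (\<lambda>x. \<integral>\<xi>. k x \<xi> \<partial>M)"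
  unfolding continuous_on_sequentially comp_def
proof (intro allI impI ballI, elim conjE)
  fix X :: "nat \<Rightarrow> real" and a assume X: "X \<longlonglongrightarrow> a"
  show "(\<lambda>n. \<integral>\<xi>. k (X n) \<xi> \<partial>M) \<longlonglongrightarrow> (\<integral>\<xi>. k a \<xi> \<partial>M)"
  proof (rule integral_dominated_convergence[OF meas meas B])
    show "AE \<xi> in M. (\<lambda>i. k (X i) \<xi>) \<longlonglongrightarrow> k a \<xi>"
      using X cont by (auto simp: continuous_on_sequentially comp_def)
  qed (use bound in auto)
qed

text \<open>The constant of the Sobolev embedding: the L^2 norm of
  \<open>(1 + \<xi>^2) powr (- r / 2)\<close>, finite for \<open>r > 1/2\<close>.\<close>

definition weight_L2_norm :: "real \<Rightarrow> real"
  where "weight_L2_norm r = sqrt (LINT \<xi>|lborel. (1 + \<xi>\<^sup>2) powr (- r))"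

text \<open>Cauchy-Schwarz after writing the integrand as
  \<open>(1 + \<xi>^2) powr (- (s - r) / 2)\<close> times
  \<open>(1 + \<xi>^2) powr (s / 2) * cmod (g \<xi>)\<close>. The case \<open>r = 0\<close> controls
  a function, \<open>r = 1\<close> its derivative.\<close>

lemma integrable_weighted_cmod:
  fixes g :: "real \<Rightarrow> complex"
  assumes [measurable]: "g \<in> borel_measurable lborel"
    and i: "integrable lborel (\<lambda>\<xi>. (1 + \<xi>\<^sup>2) powr s * (cmod (g \<xi>))\<^sup>2)" and r: "s - r > 1 / 2"
  shows "integrable lborel (\<lambda>\<xi>. (1 + \<xi>\<^sup>2) powr (r / 2) * cmod (g \<xi>))"
    and "(LINT \<xi>|lborel. (1 + \<xi>\<^sup>2) powr (r / 2) * cmod (g \<xi>))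
      \<le> weight_L2_norm (s - r) * sqrt (LINT \<xi>|lborel. (1 + \<xi>\<^sup>2) powr s * (cmod (g \<xi>))\<^sup>2)"
proof -
  define a b where "a \<xi> = (1 + \<xi>\<^sup>2) powr (- ((s - r) / 2))" and "b \<xi> = (1 + \<xi>\<^sup>2) powr (s / 2) * cmod (g \<xi>)" for \<xi> :: real
  have sq: "(a \<xi>)\<^sup>2 = (1 + \<xi>\<^sup>2) powr (- (s - r))" "(b \<xi>)\<^sup>2 = (1 + \<xi>\<^sup>2) powr s * (cmod (g \<xi>))\<^sup>2" for \<xi>
    by (auto simp: a_def b_def power_mult_distrib powr_power add_nonneg_eq_0_iff diff_divide_distrib)
  have ab: "a \<xi> * b \<xi> = (1 + \<xi>\<^sup>2) powr (r / 2) * cmod (g \<xi>)" for \<xi>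
    by (simp add: a_def b_def field_simps flip: powr_add)
  have pos: "\<bar>a \<xi> * b \<xi>\<bar> = a \<xi> * b \<xi>" for \<xi> by (simp add: a_def b_def)
  have [measurable]: "a \<in> borel_measurable lborel" "b \<in> borel_measurable lborel"
    unfolding a_def b_def by measurable
  note CS = Cauchy_Schwarz_lebesgue_integral[of a lborel b]
  have i1: "integrable lborel (\<lambda>\<xi>. (a \<xi>)\<^sup>2)" unfolding sq using r by (rule integrable_one_plus_square_powr)
  have i2: "integrable lborel (\<lambda>\<xi>. (b \<xi>)\<^sup>2)" unfolding sq by (rule i)
  show "integrable lborel (\<lambda>\<xi>. (1 + \<xi>\<^sup>2) powr (r / 2) * cmod (g \<xi>))"
    using CS(1)[OF _ _ i1 i2] by (simp add: pos ab)
  show "(LINT \<xi>|lborel. (1 + \<xi>\<^sup>2) powr (r / 2) * cmod (g \<xi>))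
      \<le> weight_L2_norm (s - r) * sqrt (LINT \<xi>|lborel. (1 + \<xi>\<^sup>2) powr s * (cmod (g \<xi>))\<^sup>2)"
    using CS(2)[OF _ _ i1 i2] unfolding pos ab sq weight_L2_norm_def by simp
qed

lemma abs_Re_Im_cos_sin_le: "\<bar>Re z * cos t - Im z * sin t\<bar> \<le> cmod z"
proof -
  have "Re z * cos t - Im z * sin t = Re (z * cis t)" by simp
  also have "\<bar>\<dots>\<bar> \<le> cmod (z * cis t)" by (rule abs_Re_le_cmod)
  finally show ?thesis by (simp add: norm_mult)
qed

lemma sobolev_sup_bound:
  assumes s: "s > 1 / 2" and f: "f \<in> sobolev_space s" and cont: "continuous_on UNIV f"
  shows "\<bar>f x\<bar> \<le> weight_L2_norm s * sobolev_norm s f"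
proof -
  obtain g where g: "square_integrable f" "is_L2_fourier f g"
    "integrable lborel (\<lambda>\<xi>. (1 + \<xi>\<^sup>2) powr s * (cmod (g \<xi>))\<^sup>2)"
    "sobolev_norm s f = sqrt (LINT \<xi>|lborel. (1 + \<xi>\<^sup>2) powr s * (cmod (g \<xi>))\<^sup>2)"
    using f by (rule sobolev_spaceE)
  have [measurable]: "g \<in> borel_measurable lborel"
    using g by (auto simp: square_integrable_def is_L2_fourier_def)
  have w: "integrable lborel (\<lambda>\<xi>. cmod (g \<xi>))"
    "(LINT \<xi>|lborel. cmod (g \<xi>)) \<le> weight_L2_norm s * sobolev_norm s f"
    using integrable_weighted_cmod[of g s 0] g(3,4) s by (auto simp: add_nonneg_eq_0_iff)
  have gi: "integrable lborel g" using w(1) by (rule integrable_norm_cancel) measurable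
  have "\<bar>f x\<bar> = \<bar>LINT \<xi>|lborel. Re (g \<xi>) * cos (\<xi> * x) - Im (g \<xi>) * sin (\<xi> * x)\<bar> / (2 * pi)"
    unfolding L2_fourier_inversion[OF cont g(1,2) gi, of x] by simp
  also have "\<dots> \<le> \<bar>LINT \<xi>|lborel. Re (g \<xi>) * cos (\<xi> * x) - Im (g \<xi>) * sin (\<xi> * x)\<bar> / 1"
    using pi_ge_two by (intro divide_left_mono) auto
  also have "\<dots> \<le> (LINT \<xi>|lborel. cmod (g \<xi>))"
    using abs_Re_Im_cos_sin_le
    by (auto intro!: order_trans[OF integral_abs_bound] integral_mono_AE' w)
  finally show ?thesis using w(2) by simp
qed

text \<open>The inversion formula is differentiated under the integral sign. The derivative brings
  down a factor \<open>\<xi>\<close>, and \<open>\<bar>\<xi>\<bar> * cmod (g \<xi>)\<close> is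
  integrable because \<open>s - 1 > 1/2\<close>.\<close>

lemma sobolev_C1:
  assumes s: "s > 3 / 2" and f: "f \<in> sobolev_space s" and cont: "continuous_on UNIV f"
  shows "(f has_real_derivative deriv f x) (at x)"
    and "continuous_on UNIV (deriv f)"
    and "\<bar>deriv f x\<bar> \<le> weight_L2_norm (s - 1) * sobolev_norm s f"
proof -
  obtain g where g: "square_integrable f" "is_L2_fourier f g"
    "integrable lborel (\<lambda>\<xi>. (1 + \<xi>\<^sup>2) powr s * (cmod (g \<xi>))\<^sup>2)"
    "sobolev_norm s f = sqrt (LINT \<xi>|lborel. (1 + \<xi>\<^sup>2) powr s * (cmod (g \<xi>))\<^sup>2)"
    using f by (rule sobolev_spaceE)
  have [measurable]: "g \<in> borel_measurable lborel"
    using g by (auto simp: square_integrable_def is_L2_fourier_def)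
  have w: "integrable lborel (\<lambda>\<xi>. cmod (g \<xi>))"
    using integrable_weighted_cmod[of g s 0] g(3,4) s by (auto simp: add_nonneg_eq_0_iff)
  have gi: "integrable lborel g" using w(1) by (rule integrable_norm_cancel) measurable
  define B where "B \<xi> = (1 + \<xi>\<^sup>2) powr (1 / 2) * cmod (g \<xi>)" for \<xi> :: real
  have B: "integrable lborel B" "(LINT \<xi>|lborel. B \<xi>) \<le> weight_L2_norm (s - 1) * sobolev_norm s f"
    using integrable_weighted_cmod[of g s 1] g(3,4) s unfolding B_def by auto
  define k k' where "k x \<xi> = Re (g \<xi>) * cos (\<xi> * x) - Im (g \<xi>) * sin (\<xi> * x)"
    and "k' x \<xi> = - \<xi> * (Re (g \<xi>) * sin (\<xi> * x) + Im (g \<xi>) * cos (\<xi> * x))" for x \<xi>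
  have [measurable]: "k x \<in> borel_measurable lborel" "k' x \<in> borel_measurable lborel" for x
    unfolding k_def k'_def by measurable
  have bound: "\<bar>k' x \<xi>\<bar> \<le> B \<xi>" for x \<xi>
  proof -
    \<comment> \<open>A phase shift by \<open>pi / 2\<close> gives the sines and cosines the shape
      required by \<open>abs_Re_Im_cos_sin_le\<close>.\<close>
    have "k' x \<xi> = \<xi> * (Re (g \<xi>) * cos (\<xi> * x + pi / 2) - Im (g \<xi>) * sin (\<xi> * x + pi / 2))"
      by (simp add: k'_def cos_add sin_add algebra_simps)
    then have "\<bar>k' x \<xi>\<bar> \<le> \<bar>\<xi>\<bar> * cmod (g \<xi>)"
      unfolding abs_mult by (simp add: abs_mult mult_left_mono abs_Re_Im_cos_sin_le)
    also have "\<bar>\<xi>\<bar> \<le> (1 + \<xi>\<^sup>2) powr (1 / 2)"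
      by (subst powr_half_sqrt) (auto intro!: real_le_rsqrt)
    finally show ?thesis by (simp add: B_def mult_right_mono)
  qed
  have "((\<lambda>x. LINT \<xi>|lborel. k x \<xi>) has_real_derivative (LINT \<xi>|lborel. k' x \<xi>)) (at x)" for x
  proof (rule has_real_derivative_integral_dominated[OF _ _ _ B(1) bound])
    show "integrable lborel (k x)" for x
      using w by (rule Bochner_Integration.integrable_bound) (auto simp: k_def abs_Re_Im_cos_sin_le)
    show "((\<lambda>x. k x \<xi>) has_real_derivative k' x \<xi>) (at x)" for x \<xi>
      unfolding k_def k'_def by (auto intro!: derivative_eq_intros simp: algebra_simps)
  qed measurable
  then have "((\<lambda>x. (LINT \<xi>|lborel. k x \<xi>) / (2 * pi)) has_real_derivative (LINT \<xi>|lborel. k' x \<xi>) / (2 * pi)) (at x)" for x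
    by (rule DERIV_cdivide)
  moreover have "f = (\<lambda>x. (LINT \<xi>|lborel. k x \<xi>) / (2 * pi))"
    unfolding k_def using L2_fourier_inversion[OF cont g(1,2) gi] by auto
  ultimately have der: "(f has_real_derivative (LINT \<xi>|lborel. k' x \<xi>) / (2 * pi)) (at x)" for x
    by simp
  then have deriv: "deriv f = (\<lambda>x. (LINT \<xi>|lborel. k' x \<xi>) / (2 * pi))"
    using DERIV_imp_deriv by blast
  show "(f has_real_derivative deriv f x) (at x)" using der by (simp add: deriv)
  have "continuous_on UNIV (\<lambda>x. LINT \<xi>|lborel. k' x \<xi>)"
    by (rule continuous_on_integral_dominated[OF _ _ B(1) bound])
      (auto simp: k'_def intro!: continuous_intros)
  then show "continuous_on UNIV (deriv f)" unfolding deriv by (intro continuous_intros) auto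
  have "\<bar>deriv f x\<bar> = \<bar>LINT \<xi>|lborel. k' x \<xi>\<bar> / (2 * pi)" by (simp add: deriv)
  also have "\<dots> \<le> \<bar>LINT \<xi>|lborel. k' x \<xi>\<bar> / 1"
    using pi_ge_two by (intro divide_left_mono) auto
  also have "\<dots> \<le> (LINT \<xi>|lborel. B \<xi>)"
    using bound by (auto intro!: order_trans[OF integral_abs_bound] integral_mono_AE' B) (simp add: B_def)
  finally show "\<bar>deriv f x\<bar> \<le> weight_L2_norm (s - 1) * sobolev_norm s f" using B(2) by simp
qed

section \<open>Convolution with the kernel\<close>

definition kernel_right :: "(real \<Rightarrow> real) \<Rightarrow> real \<Rightarrow> real"
  where "kernel_right f x = exp x / 2 * (LINT y:{x..}|lborel. exp (- y) * f y)"

text \<open>Encoded as a reflection, so that its properties are inherited from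
  \<open>kernel_right\<close>. Unfolded, it is the part of the convolution over
  \<open>y \<le> x\<close>.\<close>

definition kernel_left :: "(real \<Rightarrow> real) \<Rightarrow> real \<Rightarrow> real"
  where "kernel_left f x = kernel_right (\<lambda>y. f (- y)) (- x)"

lemma has_bochner_integral_exp_atLeast:
  "has_bochner_integral lborel (\<lambda>y::real. indicator {x..} y *\<^sub>R exp (- y)) (exp (- x))"
proof -
  have "(\<integral>\<^sup>+y. ennreal (exp (- y)) * indicator {x..} y \<partial>lborel) = ennreal (0 - - exp (- x))"
  proof (rule nn_integral_FTC_atLeast)
    show "((\<lambda>y. - exp (- y)) has_real_derivative exp (- y)) (at y)" for y :: real
      by (auto intro!: derivative_eq_intros)
    have "((\<lambda>y. - exp (- y)) \<longlongrightarrow> - (0::real)) at_top"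
      by (intro tendsto_minus filterlim_compose[OF exp_at_bot] filterlim_uminus_at_bot_at_top)
    then show "((\<lambda>y. - exp (- y)) \<longlongrightarrow> (0::real)) at_top" by simp
  qed auto
  then have "(\<integral>\<^sup>+y. ennreal (indicator {x..} y *\<^sub>R exp (- y)) \<partial>lborel) = ennreal (exp (- x))"
    by (subst nn_integral_cong[where v = "\<lambda>y. ennreal (exp (- y)) * indicator {x..} y"])
      (auto simp: indicator_def)
  then show ?thesis
    by (intro has_bochner_integral_nn_integral) auto
qed

context
  fixes f :: "real \<Rightarrow> real" and M :: real
  assumes cont: "continuous_on UNIV f" and bound: "\<And>x. \<bar>f x\<bar> \<le> M"
begin

lemma set_integrable_kernel_right: "set_integrable lborel {x..} (\<lambda>y. exp (- y) * f y)"
proof -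
  have [measurable]: "f \<in> borel_measurable lborel"
    using cont by (simp add: borel_measurable_continuous_onI)
  have "integrable lborel (\<lambda>y. M * (indicator {x..} y *\<^sub>R exp (- y)))"
    using has_bochner_integral_exp_atLeast[of x] by (auto simp: has_bochner_integral_iff)
  then show ?thesis unfolding set_integrable_def
    by (rule Bochner_Integration.integrable_bound)
      (auto simp: indicator_def abs_mult mult.commute intro!: AE_I2 mult_left_mono order_trans[OF bound abs_ge_self])
qed

lemma abs_kernel_right_le: "\<bar>kernel_right f x\<bar> \<le> M / 2"
proof -
  have "\<bar>LINT y:{x..}|lborel. exp (- y) * f y\<bar> \<le> (LINT y|lborel. M * (indicator {x..} y *\<^sub>R exp (- y)))"
    unfolding set_lebesgue_integral_def
  proof (rule order_trans[OF integral_abs_bound], rule integral_mono)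
    show "integrable lborel (\<lambda>y. \<bar>indicator {x..} y *\<^sub>R (exp (- y) * f y)\<bar>)"
      using set_integrable_kernel_right[of x] unfolding set_integrable_def by (rule integrable_abs)
    show "integrable lborel (\<lambda>y. M * (indicator {x..} y *\<^sub>R exp (- y)))"
      using has_bochner_integral_exp_atLeast[of x] by (auto simp: has_bochner_integral_iff)
    show "\<bar>indicator {x..} y *\<^sub>R (exp (- y) * f y)\<bar> \<le> M * (indicator {x..} y *\<^sub>R exp (- y))" for y
      using bound by (auto simp: indicator_def abs_mult mult.commute intro!: mult_left_mono)
  qed
  also have "\<dots> = M * exp (- x)"
    using has_bochner_integral_exp_atLeast[of x] by (auto simp: has_bochner_integral_iff)
  finally have "exp x / 2 * \<bar>LINT y:{x..}|lborel. exp (- y) * f y\<bar> \<le> exp x / 2 * (M * exp (- x))"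
    by (intro mult_left_mono) auto
  also have "exp x / 2 * (M * exp (- x)) = M / 2" by (simp add: exp_minus field_simps)
  finally show ?thesis by (simp add: kernel_right_def abs_mult)
qed

text \<open>Near \<open>x\<close> the tail integral is a constant minus the integral over
  \<open>{x-1..z}\<close>, so the fundamental theorem of calculus applies. This first-order equation
  and its mirror image replace the distributional identity \<open>p'' = p - delta\<close>.\<close>

lemma kernel_right_has_derivative:
  "(kernel_right f has_real_derivative kernel_right f x - f x / 2) (at x)"
proof -
  define h where "h y = exp (- y) * f y" for y
  have hc: "continuous_on S h" for S
    unfolding h_def by (intro continuous_intros continuous_on_subset[OF cont]) auto
  have E: "(LINT y:{z..}|lborel. h y) = (LINT y:{x-1..}|lborel. h y) - integral {x-1..z} h" if "x - 1 \<le> z" for z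
  proof -
    have si: "set_integrable lborel {x-1..z} h"
      by (rule borel_integrable_atLeastAtMost') (rule hc)
    have "(LINT y:{x-1..}|lborel. h y) = (LINT y:{x-1..z} \<union> {z<..}|lborel. h y)"
      using that by (intro arg_cong[where f = "\<lambda>A. set_lebesgue_integral lborel A h"]) auto
    also have "\<dots> = (LINT y:{x-1..z}|lborel. h y) + (LINT y:{z<..}|lborel. h y)"
      using set_integrable_kernel_right[of z]
      by (intro set_integral_Un si) (auto simp: h_def intro: set_integrable_subset)
    also have "(LINT y:{z<..}|lborel. h y) = (LINT y:{z..}|lborel. h y)"
      unfolding set_lebesgue_integral_def
    proof (rule integral_cong_AE)
      have [measurable]: "h \<in> borel_measurable lborel"
        using hc by (simp add: borel_measurable_continuous_onI)
      show "(\<lambda>y. indicat_real {z<..} y *\<^sub>R h y) \<in> borel_measurable lborel"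
        "(\<lambda>y. indicat_real {z..} y *\<^sub>R h y) \<in> borel_measurable lborel" by measurable
      show "AE y in lborel. indicat_real {z<..} y *\<^sub>R h y = indicat_real {z..} y *\<^sub>R h y"
        using AE_lborel_singleton[of z] by eventually_elim (auto simp: indicator_def)
    qed
    also have "(LINT y:{x-1..z}|lborel. h y) = integral {x-1..z} h"
      by (rule set_borel_integral_eq_integral(2)[OF si])
    finally show ?thesis by simp
  qed
  have "((\<lambda>z. integral {x-1..z} h) has_real_derivative h x) (at x within {x-1..x+1})"
    by (rule integral_has_real_derivative) (auto intro: hc)
  moreover have "at x within {x-1..x+1} = at x" by (rule at_within_interior) auto
  ultimately have d: "((\<lambda>z. integral {x-1..z} h) has_real_derivative h x) (at x)" by simp
  have "((\<lambda>z. exp z / 2 * ((LINT y:{x-1..}|lborel. h y) - integral {x-1..z} h)) has_real_derivative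
    exp x / 2 * ((LINT y:{x-1..}|lborel. h y) - integral {x-1..x} h) - exp x / 2 * h x) (at x)"
    by (auto intro!: derivative_eq_intros d)
  moreover have "exp x / 2 * ((LINT y:{x-1..}|lborel. h y) - integral {x-1..x} h) - exp x / 2 * h x = kernel_right f x - f x / 2"
    by (subst E[symmetric]) (simp_all add: kernel_right_def h_def[abs_def] exp_minus)
  ultimately have "((\<lambda>z. exp z / 2 * ((LINT y:{x-1..}|lborel. h y) - integral {x-1..z} h)) has_real_derivative
    kernel_right f x - f x / 2) (at x)" by simp
  then show ?thesis
  proof (rule has_field_derivative_transform_within_open[of _ _ _ "{x-1<..}"])
    show "exp z / 2 * ((LINT y:{x-1..}|lborel. h y) - integral {x-1..z} h) = kernel_right f z" if "z \<in> {x-1<..}" for z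
      using that by (subst E[symmetric]) (auto simp: kernel_right_def h_def[abs_def])
  qed auto
qed

end

lemma kernel_right_diff:
  assumes "continuous_on UNIV f" "\<And>x. \<bar>f x\<bar> \<le> M" "continuous_on UNIV g" "\<And>x. \<bar>g x\<bar> \<le> N"
  shows "kernel_right f x - kernel_right g x = kernel_right (\<lambda>y. f y - g y) x"
  unfolding kernel_right_def right_diff_distrib
  by (subst set_integral_diff(2)) (auto intro: set_integrable_kernel_right assms simp: right_diff_distrib)

lemma kernel_right_dist:
  assumes "continuous_on UNIV f" "\<And>x. \<bar>f x\<bar> \<le> M" "continuous_on UNIV g" "\<And>x. \<bar>g x\<bar> \<le> N"
    and "\<And>x. \<bar>f x - g x\<bar> \<le> e"
  shows "\<bar>kernel_right f x - kernel_right g x\<bar> \<le> e / 2"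
  unfolding kernel_right_diff[OF assms(1-4)]
  by (intro abs_kernel_right_le continuous_intros assms)

lemma continuous_on_reflect:
  fixes f :: "real \<Rightarrow> real"
  assumes "continuous_on UNIV f"
  shows "continuous_on UNIV (\<lambda>y. f (- y))"
  by (intro continuous_on_compose2[OF assms] continuous_intros) auto

lemma abs_kernel_left_le:
  assumes "continuous_on UNIV f" "\<And>x. \<bar>f x\<bar> \<le> M"
  shows "\<bar>kernel_left f x\<bar> \<le> M / 2"
  unfolding kernel_left_def by (intro abs_kernel_right_le continuous_on_reflect assms)

lemma kernel_left_dist:
  assumes "continuous_on UNIV f" "\<And>x. \<bar>f x\<bar> \<le> M" "continuous_on UNIV g" "\<And>x. \<bar>g x\<bar> \<le> N"
    and "\<And>x. \<bar>f x - g x\<bar> \<le> e"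
  shows "\<bar>kernel_left f x - kernel_left g x\<bar> \<le> e / 2"
  unfolding kernel_left_def by (rule kernel_right_dist) (auto intro: continuous_on_reflect assms)

lemma kernel_left_has_derivative:
  assumes "continuous_on UNIV f" "\<And>x. \<bar>f x\<bar> \<le> M"
  shows "(kernel_left f has_real_derivative f x / 2 - kernel_left f x) (at x)"
proof -
  have "(kernel_right (\<lambda>y. f (- y)) has_real_derivative kernel_right (\<lambda>y. f (- y)) (- x) - f (- (- x)) / 2) (at (- x))"
    by (rule kernel_right_has_derivative[OF continuous_on_reflect]) (use assms in auto)
  then have "((\<lambda>x. kernel_right (\<lambda>y. f (- y)) (- x)) has_real_derivative
     (kernel_right (\<lambda>y. f (- y)) (- x) - f (- (- x)) / 2) * (- 1)) (at x)"
    by (rule DERIV_chain2) (auto intro!: derivative_eq_intros)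
  then show ?thesis by (simp add: kernel_left_def[abs_def])
qed

text \<open>The exponential factorizes on each side of \<open>x\<close>. Both closed half-lines
  contain \<open>x\<close>, which is why the integrands agree only almost everywhere.\<close>

lemma convolution_rod_kernel:
  assumes f: "continuous_on UNIV f" "\<And>x. \<bar>f x\<bar> \<le> M"
  shows "convolution rod_kernel f x = kernel_left f x + kernel_right f x"
proof -
  have [measurable]: "f \<in> borel_measurable lborel"
    using f by (simp add: borel_measurable_continuous_onI)
  have iR: "integrable lborel (\<lambda>y. indicator {x..} y *\<^sub>R (exp (- y) * f y))"
    using set_integrable_kernel_right[OF f, of x] by (simp add: set_integrable_def)
  have "set_integrable lborel {- x..} (\<lambda>y. exp (- y) * f (- y))"
    by (rule set_integrable_kernel_right[OF continuous_on_reflect]) (use f in auto)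
  then have iL': "integrable lborel (\<lambda>y. indicator {- x..} y *\<^sub>R (exp (- y) * f (- y)))"
    by (simp add: set_integrable_def)
  have reflect: "indicator {- x..} (0 + - 1 * y) *\<^sub>R (exp (- (0 + - 1 * y)) * f (- (0 + - 1 * y)))
    = indicator {..x} y *\<^sub>R (exp y * f y)" for y
    by (auto simp: indicator_def)
  have iL: "integrable lborel (\<lambda>y. indicator {..x} y *\<^sub>R (exp y * f y))"
    using lborel_integrable_real_affine[OF iL', of "-1" 0] unfolding reflect by simp
  have L: "(LINT y:{- x..}|lborel. exp (- y) * f (- y)) = (LINT y|lborel. indicator {..x} y *\<^sub>R (exp y * f y))"
    unfolding set_lebesgue_integral_def
    by (subst lborel_integral_real_affine[of "-1" _ 0]) (simp_all only: reflect, simp_all)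
  have "convolution rod_kernel f x = (LINT y|lborel. exp (- x) / 2 * (indicator {..x} y *\<^sub>R (exp y * f y))
     + exp x / 2 * (indicator {x..} y *\<^sub>R (exp (- y) * f y)))"
    unfolding convolution_def
  proof (rule integral_cong_AE)
    show "AE y in lborel. rod_kernel (x - y) * f y = exp (- x) / 2 * (indicator {..x} y *\<^sub>R (exp y * f y))
     + exp x / 2 * (indicator {x..} y *\<^sub>R (exp (- y) * f y))"
      using AE_lborel_singleton[of x]
      by eventually_elim (auto simp: rod_kernel_def indicator_def abs_if exp_diff exp_minus field_simps)
  qed (unfold rod_kernel_def, measurable)
  also have "\<dots> = kernel_left f x + kernel_right f x"
    using iL iR by (simp add: kernel_left_def kernel_right_def L) (simp add: set_lebesgue_integral_def)
  finally show ?thesis .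
qed

section \<open>Ordinary differential equations\<close>

lemma continuous_on_of_real_derivative:
  fixes f :: "real \<Rightarrow> real"
  assumes "\<And>x. (f has_real_derivative f' x) (at x)"
  shows "continuous_on S f"
  by (rule DERIV_continuous_on[OF has_field_derivative_at_within[OF assms]])

text \<open>Integrating \<open>exp (K * \<bar>s - a\<bar>)\<close> gains the factor
  \<open>1 / K\<close>. A large \<open>K\<close> thus yields the contraction in
  \<open>Picard_Lindelof_global\<close> and the halving in \<open>zero_propagates\<close>. The
  closed segment covers both time directions.\<close>

lemma exponential_derivative_bound:
  fixes \<phi> :: "real \<Rightarrow> real"
  assumes K: "K > 0" and C: "C \<ge> 0"
    and der: "\<And>s. s \<in> closed_segment a b \<Longrightarrow> (\<phi> has_real_derivative \<phi>' s) (at s within closed_segment a b)"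
    and bound: "\<And>s. s \<in> closed_segment a b \<Longrightarrow> \<bar>\<phi>' s\<bar> \<le> C * exp (K * \<bar>s - a\<bar>)"
  shows "\<bar>\<phi> b - \<phi> a\<bar> \<le> C / K * exp (K * \<bar>b - a\<bar>)"
proof -
  have cont: "continuous_on (closed_segment a b) \<phi>"
    using der by (rule DERIV_continuous_on)
  have at: "(\<phi> has_real_derivative \<phi>' s) (at s)" if "s \<in> open_segment a b" for s
  proof -
    have "at s within closed_segment a b = at s"
    proof (rule at_within_interior)
      have "s \<in> interior {min a b..max a b}"
        using that by (auto simp: open_segment_eq_real_ivl interior_atLeastAtMost_real split: if_splits)
      then show "s \<in> interior (closed_segment a b)"
        by (auto simp: closed_segment_eq_real_ivl min_def max_def split: if_splits)
    qed
    then show ?thesis using der[of s] that by (simp add: open_segment_def)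
  qed
  consider "a < b" | "b < a" | "a = b" by linarith
  then show ?thesis
  proof cases
    case 1
    have "norm (\<phi> b - \<phi> a) \<le> C / K * exp (K * (b - a)) - C / K * exp (K * (a - a))"
    proof (rule differentiable_bound_general[OF 1, where f' = \<phi>' and \<phi>' = "\<lambda>s. C * exp (K * (s - a))"])
      show "(\<phi> has_vector_derivative \<phi>' s) (at s)" if "a < s" "s < b" for s
        using at[of s] that by (simp add: open_segment_eq_real_ivl has_real_derivative_iff_has_vector_derivative)
      show "((\<lambda>s. C / K * exp (K * (s - a))) has_vector_derivative C * exp (K * (s - a))) (at s)" for s
        using K unfolding has_real_derivative_iff_has_vector_derivative[symmetric]
        by (auto intro!: derivative_eq_intros)
      show "norm (\<phi>' s) \<le> C * exp (K * (s - a))" if "a < s" "s < b" for s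
        using bound[of s] that by (simp add: closed_segment_eq_real_ivl)
    qed (use cont 1 K in \<open>auto simp: closed_segment_eq_real_ivl intro!: continuous_intros\<close>)
    moreover have "0 \<le> C / K" using K C by simp
    ultimately show ?thesis using 1 by simp
  next
    case 2
    have "norm (\<phi> a - \<phi> b) \<le> - (C / K) * exp (K * (a - a)) - (- (C / K) * exp (K * (a - b)))"
    proof (rule differentiable_bound_general[OF 2, where f' = \<phi>' and \<phi>' = "\<lambda>s. C * exp (K * (a - s))"])
      show "(\<phi> has_vector_derivative \<phi>' s) (at s)" if "b < s" "s < a" for s
        using at[of s] that by (simp add: open_segment_eq_real_ivl has_real_derivative_iff_has_vector_derivative)
      show "((\<lambda>s. - (C / K) * exp (K * (a - s))) has_vector_derivative C * exp (K * (a - s))) (at s)" for s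
        using K unfolding has_real_derivative_iff_has_vector_derivative[symmetric]
        by (auto intro!: derivative_eq_intros)
      show "norm (\<phi>' s) \<le> C * exp (K * (a - s))" if "b < s" "s < a" for s
        using bound[of s] that by (simp add: closed_segment_eq_real_ivl)
    qed (use cont 2 K in \<open>auto simp: closed_segment_eq_real_ivl intro!: continuous_intros\<close>)
    moreover have "0 \<le> C / K" using K C by simp
    ultimately show ?thesis using 2 by simp
  next
    case 3
    then show ?thesis using K C by simp
  qed
qed

text \<open>Banach's fixed point theorem for the integral equation, in a sup norm weighted by
  \<open>exp (- (K * \<bar>t - t0\<bar>))\<close>. The weight gives a contraction on the whole line
  at once, with no gluing of local solutions.\<close>

theorem Picard_Lindelof_global:
  fixes F :: "real \<Rightarrow> real \<Rightarrow> real"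
  assumes cont: "continuous_on UNIV (\<lambda>(t, x). F t x)"
    and bound: "\<And>t x. \<bar>F t x\<bar> \<le> M"
    and Lip: "\<And>t x y. \<bar>F t x - F t y\<bar> \<le> L * \<bar>x - y\<bar>"
  obtains q where "q t0 = x0" "\<And>t. (q has_real_derivative F t (q t)) (at t)"
proof -
  have M: "0 \<le> M" using bound[of 0 0] by linarith
  have L: "0 \<le> L" using order_trans[OF abs_ge_zero Lip[of 0 0 1]] by simp
  \<comment> \<open>The contraction factor is \<open>L / K\<close>, which is below 1; the summand 1
    keeps \<open>K\<close> positive when \<open>L = 0\<close>.\<close>
  define K where "K = 2 * L + 1"
  have K: "K > 0" using L by (simp add: K_def)
  \<comment> \<open>The bounded function \<open>z\<close> stands for the trajectory divided by the
    weight \<open>exp (K * \<bar>s - t0\<bar>)\<close>, so \<open>F\<close> is evaluated at the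
    product. At the fixed point the weights cancel.\<close>
  define G where "G z s = F s (exp (K * \<bar>s - t0\<bar>) * apply_bcontfun z s)" for z s
  define I where "I z t = (LBINT s=t0..t. G z s)" for z and t :: real
  have Gc: "continuous_on S (G z)" for S z
  proof -
    have "continuous_on S (\<lambda>s. (case (s, exp (K * \<bar>s - t0\<bar>) * apply_bcontfun z s) of (t, x) \<Rightarrow> F t x))"
      by (rule continuous_on_compose2[OF cont]) (auto intro!: continuous_intros)
    then show ?thesis by (simp add: G_def[abs_def])
  qed
  have Ider: "(I z has_real_derivative G z t) (at t)" for z t
  proof -
    have "((\<lambda>v. LBINT s=t0..v. G z s) has_vector_derivative G z t) (at t within {min t t0 - 1..max t t0 + 1})"
      by (rule interval_integral_FTC2) (auto intro: Gc)
    moreover have "at t within {min t t0 - 1..max t t0 + 1} = at t"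
      by (rule at_within_interior) (auto simp: interior_atLeastAtMost_real)
    ultimately show ?thesis
      by (simp add: I_def[abs_def] has_real_derivative_iff_has_vector_derivative)
  qed
  have I0: "I z t0 = 0" for z by (simp add: I_def)
  have Ibound: "\<bar>I z t\<bar> \<le> M / K * exp (K * \<bar>t - t0\<bar>)" for z t
  proof -
    have "\<bar>I z t - I z t0\<bar> \<le> M / K * exp (K * \<bar>t - t0\<bar>)"
    proof (rule exponential_derivative_bound[OF K M])
      show "(I z has_real_derivative G z s) (at s within closed_segment t0 t)" for s
        using Ider by (rule has_field_derivative_at_within)
      have "\<bar>G z s\<bar> \<le> M * 1" for s using bound by (simp add: G_def)
      also have "M * 1 \<le> M * exp (K * \<bar>s - t0\<bar>)" for s using M K by (intro mult_left_mono) auto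
      finally show "\<bar>G z s\<bar> \<le> M * exp (K * \<bar>s - t0\<bar>)" for s .
    qed
    then show ?thesis by (simp add: I0)
  qed
  have Idist: "\<bar>I z t - I w t\<bar> \<le> L * dist z w / K * exp (K * \<bar>t - t0\<bar>)" for z w t
  proof -
    have "\<bar>(I z t - I w t) - (I z t0 - I w t0)\<bar> \<le> (L * dist z w) / K * exp (K * \<bar>t - t0\<bar>)"
    proof (rule exponential_derivative_bound[OF K])
      show "0 \<le> L * dist z w" using L by simp
      show "((\<lambda>t. I z t - I w t) has_real_derivative G z s - G w s) (at s within closed_segment t0 t)" for s
        by (rule DERIV_diff; rule has_field_derivative_at_within[OF Ider])
      show "\<bar>G z s - G w s\<bar> \<le> L * dist z w * exp (K * \<bar>s - t0\<bar>)" for s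
      proof -
        have "\<bar>G z s - G w s\<bar> \<le> L * \<bar>exp (K * \<bar>s - t0\<bar>) * apply_bcontfun z s - exp (K * \<bar>s - t0\<bar>) * apply_bcontfun w s\<bar>"
          unfolding G_def by (rule Lip)
        also have "\<dots> = L * (dist (apply_bcontfun z s) (apply_bcontfun w s) * exp (K * \<bar>s - t0\<bar>))"
          unfolding right_diff_distrib[symmetric] abs_mult by (simp add: dist_real_def)
        also have "\<dots> \<le> L * (dist z w * exp (K * \<bar>s - t0\<bar>))"
          using L by (intro mult_left_mono mult_right_mono dist_bounded) auto
        finally show ?thesis by (simp add: mult.assoc)
      qed
    qed
    then show ?thesis by (simp add: I0)
  qed
  define \<Phi> where "\<Phi> z = (\<lambda>t. exp (- (K * \<bar>t - t0\<bar>)) * (x0 + I z t))" for z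
  have "\<Phi> z \<in> bcontfun" for z
  proof -
    have "continuous_on UNIV (I z)" using Ider by (rule DERIV_continuous_on[OF has_field_derivative_at_within])
    then have c: "continuous_on UNIV (\<Phi> z)" unfolding \<Phi>_def by (intro continuous_intros)
    have "\<bar>\<Phi> z t\<bar> \<le> \<bar>x0\<bar> + M / K" for t
    proof -
      have "\<bar>\<Phi> z t\<bar> \<le> exp (- (K * \<bar>t - t0\<bar>)) * (\<bar>x0\<bar> + M / K * exp (K * \<bar>t - t0\<bar>))"
        unfolding \<Phi>_def abs_mult abs_exp_cancel
        using Ibound[of z t] by (intro mult_left_mono order_trans[OF abs_triangle_ineq]) auto
      also have "\<dots> = exp (- (K * \<bar>t - t0\<bar>)) * \<bar>x0\<bar> + M / K"
        by (simp add: distrib_left exp_minus)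
      also have "\<dots> \<le> 1 * \<bar>x0\<bar> + M / K" using K by (intro add_mono mult_right_mono) auto
      finally show ?thesis by simp
    qed
    then have "bounded (range (\<Phi> z))" by (auto simp: bounded_iff)
    with c show ?thesis by (simp add: bcontfun_def)
  qed
  then have app: "apply_bcontfun (Bcontfun (\<Phi> z)) = \<Phi> z" for z by (simp add: Bcontfun_inverse)
  have "\<exists>!z. Bcontfun (\<Phi> z) = z"
  proof (rule banach_fix_type)
    show "0 \<le> L / K" "L / K < 1" using L K by (auto simp: K_def)
    show "\<forall>z w. dist (Bcontfun (\<Phi> z)) (Bcontfun (\<Phi> w)) \<le> L / K * dist z w"
    proof (intro allI dist_bound)
      fix z w :: "real \<Rightarrow>\<^sub>C real" and t
      have "dist (\<Phi> z t) (\<Phi> w t) = exp (- (K * \<bar>t - t0\<bar>)) * \<bar>I z t - I w t\<bar>"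
        by (simp add: \<Phi>_def dist_real_def abs_mult flip: right_diff_distrib)
      also have "\<dots> \<le> exp (- (K * \<bar>t - t0\<bar>)) * (L * dist z w / K * exp (K * \<bar>t - t0\<bar>))"
        by (intro mult_left_mono Idist) auto
      also have "\<dots> = L / K * dist z w" by (simp add: exp_minus)
      finally show "dist (apply_bcontfun (Bcontfun (\<Phi> z)) t) (apply_bcontfun (Bcontfun (\<Phi> w)) t) \<le> L / K * dist z w"
        unfolding app .
    qed
  qed
  then obtain z where "Bcontfun (\<Phi> z) = z" by blast
  then have z: "apply_bcontfun z = \<Phi> z" using app by metis
  define q where "q t = x0 + I z t" for t
  have Gq: "G z t = F t (q t)" for t
    by (simp add: G_def z \<Phi>_def q_def flip: mult.assoc exp_add)
  have "(q has_real_derivative F t (q t)) (at t)" for t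
    unfolding q_def[abs_def] by (auto intro!: derivative_eq_intros Ider simp: Gq q_def)
  moreover have "q t0 = x0" by (simp add: q_def I0)
  ultimately show ?thesis using that by blast
qed

section \<open>Joint continuity and uniformity along curves\<close>

lemma continuous_on_Times_uniform:
  fixes h :: "real \<Rightarrow> real \<Rightarrow> real"
  assumes space: "\<And>t. t \<in> S \<Longrightarrow> continuous_on UNIV (h t)"
    and time: "\<And>t e. t \<in> S \<Longrightarrow> e > 0 \<Longrightarrow> \<exists>d>0. \<forall>\<tau>\<in>S. \<bar>\<tau> - t\<bar> < d \<longrightarrow> (\<forall>x. \<bar>h \<tau> x - h t x\<bar> < e)"
  shows "continuous_on (S \<times> UNIV) (\<lambda>(t, x). h t x)"
  unfolding continuous_on_iff
proof (intro ballI allI impI)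
  fix p :: "real \<times> real" and e :: real assume p: "p \<in> S \<times> UNIV" and e: "0 < e"
  obtain t x where tx: "p = (t, x)" "t \<in> S" using p by auto
  obtain d1 where d1: "d1 > 0" "\<And>\<tau> x. \<tau> \<in> S \<Longrightarrow> \<bar>\<tau> - t\<bar> < d1 \<Longrightarrow> \<bar>h \<tau> x - h t x\<bar> < e / 2"
    using time[OF tx(2), of "e / 2"] e by auto
  obtain d2 where d2: "d2 > 0" "\<And>y. \<bar>y - x\<bar> < d2 \<Longrightarrow> \<bar>h t y - h t x\<bar> < e / 2"
    using space[OF tx(2)] e unfolding continuous_on_iff dist_real_def by (metis UNIV_I half_gt_zero)
  show "\<exists>d>0. \<forall>p'\<in>S \<times> UNIV. dist p' p < d \<longrightarrow> dist (case p' of (t, x) \<Rightarrow> h t x) (case p of (t, x) \<Rightarrow> h t x) < e"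
  proof (intro exI[of _ "min d1 d2"] conjI ballI impI)
    fix p' assume p': "p' \<in> S \<times> (UNIV :: real set)" "dist p' p < min d1 d2"
    obtain \<tau> y where ty: "p' = (\<tau>, y)" "\<tau> \<in> S" using p' by auto
    have "\<bar>\<tau> - t\<bar> < d1" "\<bar>y - x\<bar> < d2"
      using p'(2) dist_fst_le[of p' p] dist_snd_le[of p' p] by (auto simp: tx ty dist_real_def)
    then have "\<bar>h \<tau> y - h t y\<bar> < e / 2" "\<bar>h t y - h t x\<bar> < e / 2"
      using d1(2)[OF ty(2)] d2(2) by auto
    then have "\<bar>h \<tau> y - h t x\<bar> < e" by linarith
    then show "dist (case p' of (t, x) \<Rightarrow> h t x) (case p of (t, x) \<Rightarrow> h t x) < e"
      by (simp add: tx ty dist_real_def)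
  qed (use d1 d2 in auto)
qed

text \<open>Uniform continuity on a compact box containing the curve, enlarged by 1 in space so that
  the neighbouring points \<open>y\<close> stay inside.\<close>

lemma uniform_along_curve:
  fixes h :: "real \<Rightarrow> real \<Rightarrow> real"
  assumes h: "continuous_on ({0..} \<times> UNIV) (\<lambda>(t, x). h t x)"
    and q: "continuous_on {0..T} q" and e: "e > 0"
  shows "\<exists>d>0. \<forall>t\<in>{0..T}. \<forall>y. \<bar>y - q t\<bar> < d \<longrightarrow> \<bar>h t y - h t (q t)\<bar> < e"
proof -
  have "bounded (q ` {0..T})"
    by (intro compact_imp_bounded compact_continuous_image q) auto
  then obtain R where R: "\<And>t. t \<in> {0..T} \<Longrightarrow> \<bar>q t\<bar> \<le> R"
    by (metis bounded_iff imageI real_norm_def)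
  have "uniformly_continuous_on ({0..T} \<times> {-R-1..R+1}) (\<lambda>(t, x). h t x)"
    by (intro compact_uniformly_continuous continuous_on_subset[OF h] compact_Times) auto
  then obtain d where d: "d > 0" "\<And>p p'. p \<in> {0..T} \<times> {-R-1..R+1} \<Longrightarrow> p' \<in> {0..T} \<times> {-R-1..R+1} \<Longrightarrow> dist p' p < d
    \<Longrightarrow> dist (case p' of (t, x) \<Rightarrow> h t x) (case p of (t, x) \<Rightarrow> h t x) < e"
    unfolding uniformly_continuous_on_def using e by metis
  show ?thesis
  proof (intro exI[of _ "min d 1"] conjI ballI allI impI)
    fix t y assume t: "t \<in> {0..T}" and y: "\<bar>y - q t\<bar> < min d 1"
    have "q t \<in> {-R-1..R+1}" "y \<in> {-R-1..R+1}" using R[OF t] y by auto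
    then show "\<bar>h t y - h t (q t)\<bar> < e"
      using d(2)[of "(t, q t)" "(t, y)"] t y by (auto simp: dist_Pair_Pair dist_real_def)
  qed (use d in auto)
qed

section \<open>Lower bounds for the two halves of the convolution\<close>

text \<open>By monotonicity \<open>R x \<ge> R z \<ge> - C * exp z\<close> for every
  \<open>z \<le> x\<close>, and the last term vanishes as \<open>z\<close> tends to minus
  infinity.\<close>

lemma nonneg_of_increasing_at_bot:
  fixes R :: "real \<Rightarrow> real"
  assumes der: "\<And>x. (R has_real_derivative R' x) (at x)" and pos: "\<And>x. 0 \<le> R' x"
    and lower: "\<And>x. - C * exp x \<le> R x"
  shows "0 \<le> R x"
proof -
  have "((\<lambda>z. - C * exp z) \<longlongrightarrow> - C * 0) at_bot"
    by (intro tendsto_intros exp_at_bot)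
  moreover have "eventually (\<lambda>z. - C * exp z \<le> R x) at_bot"
    using eventually_le_at_bot[of x]
  proof eventually_elim
    case (elim z)
    have "R z \<le> R x" using elim by (rule DERIV_nonneg_imp_nondecreasing) (use der pos in blast)
    then show ?case using lower[of z] by linarith
  qed
  ultimately show ?thesis using tendsto_upperbound[of "\<lambda>z. - C * exp z" "- C * 0" at_bot "R x"] by simp
qed

text \<open>\<open>exp x * kernel_left f x\<close> has derivative \<open>exp x * f x / 2\<close>, so
  \<open>ge\<close> says precisely that \<open>R\<close> is nondecreasing. Boundedness of
  \<open>v\<close> and \<open>f\<close> provides the lower bound at minus infinity.\<close>

lemma kernel_left_lower_bound:
  fixes v v' f :: "real \<Rightarrow> real"
  assumes v: "\<And>x. (v has_real_derivative v' x) (at x)" and vM: "\<And>x. \<bar>v x\<bar> \<le> M"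
    and f: "continuous_on UNIV f" "\<And>x. \<bar>f x\<bar> \<le> N"
    and ge: "\<And>x. c * ((v x)\<^sup>2 + 2 * (v x * v' x)) \<le> f x / 2"
  shows "c * (v x)\<^sup>2 \<le> kernel_left f x"
proof -
  define R where "R x = exp x * (kernel_left f x - c * (v x)\<^sup>2)" for x
  have "0 \<le> R x"
  proof (rule nonneg_of_increasing_at_bot[where R = R])
    show "(R has_real_derivative exp x * (f x / 2 - c * ((v x)\<^sup>2 + 2 * (v x * v' x)))) (at x)" for x
      unfolding R_def
      by (auto intro!: derivative_eq_intros kernel_left_has_derivative[OF f] v simp: algebra_simps power2_eq_square)
    show "0 \<le> exp x * (f x / 2 - c * ((v x)\<^sup>2 + 2 * (v x * v' x)))" for x
      using ge[of x] by simp
    show "- (N / 2 + \<bar>c\<bar> * M\<^sup>2) * exp x \<le> R x" for x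
    proof -
      have "(v x)\<^sup>2 \<le> M\<^sup>2" using vM[of x] by (metis abs_ge_zero power2_abs power_mono)
      then have "c * (v x)\<^sup>2 \<le> \<bar>c\<bar> * M\<^sup>2"
        by (intro mult_mono) auto
      then have "- (N / 2 + \<bar>c\<bar> * M\<^sup>2) \<le> kernel_left f x - c * (v x)\<^sup>2"
        using abs_kernel_left_le[OF f, of x] by linarith
      then have "exp x * (- (N / 2 + \<bar>c\<bar> * M\<^sup>2)) \<le> R x" unfolding R_def by (rule mult_left_mono) simp
      then show ?thesis by (simp only: mult.commute)
    qed
  qed
  then show ?thesis by (simp add: R_def zero_le_mult_iff)
qed

lemma kernel_right_lower_bound:
  fixes v v' f :: "real \<Rightarrow> real"
  assumes v: "\<And>x. (v has_real_derivative v' x) (at x)" and vM: "\<And>x. \<bar>v x\<bar> \<le> M"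
    and f: "continuous_on UNIV f" "\<And>x. \<bar>f x\<bar> \<le> N"
    and ge: "\<And>x. c * ((v x)\<^sup>2 - 2 * (v x * v' x)) \<le> f x / 2"
  shows "c * (v x)\<^sup>2 \<le> kernel_right f x"
proof -
  have "c * (v (- (- x)))\<^sup>2 \<le> kernel_left (\<lambda>y. f (- y)) (- x)"
  proof (rule kernel_left_lower_bound[of "\<lambda>y. v (- y)" "\<lambda>y. - v' (- y)"])
    show "((\<lambda>y. v (- y)) has_real_derivative - v' (- x)) (at x)" for x
      by (rule DERIV_cong[OF DERIV_chain2[where f = v and g = uminus, OF v]]) (auto intro!: derivative_eq_intros)
    show "c * ((v (- x))\<^sup>2 + 2 * (v (- x) * - v' (- x))) \<le> f (- x) / 2" for x
      using ge[of "- x"] by simp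
  qed (use vM f in \<open>auto intro: continuous_on_reflect\<close>)
  then show ?thesis by (simp add: kernel_left_def)
qed

section \<open>Differential inequalities on a compact time interval\<close>

lemma nondecreasing_within_interval:
  fixes f :: "real \<Rightarrow> real"
  assumes "a \<le> b"
    and der: "\<And>x. x \<in> {a..b} \<Longrightarrow> (f has_real_derivative f' x) (at x within {a..b})"
    and pos: "\<And>x. x \<in> {a..b} \<Longrightarrow> 0 \<le> f' x"
  shows "f a \<le> f b"
proof (cases "a = b")
  case False
  then have "a < b" using assms(1) by simp
  then obtain x where "x \<in> {a<..<b}" "f b - f a = f' x * (b - a)"
    using mvt_simple[of a b f "\<lambda>x. (*) (f' x)"] der unfolding has_field_derivative_def by auto
  then show ?thesis using pos[of x] \<open>a < b\<close> by (smt (verit) atLeastAtMost_iff greaterThanLessThan_iff mult_nonneg_nonneg)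
qed simp

text \<open>Integrating factor: with \<open>E\<close> an antiderivative of \<open>c\<close>, the
  function \<open>y * exp (- E)\<close> is nondecreasing.\<close>

lemma linear_differential_inequality_pos:
  fixes y :: "real \<Rightarrow> real"
  assumes "a \<le> b" and c: "continuous_on {a..b} c"
    and der: "\<And>t. t \<in> {a..b} \<Longrightarrow> (y has_real_derivative y' t) (at t within {a..b})"
    and ge: "\<And>t. t \<in> {a..b} \<Longrightarrow> c t * y t \<le> y' t"
    and y0: "0 < y a" and t: "t \<in> {a..b}"
  shows "0 < y t"
proof -
  obtain E where E: "\<And>t. t \<in> {a..b} \<Longrightarrow> (E has_vector_derivative c t) (at t within {a..b})"
    using antiderivative_continuous[OF c] by blast
  have "y a * exp (- E a) \<le> y t * exp (- E t)"
  proof (rule nondecreasing_within_interval[where f = "\<lambda>s. y s * exp (- E s)" and f' = "\<lambda>s. (y' s - c s * y s) * exp (- E s)"])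
    fix s assume "s \<in> {a..t}"
    then have s: "s \<in> {a..b}" using t by auto
    have "((\<lambda>s. y s * exp (- E s)) has_real_derivative (y' s - c s * y s) * exp (- E s)) (at s within {a..b})"
      using E[OF s] der[OF s] unfolding has_real_derivative_iff_has_vector_derivative[symmetric]
      by (auto intro!: derivative_eq_intros simp: algebra_simps)
    then show "((\<lambda>s. y s * exp (- E s)) has_real_derivative (y' s - c s * y s) * exp (- E s)) (at s within {a..t})"
      by (rule DERIV_subset) (use t in auto)
    show "0 \<le> (y' s - c s * y s) * exp (- E s)" using ge[OF s] by simp
  qed (use t in auto)
  moreover have "0 < y a * exp (- E a)" using y0 by simp
  ultimately have "0 < y t * exp (- E t)" by linarith
  then show ?thesis by (simp add: zero_less_mult_iff)
qed

text \<open>With \<open>r = - B / A > 0\<close>, the sum \<open>1/A - 1/B\<close> decreases at rate at least \<open>g (r + 1/r) \<ge> 2 g\<close>.\<close>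

lemma riccati_pair_lifespan:
  fixes A B :: "real \<Rightarrow> real"
  assumes g: "g > 0" and "t0 \<le> T" and A0: "A t0 > 0" and B0: "B t0 < 0"
    and dA: "\<And>t. t \<in> {t0..T} \<Longrightarrow> (A has_real_derivative A' t) (at t within {t0..T})"
    and dB: "\<And>t. t \<in> {t0..T} \<Longrightarrow> (B has_real_derivative B' t) (at t within {t0..T})"
    and A': "\<And>t. t \<in> {t0..T} \<Longrightarrow> A' t \<ge> - g * (A t * B t)"
    and B': "\<And>t. t \<in> {t0..T} \<Longrightarrow> B' t \<le> g * (A t * B t)"
  shows "2 * g * (T - t0) < 1 / A t0 - 1 / B t0"
proof -
  have cA: "continuous_on {t0..T} A" and cB: "continuous_on {t0..T} B"
    using DERIV_continuous_on[OF dA] DERIV_continuous_on[OF dB] by blast+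
  \<comment> \<open>The inequality for \<open>A\<close> is linear in \<open>A\<close> with
    coefficient \<open>- g * B\<close>, so positivity persists whatever the sign of
    \<open>B\<close>. The same holds for \<open>- B\<close> with coefficient \<open>g * A\<close>,
    so the two sign claims are independent.\<close>
  have Apos: "0 < A t" if "t \<in> {t0..T}" for t
    by (rule linear_differential_inequality_pos[OF assms(2) _ dA, where c = "\<lambda>t. - g * B t"])
      (use that A0 A' in \<open>auto intro!: continuous_intros cB simp: mult_ac\<close>)
  have Bneg: "0 < - B t" if "t \<in> {t0..T}" for t
    by (rule linear_differential_inequality_pos[OF assms(2) _ DERIV_minus[OF dB], where c = "\<lambda>t. g * A t"])
      (use that B0 B' in \<open>auto intro!: continuous_intros cA simp: mult_ac\<close>)
  define H where "H t = - (1 / A t) + 1 / B t - 2 * g * t" for t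
  have "H t0 \<le> H T"
  proof (rule nondecreasing_within_interval[OF assms(2), where f = H])
    fix t assume t: "t \<in> {t0..T}"
    have a: "A t > 0" and b: "B t < 0" using Apos[OF t] Bneg[OF t] by auto
    show "(H has_real_derivative A' t / (A t)\<^sup>2 - B' t / (B t)\<^sup>2 - 2 * g) (at t within {t0..T})"
      unfolding H_def using a b
      by (auto intro!: derivative_eq_intros dA[OF t] dB[OF t] simp: power2_eq_square)
    have "- g * (A t * B t) / (A t)\<^sup>2 \<le> A' t / (A t)\<^sup>2" "B' t / (B t)\<^sup>2 \<le> g * (A t * B t) / (B t)\<^sup>2"
      using A'[OF t] B'[OF t] by (intro divide_right_mono; simp)+
    moreover have "- g * (A t * B t) / (A t)\<^sup>2 - g * (A t * B t) / (B t)\<^sup>2 - 2 * g = g * (A t + B t)\<^sup>2 / (- (A t * B t))"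
      using a b by (simp add: field_simps power2_eq_square)
    moreover have "0 \<le> g * (A t + B t)\<^sup>2 / (- (A t * B t))"
      using a b g by (intro divide_nonneg_nonneg) (auto simp: mult_le_0_iff)
    ultimately show "0 \<le> A' t / (A t)\<^sup>2 - B' t / (B t)\<^sup>2 - 2 * g" by linarith
  qed
  \<comment> \<open>At time \<open>T\<close> the sum \<open>1/A - 1/B\<close> is still positive, so
    its total decrease is less than its initial value.\<close>
  moreover have "0 < 1 / A T" "1 / B T < 0" using Apos[of T] Bneg[of T] assms(2) by auto
  ultimately show ?thesis unfolding H_def right_diff_distrib by linarith
qed

section \<open>Classical solutions and characteristics\<close>

text \<open>The time assumptions are uniform in space because they are applied at points that move
  with time. Differentiability in time is stated as a bound on the first-order remainder, which also
  makes sense at \<open>\<tau> = t\<close>.\<close>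

locale classical_rod_solution =
  fixes \<gamma> :: real and u ux :: "real \<Rightarrow> real \<Rightarrow> real"
  assumes \<gamma>_ge: "1 \<le> \<gamma>" and \<gamma>_le: "\<gamma> \<le> 4"
    and space_derivative: "0 \<le> t \<Longrightarrow> (u t has_real_derivative ux t x) (at x)"
    and continuous_ux: "0 \<le> t \<Longrightarrow> continuous_on UNIV (ux t)"
    and bounded_slice: "0 \<le> t \<Longrightarrow> \<exists>M. \<forall>x. \<bar>u t x\<bar> \<le> M \<and> \<bar>ux t x\<bar> \<le> M"
    and time_continuous: "0 \<le> t \<Longrightarrow> 0 < e \<Longrightarrow>
      \<exists>d>0. \<forall>\<tau>\<ge>0. \<bar>\<tau> - t\<bar> < d \<longrightarrow> (\<forall>x. \<bar>u \<tau> x - u t x\<bar> < e \<and> \<bar>ux \<tau> x - ux t x\<bar> < e)"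
    and time_derivative: "0 \<le> t \<Longrightarrow> 0 < e \<Longrightarrow>
      \<exists>d>0. \<forall>\<tau>\<ge>0. \<bar>\<tau> - t\<bar> < d \<longrightarrow> (\<forall>x.
        \<bar>u \<tau> x - u t x - (\<tau> - t) * (- \<gamma> * u t x * ux t x - deriv (convolution rod_kernel
            (\<lambda>y. (3 - \<gamma>) / 2 * (u t y)\<^sup>2 + \<gamma> / 2 * (ux t y)\<^sup>2)) x)\<bar> \<le> e * \<bar>\<tau> - t\<bar>)"
begin

definition source :: "real \<Rightarrow> real \<Rightarrow> real"
  where "source t x = (3 - \<gamma>) / 2 * (u t x)\<^sup>2 + \<gamma> / 2 * (ux t x)\<^sup>2"

definition Pl :: "real \<Rightarrow> real \<Rightarrow> real" where "Pl t = kernel_left (source t)"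
definition Pr :: "real \<Rightarrow> real \<Rightarrow> real" where "Pr t = kernel_right (source t)"

text \<open>The time derivative of \<open>u\<close> with the nonlocal term made explicit:
  \<open>Pl\<close> has derivative \<open>source / 2 - Pl\<close> and \<open>Pr\<close> has
  derivative \<open>Pr - source / 2\<close>, so in the derivative of \<open>Pl + Pr\<close> the
  source cancels.\<close>

definition ut :: "real \<Rightarrow> real \<Rightarrow> real"
  where "ut t x = - \<gamma> * u t x * ux t x + Pl t x - Pr t x"

lemma continuous_u: "0 \<le> t \<Longrightarrow> continuous_on UNIV (u t)"
  by (rule continuous_on_of_real_derivative[OF space_derivative])

lemma continuous_source: "0 \<le> t \<Longrightarrow> continuous_on UNIV (source t)"
  unfolding source_def[abs_def] by (intro continuous_intros continuous_u continuous_ux)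

text \<open>Bisection of \<open>{0..T}\<close>: a bound on one slice extends to nearby times by
  uniform continuity in time, and bounds on adjacent intervals combine by their maximum.\<close>

lemma locally_bounded:
  assumes "0 \<le> T"
  obtains M where "0 \<le> M" "\<And>t x. t \<in> {0..T} \<Longrightarrow> \<bar>u t x\<bar> \<le> M" "\<And>t x. t \<in> {0..T} \<Longrightarrow> \<bar>ux t x\<bar> \<le> M"
proof -
  define B where "B a b \<longleftrightarrow> (\<exists>M. \<forall>t\<in>{a..b}. 0 \<le> t \<longrightarrow> (\<forall>x. \<bar>u t x\<bar> \<le> M \<and> \<bar>ux t x\<bar> \<le> M))" for a b
  have "B 0 T"
  proof (rule Bolzano[OF assms])
    fix a b c assume "B a b" "B b c" "a \<le> b" "b \<le> c"
    then obtain M N where M: "\<forall>t\<in>{a..b}. 0 \<le> t \<longrightarrow> (\<forall>x. \<bar>u t x\<bar> \<le> M \<and> \<bar>ux t x\<bar> \<le> M)"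
      and N: "\<forall>t\<in>{b..c}. 0 \<le> t \<longrightarrow> (\<forall>x. \<bar>u t x\<bar> \<le> N \<and> \<bar>ux t x\<bar> \<le> N)"
      unfolding B_def by blast
    have "\<forall>t\<in>{a..c}. 0 \<le> t \<longrightarrow> (\<forall>x. \<bar>u t x\<bar> \<le> max M N \<and> \<bar>ux t x\<bar> \<le> max M N)"
    proof (intro ballI impI allI)
      fix t x assume "t \<in> {a..c}" "0 \<le> t"
      then show "\<bar>u t x\<bar> \<le> max M N \<and> \<bar>ux t x\<bar> \<le> max M N"
        using M N by (cases "t \<le> b") (auto simp: le_max_iff_disj)
    qed
    then show "B a c" unfolding B_def by blast
  next
    fix t assume "0 \<le> t" "t \<le> T"
    obtain M where M: "\<And>x. \<bar>u t x\<bar> \<le> M" "\<And>x. \<bar>ux t x\<bar> \<le> M"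
      using bounded_slice[OF \<open>0 \<le> t\<close>] by blast
    obtain d where d: "d > 0" "\<And>\<tau> x. 0 \<le> \<tau> \<Longrightarrow> \<bar>\<tau> - t\<bar> < d \<Longrightarrow> \<bar>u \<tau> x - u t x\<bar> < 1 \<and> \<bar>ux \<tau> x - ux t x\<bar> < 1"
      using time_continuous[OF \<open>0 \<le> t\<close>, of 1] by auto
    have "\<bar>u \<tau> x\<bar> \<le> M + 1 \<and> \<bar>ux \<tau> x\<bar> \<le> M + 1" if "0 \<le> \<tau>" "\<bar>\<tau> - t\<bar> < d" for \<tau> x
      using d(2)[OF that, of x] M[of x] by linarith
    then have "\<forall>a b. a \<le> t \<and> t \<le> b \<and> b - a < d \<longrightarrow> B a b"
      unfolding B_def by (intro allI impI exI[of _ "M + 1"]) auto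
    then show "\<exists>d>0. \<forall>a b. a \<le> t \<and> t \<le> b \<and> b - a < d \<longrightarrow> B a b" using d(1) by blast
  qed
  then obtain M where M: "\<forall>t\<in>{0..T}. 0 \<le> t \<longrightarrow> (\<forall>x. \<bar>u t x\<bar> \<le> M \<and> \<bar>ux t x\<bar> \<le> M)"
    unfolding B_def by blast
  moreover have "0 \<le> M" using M assms by (metis abs_ge_zero atLeastAtMost_iff order_refl order_trans)
  ultimately show ?thesis using that by auto
qed

text \<open>Two separate bounds make the estimate bilinear: in \<open>zero_propagates\<close> the
  first is a fixed bound on the solution and the second a small one, so the quadratic source is
  estimated linearly. The 3 is \<open>1 + 2\<close>, from
  \<open>\<bar>3 - \<gamma>\<bar> / 2 \<le> 1\<close> and
  \<open>\<gamma> / 2 \<le> 2\<close>.\<close>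

lemma abs_source_le:
  assumes "\<bar>u t x\<bar> \<le> a" "\<bar>ux t x\<bar> \<le> a" "\<bar>u t x\<bar> \<le> b" "\<bar>ux t x\<bar> \<le> b"
  shows "\<bar>source t x\<bar> \<le> 3 * (a * b)"
proof -
  have a: "0 \<le> a" and b: "0 \<le> b" using assms by linarith+
  have 1: "(u t x)\<^sup>2 \<le> a * b" "(ux t x)\<^sup>2 \<le> a * b"
    using mult_mono[OF assms(1,3) a] mult_mono[OF assms(2,4) a] by (auto simp: power2_eq_square)
  have "\<bar>source t x\<bar> \<le> \<bar>(3 - \<gamma>) / 2\<bar> * (u t x)\<^sup>2 + \<bar>\<gamma> / 2\<bar> * (ux t x)\<^sup>2"
    unfolding source_def by (rule order_trans[OF abs_triangle_ineq]) (simp add: abs_mult)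
  also have "\<dots> \<le> 1 * (a * b) + 2 * (a * b)"
    using \<gamma>_ge \<gamma>_le 1 by (intro add_mono mult_mono) auto
  finally show ?thesis by simp
qed

lemma bounded_source: "0 \<le> t \<Longrightarrow> \<exists>N. \<forall>x. \<bar>source t x\<bar> \<le> N"
  using bounded_slice[of t] abs_source_le[of t] by metis

lemma time_continuous_source:
  assumes t: "0 \<le> t" and e: "0 < e"
  shows "\<exists>d>0. \<forall>\<tau>\<in>{0..}. \<bar>\<tau> - t\<bar> < d \<longrightarrow> (\<forall>x. \<bar>source \<tau> x - source t x\<bar> < e)"
proof -
  obtain M where M0: "0 \<le> M" and M: "\<And>s x. s \<in> {0..t+1} \<Longrightarrow> \<bar>u s x\<bar> \<le> M" "\<And>s x. s \<in> {0..t+1} \<Longrightarrow> \<bar>ux s x\<bar> \<le> M"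
    using locally_bounded[of "t + 1"] t by auto
  \<comment> \<open>The two coefficients, at most 1 and 2, each multiply a difference of squares of
    size at most \<open>2 * M * e'\<close>, in total \<open>6 * M * e'\<close>. The added 1 makes
    the final inequality strict and covers \<open>M = 0\<close>.\<close>
  define e' where "e' = e / (6 * M + 1)"
  have e': "0 < e'" using e M0 by (simp add: e'_def)
  obtain d where d: "d > 0" "\<And>\<tau> x. 0 \<le> \<tau> \<Longrightarrow> \<bar>\<tau> - t\<bar> < d \<Longrightarrow> \<bar>u \<tau> x - u t x\<bar> < e' \<and> \<bar>ux \<tau> x - ux t x\<bar> < e'"
    using time_continuous[OF t e'] by blast
  have sq: "\<bar>a\<^sup>2 - b\<^sup>2\<bar> \<le> e' * (2 * M)" if "\<bar>a\<bar> \<le> M" "\<bar>b\<bar> \<le> M" "\<bar>a - b\<bar> < e'" for a b :: real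
  proof -
    have "\<bar>a\<^sup>2 - b\<^sup>2\<bar> = \<bar>a - b\<bar> * \<bar>a + b\<bar>"
      by (simp add: power2_eq_square square_diff_square_factored abs_mult mult.commute)
    also have "\<dots> \<le> e' * (2 * M)" using that e' by (intro mult_mono) auto
    finally show ?thesis .
  qed
  show ?thesis
  proof (intro exI[of _ "min d 1"] conjI ballI impI allI)
    fix \<tau> x assume \<tau>: "\<tau> \<in> {0..}" "\<bar>\<tau> - t\<bar> < min d 1"
    have s: "\<tau> \<in> {0..t+1}" "t \<in> {0..t+1}" using \<tau> t by auto
    have 1: "\<bar>(u \<tau> x)\<^sup>2 - (u t x)\<^sup>2\<bar> \<le> e' * (2 * M)" "\<bar>(ux \<tau> x)\<^sup>2 - (ux t x)\<^sup>2\<bar> \<le> e' * (2 * M)"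
      using d(2)[of \<tau> x] \<tau> s by (auto intro!: sq M)
    have "\<bar>source \<tau> x - source t x\<bar> = \<bar>(3 - \<gamma>) / 2 * ((u \<tau> x)\<^sup>2 - (u t x)\<^sup>2) + \<gamma> / 2 * ((ux \<tau> x)\<^sup>2 - (ux t x)\<^sup>2)\<bar>"
      by (simp add: source_def algebra_simps)
    also have "\<dots> \<le> \<bar>(3 - \<gamma>) / 2\<bar> * \<bar>(u \<tau> x)\<^sup>2 - (u t x)\<^sup>2\<bar> + \<bar>\<gamma> / 2\<bar> * \<bar>(ux \<tau> x)\<^sup>2 - (ux t x)\<^sup>2\<bar>"
      by (rule order_trans[OF abs_triangle_ineq]) (simp add: abs_mult)
    also have "\<dots> \<le> 1 * (e' * (2 * M)) + 2 * (e' * (2 * M))"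
      using \<gamma>_ge \<gamma>_le 1 by (intro add_mono mult_mono) auto
    also have "\<dots> = e * (6 * M / (6 * M + 1))" by (simp add: e'_def)
    also have "\<dots> < e * 1" using e M0 by (intro mult_strict_left_mono) auto
    finally show "\<bar>source \<tau> x - source t x\<bar> < e" by simp
  qed (use d in auto)
qed

lemma Pl_has_derivative: "0 \<le> t \<Longrightarrow> (Pl t has_real_derivative source t x / 2 - Pl t x) (at x)"
  unfolding Pl_def using kernel_left_has_derivative[OF continuous_source] bounded_source by blast

lemma Pr_has_derivative: "0 \<le> t \<Longrightarrow> (Pr t has_real_derivative Pr t x - source t x / 2) (at x)"
  unfolding Pr_def using kernel_right_has_derivative[OF continuous_source] bounded_source by blast

lemma deriv_convolution:
  assumes t: "0 \<le> t"
  shows "deriv (convolution rod_kernel (\<lambda>y. (3 - \<gamma>) / 2 * (u t y)\<^sup>2 + \<gamma> / 2 * (ux t y)\<^sup>2)) x = Pr t x - Pl t x"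
proof -
  have "convolution rod_kernel (source t) = (\<lambda>x. Pl t x + Pr t x)"
    unfolding Pl_def Pr_def using convolution_rod_kernel[OF continuous_source[OF t]] bounded_source[OF t] by blast
  moreover have "((\<lambda>x. Pl t x + Pr t x) has_real_derivative Pr t x - Pl t x) (at x)"
    using DERIV_add[OF Pl_has_derivative[OF t, of x] Pr_has_derivative[OF t, of x]] by simp
  ultimately show ?thesis by (simp add: source_def[abs_def] DERIV_imp_deriv)
qed

lemma joint_ux: "continuous_on ({0..} \<times> UNIV) (\<lambda>(t, x). ux t x)"
proof (rule continuous_on_Times_uniform)
  fix t e :: real assume "t \<in> {0..}" "0 < e"
  then show "\<exists>d>0. \<forall>\<tau>\<in>{0..}. \<bar>\<tau> - t\<bar> < d \<longrightarrow> (\<forall>x. \<bar>ux \<tau> x - ux t x\<bar> < e)"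
    using time_continuous[of t e] by auto
qed (simp add: continuous_ux)

lemma joint_u: "continuous_on ({0..} \<times> UNIV) (\<lambda>(t, x). u t x)"
proof (rule continuous_on_Times_uniform)
  fix t e :: real assume "t \<in> {0..}" "0 < e"
  then show "\<exists>d>0. \<forall>\<tau>\<in>{0..}. \<bar>\<tau> - t\<bar> < d \<longrightarrow> (\<forall>x. \<bar>u \<tau> x - u t x\<bar> < e)"
    using time_continuous[of t e] by auto
qed (simp add: continuous_u)

lemma joint_source: "continuous_on ({0..} \<times> UNIV) (\<lambda>(t, x). source t x)"
  by (rule continuous_on_Times_uniform) (auto simp: continuous_source time_continuous_source)

lemma time_continuous_P:
  assumes t: "0 \<le> t" and e: "0 < e"
  shows "\<exists>d>0. \<forall>\<tau>\<in>{0..}. \<bar>\<tau> - t\<bar> < d \<longrightarrow> (\<forall>x. \<bar>Pl \<tau> x - Pl t x\<bar> < e \<and> \<bar>Pr \<tau> x - Pr t x\<bar> < e)"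
proof -
  obtain d where d: "d > 0" "\<And>\<tau> x. 0 \<le> \<tau> \<Longrightarrow> \<bar>\<tau> - t\<bar> < d \<Longrightarrow> \<bar>source \<tau> x - source t x\<bar> < e"
    using time_continuous_source[OF t e] by auto
  have "\<bar>Pl \<tau> x - Pl t x\<bar> < e \<and> \<bar>Pr \<tau> x - Pr t x\<bar> < e" if \<tau>: "0 \<le> \<tau>" "\<bar>\<tau> - t\<bar> < d" for \<tau> x
  proof -
    obtain M N where M: "\<And>x. \<bar>source \<tau> x\<bar> \<le> M" and N: "\<And>x. \<bar>source t x\<bar> \<le> N"
      using bounded_source[OF t] bounded_source[OF \<tau>(1)] by blast
    have "\<bar>source \<tau> x - source t x\<bar> \<le> e" for x using d(2)[OF \<tau>] by (rule less_imp_le)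
    then have "\<bar>Pl \<tau> x - Pl t x\<bar> \<le> e / 2" "\<bar>Pr \<tau> x - Pr t x\<bar> \<le> e / 2"
      unfolding Pl_def Pr_def
      using kernel_left_dist[OF continuous_source[OF \<tau>(1)] M continuous_source[OF t] N]
        kernel_right_dist[OF continuous_source[OF \<tau>(1)] M continuous_source[OF t] N] by blast+
    then show ?thesis using e by linarith
  qed
  then show ?thesis using d(1) by auto
qed

lemma continuous_Pl: "0 \<le> t \<Longrightarrow> continuous_on UNIV (Pl t)"
  and continuous_Pr: "0 \<le> t \<Longrightarrow> continuous_on UNIV (Pr t)"
  by (rule continuous_on_of_real_derivative[OF Pl_has_derivative]
      continuous_on_of_real_derivative[OF Pr_has_derivative], assumption)+

lemma joint_Pl: "continuous_on ({0..} \<times> UNIV) (\<lambda>(t, x). Pl t x)"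
proof (rule continuous_on_Times_uniform)
  fix t e :: real assume "t \<in> {0..}" "0 < e"
  then show "\<exists>d>0. \<forall>\<tau>\<in>{0..}. \<bar>\<tau> - t\<bar> < d \<longrightarrow> (\<forall>x. \<bar>Pl \<tau> x - Pl t x\<bar> < e)"
    using time_continuous_P[of t e] by auto
qed (simp add: continuous_Pl)

lemma joint_Pr: "continuous_on ({0..} \<times> UNIV) (\<lambda>(t, x). Pr t x)"
proof (rule continuous_on_Times_uniform)
  fix t e :: real assume "t \<in> {0..}" "0 < e"
  then show "\<exists>d>0. \<forall>\<tau>\<in>{0..}. \<bar>\<tau> - t\<bar> < d \<longrightarrow> (\<forall>x. \<bar>Pr \<tau> x - Pr t x\<bar> < e)"
    using time_continuous_P[of t e] by auto
qed (simp add: continuous_Pr)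

lemma continuous_ut: "0 \<le> t \<Longrightarrow> continuous_on UNIV (ut t)"
  unfolding ut_def[abs_def] by (intro continuous_intros continuous_u continuous_ux continuous_Pl continuous_Pr)

lemma characteristic_exists:
  assumes T: "0 \<le> T"
  obtains q where "q t0 = x0" "\<And>t. t \<in> {0..T} \<Longrightarrow> (q has_real_derivative \<gamma> * u t (q t)) (at t within {0..T})"
proof -
  obtain M where M: "0 \<le> M" "\<And>t x. t \<in> {0..T} \<Longrightarrow> \<bar>u t x\<bar> \<le> M" "\<And>t x. t \<in> {0..T} \<Longrightarrow> \<bar>ux t x\<bar> \<le> M"
    using locally_bounded[OF T] by blast
  \<comment> \<open>Time is clamped because \<open>Picard_Lindelof_global\<close> wants a bounded
    Lipschitz field for all real times, whereas the bounds on \<open>u\<close> and \<open>ux\<close>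
    hold on \<open>{0..T}\<close>, where the clamp is the identity.\<close>
  define c where "c t = max 0 (min T t)" for t
  have c: "c t \<in> {0..T}" for t using T by (auto simp: c_def)
  define F where "F t x = \<gamma> * u (c t) x" for t x
  have "continuous_on UNIV (\<lambda>p. \<gamma> * (case (c (fst p), snd p) of (t, x) \<Rightarrow> u t x))"
    unfolding c_def
    by (intro continuous_intros continuous_on_compose2[OF joint_u]) auto
  then have cont: "continuous_on UNIV (\<lambda>(t, x). F t x)"
    by (simp add: F_def case_prod_beta')
  have bound: "\<bar>F t x\<bar> \<le> \<gamma> * M" for t x
    using M(2)[OF c] \<gamma>_ge by (simp add: F_def abs_mult)
  have Lip: "\<bar>F t x - F t y\<bar> \<le> \<gamma> * M * \<bar>x - y\<bar>" for t x y
  proof -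
    have "norm (u (c t) x - u (c t) y) \<le> M * norm (x - y)"
    proof (rule differentiable_bound[OF convex_UNIV])
      show "(u (c t) has_derivative (*) (ux (c t) z)) (at z within UNIV)" for z
        using space_derivative[of "c t" z] c[of t] by (simp add: has_field_derivative_def)
      show "onorm ((*) (ux (c t) z)) \<le> M" for z
        using M(3)[OF c] by (intro onorm_le) (auto simp: abs_mult intro!: mult_right_mono)
    qed auto
    then have "\<gamma> * \<bar>u (c t) x - u (c t) y\<bar> \<le> \<gamma> * (M * \<bar>x - y\<bar>)"
      using \<gamma>_ge by (intro mult_left_mono) auto
    then show ?thesis using \<gamma>_ge unfolding F_def right_diff_distrib[symmetric] abs_mult by (simp add: mult.assoc)
  qed
  obtain q where q: "q t0 = x0" "\<And>t. (q has_real_derivative F t (q t)) (at t)"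
    using Picard_Lindelof_global[OF cont bound Lip] by blast
  have "(q has_real_derivative \<gamma> * u t (q t)) (at t within {0..T})" if "t \<in> {0..T}" for t
  proof -
    have "c t = t" using that by (auto simp: c_def)
    then show ?thesis using has_field_derivative_at_within[OF q(2)[of t], of "{0..T}"] by (simp add: F_def)
  qed
  then show ?thesis using that q(1) by blast
qed

text \<open>The increment is split into a change of time at the moving point \<open>c \<tau>\<close>
  and a change of space at the fixed time \<open>t\<close>. The second is the chain rule; the first
  uses the uniform time expansion and the continuity of \<open>ut t\<close>.\<close>

lemma derivative_along_curve:
  assumes t: "t \<in> {0..T}" and c: "(c has_real_derivative c') (at t within {0..T})"
  shows "((\<lambda>\<tau>. u \<tau> (c \<tau>)) has_real_derivative ut t (c t) + ux t (c t) * c') (at t within {0..T})"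
proof -
  have t0: "0 \<le> t" using t by simp
  have 1: "((\<lambda>\<tau>. u t (c \<tau>)) has_real_derivative ux t (c t) * c') (at t within {0..T})"
    by (rule DERIV_chain2[OF space_derivative[OF t0] c])
  have cc: "(c \<longlongrightarrow> c t) (at t within {0..T})"
    using has_field_derivative_imp_has_derivative[OF c] has_derivative_continuous
    unfolding continuous_within by blast
  have 2: "((\<lambda>\<tau>. u \<tau> (c \<tau>) - u t (c \<tau>)) has_real_derivative ut t (c t)) (at t within {0..T})"
    unfolding has_field_derivative_iff
  proof -
    have "((\<lambda>\<tau>. ut t (c \<tau>)) \<longlongrightarrow> ut t (c t)) (at t within {0..T})"
      using continuous_ut[OF t0] cc by (auto intro: isCont_tendsto_compose simp: continuous_on_eq_continuous_at)
    moreover have "((\<lambda>\<tau>. (u \<tau> (c \<tau>) - u t (c \<tau>)) / (\<tau> - t) - ut t (c \<tau>)) \<longlongrightarrow> 0) (at t within {0..T})"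
    proof (rule tendstoI)
      fix e :: real assume e: "0 < e"
      have weq: "ut t x = - \<gamma> * u t x * ux t x - deriv (convolution rod_kernel
            (\<lambda>y. (3 - \<gamma>) / 2 * (u t y)\<^sup>2 + \<gamma> / 2 * (ux t y)\<^sup>2)) x" for x
        unfolding deriv_convolution[OF t0] ut_def by simp
      obtain d where d: "d > 0" "\<And>\<tau> x. 0 \<le> \<tau> \<Longrightarrow> \<bar>\<tau> - t\<bar> < d \<Longrightarrow>
        \<bar>u \<tau> x - u t x - (\<tau> - t) * ut t x\<bar> \<le> e / 2 * \<bar>\<tau> - t\<bar>"
        using time_derivative[OF t0, of "e / 2", folded weq] e by (metis half_gt_zero)
      show "\<forall>\<^sub>F \<tau> in at t within {0..T}. dist ((u \<tau> (c \<tau>) - u t (c \<tau>)) / (\<tau> - t) - ut t (c \<tau>)) 0 < e"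
        unfolding eventually_at
      proof (intro exI[of _ d] conjI ballI impI)
        fix \<tau> assume \<tau>: "\<tau> \<in> {0..T}" "\<tau> \<noteq> t \<and> dist \<tau> t < d"
        have ne: "\<bar>\<tau> - t\<bar> > 0" using \<tau> by simp
        have "(u \<tau> (c \<tau>) - u t (c \<tau>)) / (\<tau> - t) - ut t (c \<tau>) = (u \<tau> (c \<tau>) - u t (c \<tau>) - (\<tau> - t) * ut t (c \<tau>)) / (\<tau> - t)"
          using ne by (simp add: field_simps)
        also have "\<bar>\<dots>\<bar> \<le> e / 2"
          using d(2)[of \<tau> "c \<tau>"] \<tau> ne by (simp add: dist_real_def pos_divide_le_eq)
        finally show "dist ((u \<tau> (c \<tau>) - u t (c \<tau>)) / (\<tau> - t) - ut t (c \<tau>)) 0 < e" using e by simp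
      qed (rule d)
    qed
    ultimately have "((\<lambda>\<tau>. (u \<tau> (c \<tau>) - u t (c \<tau>)) / (\<tau> - t) - ut t (c \<tau>) + ut t (c \<tau>)) \<longlongrightarrow> 0 + ut t (c t)) (at t within {0..T})"
      by (intro tendsto_add)
    then show "((\<lambda>\<tau>. (u \<tau> (c \<tau>) - u t (c \<tau>) - (u t (c t) - u t (c t))) / (\<tau> - t)) \<longlongrightarrow> ut t (c t)) (at t within {0..T})"
      by simp
  qed
  show ?thesis using DERIV_add[OF 2 1] by simp
qed

end

section \<open>Wave breaking\<close>

text \<open>The larger root of \<open>b^2 + b = (3 - \<gamma>) / \<gamma>\<close>. It is nonnegative
  for \<open>\<gamma> \<le> 3\<close> and negative beyond, hence the absolute value relating it to
  \<open>rod_beta\<close>.\<close>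

definition rod_b :: "real \<Rightarrow> real"
  where "rod_b \<gamma> = - 1 / 2 + sqrt (12 - 3 * \<gamma>) / (2 * sqrt \<gamma>)"

text \<open>With \<open>r = b + 1/2\<close> one has \<open>r^2 = 3 / \<gamma> - 3 / 4\<close>, and
  the radicand in \<open>rod_beta\<close> is \<open>(r - 1/2)^2\<close>. The bound
  \<open>\<gamma> \<le> 4\<close> makes \<open>r\<close> real and \<open>\<gamma> \<ge> 1\<close>
  gives \<open>r \<le> 3/2\<close>, so \<open>b\<close> lies between \<open>- 1/2\<close> and
  1.\<close>

lemma rod_b:
  assumes "1 \<le> \<gamma>" "\<gamma> \<le> 4"
  shows "\<gamma> * ((rod_b \<gamma>)\<^sup>2 + rod_b \<gamma>) = 3 - \<gamma>"
    and "rod_beta \<gamma> = \<bar>rod_b \<gamma>\<bar>"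
    and "rod_beta \<gamma> \<le> 1"
proof -
  define r where "r = sqrt (12 - 3 * \<gamma>) / (2 * sqrt \<gamma>)"
  have r2: "r\<^sup>2 = 3 / \<gamma> - 3 / 4"
    using assms by (simp add: r_def power_divide power_mult_distrib field_simps)
  have r0: "0 \<le> r" using assms by (simp add: r_def)
  have b: "rod_b \<gamma> = r - 1 / 2" by (simp add: rod_b_def r_def)
  have "(rod_b \<gamma>)\<^sup>2 + rod_b \<gamma> = r\<^sup>2 - 1 / 4" by (simp add: b power2_eq_square algebra_simps)
  then show "\<gamma> * ((rod_b \<gamma>)\<^sup>2 + rod_b \<gamma>) = 3 - \<gamma>" using assms by (simp add: r2 field_simps)
  have "(rod_b \<gamma>)\<^sup>2 = r\<^sup>2 - r + 1 / 4" by (simp add: b power2_eq_square algebra_simps)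
  also have "\<dots> = - 1 / 2 + 3 / \<gamma> - r" by (simp add: r2)
  finally show beta: "rod_beta \<gamma> = \<bar>rod_b \<gamma>\<bar>"
    unfolding rod_beta_def r_def[symmetric] by (metis real_sqrt_abs)
  have "r\<^sup>2 \<le> 9 / 4" using assms by (simp add: r2 field_simps)
  also have "9 / 4 = (3 / 2 :: real)\<^sup>2" by (simp add: power_divide)
  finally have "r \<le> 3 / 2" by (rule power2_le_imp_le) simp
  then show "rod_beta \<gamma> \<le> 1" using r0 by (simp add: beta b)
qed

context classical_rod_solution
begin

text \<open>\<open>u t\<close> need not be twice differentiable, so \<open>ux\<close> along the characteristic \<open>q\<close> is obtained as
  the limit of the difference quotients of \<open>u\<close> between \<open>q\<close> and \<open>q + h\<close>, whose time derivatives
  converge uniformly.\<close>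

lemma ux_along_characteristic:
  assumes T: "0 \<le> T"
    and q: "\<And>t. t \<in> {0..T} \<Longrightarrow> (q has_real_derivative \<gamma> * u t (q t)) (at t within {0..T})"
    and t: "t \<in> {0..T}"
  shows "((\<lambda>\<tau>. ux \<tau> (q \<tau>)) has_real_derivative
    source t (q t) - Pl t (q t) - Pr t (q t) - \<gamma> * (ux t (q t))\<^sup>2) (at t within {0..T})"
proof -
  obtain M where M: "0 \<le> M" "\<And>t x. t \<in> {0..T} \<Longrightarrow> \<bar>u t x\<bar> \<le> M" "\<And>t x. t \<in> {0..T} \<Longrightarrow> \<bar>ux t x\<bar> \<le> M"
    using locally_bounded[OF T] by blast
  define h where "h n = 1 / real (Suc n)" for n
  have h0: "0 < h n" for n by (simp add: h_def)
  have hlim: "h \<longlonglongrightarrow> 0" unfolding h_def[abs_def] using LIMSEQ_inverse_real_of_nat by (simp add: inverse_eq_divide)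
  define Z where "Z t x = source t x - Pl t x - Pr t x" for t x
  define m where "m n t = (u t (q t + h n) - u t (q t)) / h n" for n t
  \<comment> \<open>Both end points move with the velocity at \<open>q t\<close>, not each with its
    own. Hence at \<open>q t + h n\<close> the transport term leaves the difference
    \<open>u t (q t + h n) - u t (q t)\<close>, of order \<open>h n\<close>, and no second space
    derivative appears.\<close>
  define m' where "m' n t = ((ut t (q t + h n) + ux t (q t + h n) * (\<gamma> * u t (q t)))
    - (ut t (q t) + ux t (q t) * (\<gamma> * u t (q t)))) / h n" for n t
  define G where "G t = Z t (q t) - \<gamma> * (ux t (q t))\<^sup>2" for t
  have qc: "continuous_on {0..T} q" using q by (rule DERIV_continuous_on)
  have "continuous_on ({0..} \<times> UNIV) (\<lambda>p. (case p of (t, x) \<Rightarrow> source t x) - (case p of (t, x) \<Rightarrow> Pl t x) - (case p of (t, x) \<Rightarrow> Pr t x))"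
    by (intro continuous_on_diff joint_source joint_Pl joint_Pr)
  then have jZ: "continuous_on ({0..} \<times> UNIV) (\<lambda>(t, x). Z t x)"
    by (simp add: Z_def case_prod_beta')
  have dm: "(m n has_real_derivative m' n t) (at t within {0..T})" if t: "t \<in> {0..T}" for n t
  proof -
    have 1: "((\<lambda>t. u t (q t + h n)) has_real_derivative ut t (q t + h n) + ux t (q t + h n) * (\<gamma> * u t (q t))) (at t within {0..T})"
      by (rule derivative_along_curve[OF t]) (auto intro!: derivative_eq_intros q t)
    have 2: "((\<lambda>t. u t (q t)) has_real_derivative ut t (q t) + ux t (q t) * (\<gamma> * u t (q t))) (at t within {0..T})"
      by (rule derivative_along_curve[OF t q[OF t]])
    show ?thesis unfolding m_def[abs_def] m'_def
      by (rule DERIV_cdivide[OF DERIV_diff[OF 1 2]])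
  qed
  have mv: "\<exists>\<xi> \<xi>'. \<bar>\<xi> - q t\<bar> < h n \<and> \<bar>\<xi>' - q t\<bar> < h n \<and> m' n t = Z t \<xi> - \<gamma> * (ux t \<xi>' * ux t (q t + h n))"
    if t: "t \<in> {0..T}" for n t
  proof -
    have t0: "0 \<le> t" using t by simp
    have "\<exists>z>q t. z < q t + h n \<and> u t (q t + h n) - u t (q t) = (q t + h n - q t) * ux t z"
      by (rule MVT2) (use h0 space_derivative[OF t0] in auto)
    then obtain \<xi>' where x': "q t < \<xi>'" "\<xi>' < q t + h n" "u t (q t + h n) - u t (q t) = h n * ux t \<xi>'" by auto
    have "\<exists>z>q t. z < q t + h n \<and> (Pl t (q t + h n) - Pr t (q t + h n)) - (Pl t (q t) - Pr t (q t)) = (q t + h n - q t) * Z t z"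
    proof (rule MVT2)
      show "((\<lambda>x. Pl t x - Pr t x) has_real_derivative Z t x) (at x)" for x
        using DERIV_diff[OF Pl_has_derivative[OF t0] Pr_has_derivative[OF t0], of x] by (simp add: Z_def algebra_simps)
    qed (use h0 in auto)
    then obtain \<xi> where x: "q t < \<xi>" "\<xi> < q t + h n"
      "(Pl t (q t + h n) - Pr t (q t + h n)) - (Pl t (q t) - Pr t (q t)) = h n * Z t \<xi>" by auto
    have "m' n t = (((Pl t (q t + h n) - Pr t (q t + h n)) - (Pl t (q t) - Pr t (q t)))
        - \<gamma> * (u t (q t + h n) - u t (q t)) * ux t (q t + h n)) / h n"
      by (simp add: m'_def ut_def algebra_simps)
    also have "\<dots> = Z t \<xi> - \<gamma> * (ux t \<xi>' * ux t (q t + h n))"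
      unfolding x(3) x'(3) using h0[of n] by (simp add: field_simps)
    finally show ?thesis using x x' by (intro exI[of _ \<xi>] exI[of _ \<xi>']) auto
  qed
  have unif: "\<forall>\<^sub>F n in sequentially. \<forall>t\<in>{0..T}. \<forall>k. norm (m' n t * k - G t * k) \<le> e * norm k" if e: "e > 0" for e
  proof -
    \<comment> \<open>The error is \<open>e1\<close> from \<open>Z\<close> plus
      \<open>\<gamma> * 2 * M * e1\<close> from the product of two values of \<open>ux\<close>; with
      \<open>\<gamma> \<le> 4\<close> the sum is at most \<open>(1 + 8 * M) * e1\<close>.\<close>
    define e1 where "e1 = e / (1 + 8 * M)"
    have e1: "e1 > 0" using e M by (simp add: e1_def)
    obtain d1 where d1: "d1 > 0" "\<And>t y. t \<in> {0..T} \<Longrightarrow> \<bar>y - q t\<bar> < d1 \<Longrightarrow> \<bar>Z t y - Z t (q t)\<bar> < e1"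
      using uniform_along_curve[OF jZ qc e1] by blast
    obtain d2 where d2: "d2 > 0" "\<And>t y. t \<in> {0..T} \<Longrightarrow> \<bar>y - q t\<bar> < d2 \<Longrightarrow> \<bar>ux t y - ux t (q t)\<bar> < e1"
      using uniform_along_curve[OF joint_ux qc e1] by blast
    have "\<forall>\<^sub>F n in sequentially. h n < min d1 d2"
      by (rule order_tendstoD(2)[OF hlim]) (use d1 d2 in auto)
    then show ?thesis
    proof eventually_elim
      case (elim n)
      show ?case
      proof (intro ballI allI)
        fix t k assume t: "t \<in> {0..T}"
        obtain \<xi> \<xi>' where x: "\<bar>\<xi> - q t\<bar> < h n" "\<bar>\<xi>' - q t\<bar> < h n" "m' n t = Z t \<xi> - \<gamma> * (ux t \<xi>' * ux t (q t + h n))"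
          using mv[OF t] by blast
        have 1: "\<bar>Z t \<xi> - Z t (q t)\<bar> \<le> e1" using d1(2)[OF t, of \<xi>] x elim by auto
        have 2: "\<bar>ux t \<xi>' - ux t (q t)\<bar> \<le> e1" using d2(2)[OF t, of \<xi>'] x elim by auto
        have 3: "\<bar>ux t (q t + h n) - ux t (q t)\<bar> \<le> e1" using d2(2)[OF t, of "q t + h n"] h0[of n] elim by auto
        have "\<bar>ux t \<xi>' * ux t (q t + h n) - (ux t (q t))\<^sup>2\<bar>
          = \<bar>ux t \<xi>' * (ux t (q t + h n) - ux t (q t)) + ux t (q t) * (ux t \<xi>' - ux t (q t))\<bar>"
          by (simp add: power2_eq_square algebra_simps)
        also have "\<dots> \<le> M * e1 + M * e1"
          using M(3)[OF t] 2 3 M(1) e1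
          by (intro order_trans[OF abs_triangle_ineq] add_mono) (auto simp: abs_mult intro!: mult_mono)
        finally have "\<gamma> * \<bar>ux t \<xi>' * ux t (q t + h n) - (ux t (q t))\<^sup>2\<bar> \<le> 4 * (M * e1 + M * e1)"
          using \<gamma>_ge \<gamma>_le M(1) e1 by (intro mult_mono) auto
        moreover have "m' n t - G t = (Z t \<xi> - Z t (q t)) - \<gamma> * (ux t \<xi>' * ux t (q t + h n) - (ux t (q t))\<^sup>2)"
          by (simp add: x(3) G_def algebra_simps)
        moreover have "\<bar>\<gamma> * (ux t \<xi>' * ux t (q t + h n) - (ux t (q t))\<^sup>2)\<bar> = \<gamma> * \<bar>ux t \<xi>' * ux t (q t + h n) - (ux t (q t))\<^sup>2\<bar>"
          using \<gamma>_ge by (simp add: abs_mult)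
        ultimately have "\<bar>m' n t - G t\<bar> \<le> e1 + 4 * (M * e1 + M * e1)" using 1 by linarith
        also have "\<dots> = e1 * (1 + 8 * M)" by (simp add: algebra_simps)
        also have "\<dots> = e" using M(1) by (simp add: e1_def)
        finally show "norm (m' n t * k - G t * k) \<le> e * norm k"
          unfolding left_diff_distrib[symmetric] norm_mult by (intro mult_right_mono) auto
      qed
    qed
  qed
  have lim: "(\<lambda>n. m n t) \<longlonglongrightarrow> ux t (q t)" if t: "t \<in> {0..T}" for t
  proof -
    have "((\<lambda>k. (u t (q t + k) - u t (q t)) / k) \<longlongrightarrow> ux t (q t)) (at 0)"
      using space_derivative[of t "q t"] t by (simp add: DERIV_def)
    then show ?thesis
      unfolding tendsto_at_iff_sequentially comp_def m_def using hlim h0 by (metis DiffI UNIV_I less_irrefl singletonD)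
  qed
  have "\<exists>g. \<forall>x\<in>{0..T}. (\<lambda>n. m n x) \<longlonglongrightarrow> g x \<and> (g has_derivative (\<lambda>k. G x * k)) (at x within {0..T})"
  proof (rule has_derivative_sequence[where f' = "\<lambda>n x k. m' n x * k"])
    show "convex {0..T}" by simp
    show "(m n has_derivative (\<lambda>k. m' n x * k)) (at x within {0..T})" if "x \<in> {0..T}" for n x
      using dm[OF that] by (simp add: has_field_derivative_def)
    show "0 \<in> {0..T}" using T by simp
    then show "(\<lambda>n. m n 0) \<longlonglongrightarrow> ux 0 (q 0)" by (rule lim)
  qed (rule unif)
  then obtain g where g: "\<And>x. x \<in> {0..T} \<Longrightarrow> (\<lambda>n. m n x) \<longlonglongrightarrow> g x"
    "\<And>x. x \<in> {0..T} \<Longrightarrow> (g has_real_derivative G x) (at x within {0..T})"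
    unfolding has_field_derivative_def by blast
  have geq: "g x = ux x (q x)" if "x \<in> {0..T}" for x using g(1)[OF that] lim[OF that] by (rule LIMSEQ_unique)
  have "((\<lambda>\<tau>. ux \<tau> (q \<tau>)) has_real_derivative G t) (at t within {0..T})"
    by (rule has_field_derivative_transform_within[OF g(2)[OF t] zero_less_one t]) (simp add: geq)
  then show ?thesis by (simp add: G_def Z_def)
qed

lemma u_along_characteristic:
  assumes q: "(q has_real_derivative \<gamma> * u t (q t)) (at t within {0..T})" and t: "t \<in> {0..T}"
  shows "((\<lambda>\<tau>. u \<tau> (q \<tau>)) has_real_derivative Pl t (q t) - Pr t (q t)) (at t within {0..T})"
  using derivative_along_curve[OF t q] by (simp add: ut_def algebra_simps)

lemma kernel_lower_bounds:
  assumes t: "0 \<le> t"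
  shows "\<gamma> / 4 * rod_b \<gamma> * (u t x)\<^sup>2 \<le> Pl t x" and "\<gamma> / 4 * rod_b \<gamma> * (u t x)\<^sup>2 \<le> Pr t x"
proof -
  define b where "b = rod_b \<gamma>"
  have g: "3 - \<gamma> = \<gamma> * (b\<^sup>2 + b)" using rod_b(1)[OF \<gamma>_ge \<gamma>_le] by (simp add: b_def)
  obtain M N where M: "\<And>x. \<bar>u t x\<bar> \<le> M" and N: "\<And>x. \<bar>source t x\<bar> \<le> N"
    using bounded_slice[OF t] bounded_source[OF t] by blast
  \<comment> \<open>Replacing \<open>3 - \<gamma>\<close> by means of \<open>g\<close> leaves the
    squares of \<open>ux - b * u\<close> and \<open>ux + b * u\<close>, one sign for each
    half-line.\<close>
  have "source t x / 2 - \<gamma> / 4 * b * ((u t x)\<^sup>2 + 2 * (u t x * ux t x)) = \<gamma> / 4 * (ux t x - b * u t x)\<^sup>2"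
    and "source t x / 2 - \<gamma> / 4 * b * ((u t x)\<^sup>2 - 2 * (u t x * ux t x)) = \<gamma> / 4 * (ux t x + b * u t x)\<^sup>2" for x
    unfolding source_def g by (simp_all add: power2_eq_square algebra_simps add_divide_distrib)
  moreover have "0 \<le> \<gamma> / 4 * (ux t x - b * u t x)\<^sup>2" "0 \<le> \<gamma> / 4 * (ux t x + b * u t x)\<^sup>2" for x
    using \<gamma>_ge by auto
  ultimately have ge: "\<gamma> / 4 * b * ((u t x)\<^sup>2 + 2 * (u t x * ux t x)) \<le> source t x / 2"
    "\<gamma> / 4 * b * ((u t x)\<^sup>2 - 2 * (u t x * ux t x)) \<le> source t x / 2" for x
    by (smt (verit))+
  show "\<gamma> / 4 * rod_b \<gamma> * (u t x)\<^sup>2 \<le> Pl t x"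
    unfolding Pl_def b_def[symmetric]
    by (rule kernel_left_lower_bound[OF space_derivative[OF t] M continuous_source[OF t] N ge(1)])
  show "\<gamma> / 4 * rod_b \<gamma> * (u t x)\<^sup>2 \<le> Pr t x"
    unfolding Pr_def b_def[symmetric]
    by (rule kernel_right_lower_bound[OF space_derivative[OF t] M continuous_source[OF t] N ge(2)])
qed

text \<open>For \<open>\<beta> \<ge> 0\<close>, the negation
  \<open>ux < - \<beta> * \<bar>u\<bar>\<close> says exactly that \<open>A > 0 > B\<close> at that
  point. The characteristic through it is followed forward beyond the lifespan allowed by
  \<open>riccati_pair_lifespan\<close>.\<close>

lemma no_wave_breaking:
  assumes t0: "0 \<le> t0"
  shows "- rod_beta \<gamma> * \<bar>u t0 x0\<bar> \<le> ux t0 x0"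
proof (rule ccontr)
  define b \<beta> where "b = rod_b \<gamma>" and "\<beta> = rod_beta \<gamma>"
  have g: "3 - \<gamma> = \<gamma> * (b\<^sup>2 + b)" and \<beta>b: "\<beta>\<^sup>2 = b\<^sup>2" and \<beta>0: "0 \<le> \<beta>" and \<beta>1: "\<beta> \<le> 1"
    using rod_b[OF \<gamma>_ge \<gamma>_le] by (simp_all add: b_def \<beta>_def)
  assume "\<not> ?thesis"
  then have neg: "ux t0 x0 < - (\<beta> * \<bar>u t0 x0\<bar>)" by (simp add: \<beta>_def)
  define a0 b0 where "a0 = \<beta> * u t0 x0 - ux t0 x0" and "b0 = \<beta> * u t0 x0 + ux t0 x0"
  have "\<beta> * u t0 x0 \<le> \<beta> * \<bar>u t0 x0\<bar>" "- (\<beta> * \<bar>u t0 x0\<bar>) \<le> \<beta> * u t0 x0"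
    using mult_left_mono[OF abs_ge_self \<beta>0, of "u t0 x0"] mult_left_mono[OF abs_ge_minus_self \<beta>0, of "u t0 x0"] by auto
  then have a0: "0 < a0" and b0: "b0 < 0" using neg by (auto simp: a0_def b0_def)
  define J where "J = 1 / a0 - 1 / b0"
  have "0 < 1 / a0" "1 / b0 < 0" using a0 b0 by auto
  then have J: "0 < J" unfolding J_def by linarith
  \<comment> \<open>With rate \<open>\<gamma> / 2\<close> the lifespan bound is
    \<open>\<gamma> * (T - t0) < J\<close>; this \<open>T\<close> makes the left side equal to
    \<open>J + \<gamma>\<close>.\<close>
  define T where "T = t0 + J / \<gamma> + 1"
  have "0 < J / \<gamma>" using J \<gamma>_ge by simp
  then have T: "t0 \<le> T" "0 \<le> T" using t0 by (auto simp: T_def)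
  obtain q where q0: "q t0 = x0" and q: "\<And>t. t \<in> {0..T} \<Longrightarrow> (q has_real_derivative \<gamma> * u t (q t)) (at t within {0..T})"
    using characteristic_exists[OF T(2)] by blast
  define U V where "U t = u t (q t)" and "V t = ux t (q t)" for t
  define U' V' where "U' t = Pl t (q t) - Pr t (q t)"
    and "V' t = source t (q t) - Pl t (q t) - Pr t (q t) - \<gamma> * (V t)\<^sup>2" for t
  have dU: "(U has_real_derivative U' t) (at t within {t0..T})" if "t \<in> {t0..T}" for t
  proof -
    have t: "t \<in> {0..T}" using that t0 by auto
    show ?thesis unfolding U_def[abs_def] U'_def
      by (rule DERIV_subset[OF u_along_characteristic[OF q[OF t] t]]) (use t0 in auto)
  qed
  have dV: "(V has_real_derivative V' t) (at t within {t0..T})" if "t \<in> {t0..T}" for t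
  proof -
    have t: "t \<in> {0..T}" using that t0 by auto
    show ?thesis unfolding V_def[abs_def] V'_def
      by (rule DERIV_subset[OF ux_along_characteristic[OF T(2) q t]]) (use t0 in auto)
  qed
  have ineq: "\<beta> * U' t - V' t \<ge> - (\<gamma> / 2) * ((\<beta> * U t - V t) * (\<beta> * U t + V t))"
    "\<beta> * U' t + V' t \<le> (\<gamma> / 2) * ((\<beta> * U t - V t) * (\<beta> * U t + V t))" if "t \<in> {t0..T}" for t
  proof -
    have t: "0 \<le> t" using that t0 by auto
    define c where "c = \<gamma> / 4 * b * (U t)\<^sup>2"
    have l: "c \<le> Pl t (q t)" and r: "c \<le> Pr t (q t)"
      using kernel_lower_bounds[OF t, of "q t"] by (simp_all add: c_def U_def b_def)
    \<comment> \<open>The weights \<open>1 + \<beta>\<close> and \<open>1 - \<beta>\<close> with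
      which \<open>Pl\<close> and \<open>Pr\<close> enter are nonnegative, and they add up to 2. So
      the bounds contribute \<open>2 * c\<close>, whatever \<open>\<beta>\<close> is.\<close>
    have p1: "(1 + \<beta>) * c + (1 - \<beta>) * c \<le> (1 + \<beta>) * Pl t (q t) + (1 - \<beta>) * Pr t (q t)"
      and p2: "(1 - \<beta>) * c + (1 + \<beta>) * c \<le> (1 - \<beta>) * Pl t (q t) + (1 + \<beta>) * Pr t (q t)"
      using l r \<beta>0 \<beta>1 by (auto intro!: add_mono mult_left_mono)
    have fe: "source t (q t) = \<gamma> / 2 * ((b\<^sup>2 + b) * (U t)\<^sup>2 + (V t)\<^sup>2)"
      by (simp add: source_def g U_def V_def algebra_simps)
    have ab: "(\<beta> * U t - V t) * (\<beta> * U t + V t) = b\<^sup>2 * (U t)\<^sup>2 - (V t)\<^sup>2"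
      unfolding \<beta>b[symmetric] by (simp add: power2_eq_square algebra_simps)
    have "\<beta> * U' t - V' t = (1 + \<beta>) * Pl t (q t) + (1 - \<beta>) * Pr t (q t) - source t (q t) + \<gamma> * (V t)\<^sup>2"
      by (simp add: U'_def V'_def algebra_simps)
    also have "\<dots> \<ge> (1 + \<beta>) * c + (1 - \<beta>) * c - source t (q t) + \<gamma> * (V t)\<^sup>2" using p1 by linarith
    also have "(1 + \<beta>) * c + (1 - \<beta>) * c - source t (q t) + \<gamma> * (V t)\<^sup>2 = - (\<gamma> / 2) * (b\<^sup>2 * (U t)\<^sup>2 - (V t)\<^sup>2)"
      by (simp add: c_def fe algebra_simps add_divide_distrib diff_divide_distrib)
    finally show "\<beta> * U' t - V' t \<ge> - (\<gamma> / 2) * ((\<beta> * U t - V t) * (\<beta> * U t + V t))" unfolding ab .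
    have "\<beta> * U' t + V' t = - ((1 - \<beta>) * Pl t (q t) + (1 + \<beta>) * Pr t (q t)) + source t (q t) - \<gamma> * (V t)\<^sup>2"
      by (simp add: U'_def V'_def algebra_simps)
    also have "\<dots> \<le> - ((1 - \<beta>) * c + (1 + \<beta>) * c) + source t (q t) - \<gamma> * (V t)\<^sup>2" using p2 by linarith
    also have "\<dots> = (\<gamma> / 2) * (b\<^sup>2 * (U t)\<^sup>2 - (V t)\<^sup>2)"
      by (simp add: c_def fe algebra_simps add_divide_distrib diff_divide_distrib)
    finally show "\<beta> * U' t + V' t \<le> (\<gamma> / 2) * ((\<beta> * U t - V t) * (\<beta> * U t + V t))" unfolding ab .
  qed
  have "2 * (\<gamma> / 2) * (T - t0) < 1 / (\<beta> * U t0 - V t0) - 1 / (\<beta> * U t0 + V t0)"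
  proof (rule riccati_pair_lifespan[where A = "\<lambda>t. \<beta> * U t - V t" and B = "\<lambda>t. \<beta> * U t + V t"])
    show "((\<lambda>t. \<beta> * U t - V t) has_real_derivative \<beta> * U' t - V' t) (at t within {t0..T})"
      "((\<lambda>t. \<beta> * U t + V t) has_real_derivative \<beta> * U' t + V' t) (at t within {t0..T})" if "t \<in> {t0..T}" for t
      using dU[OF that] dV[OF that] by (auto intro!: derivative_eq_intros)
  qed (use ineq T a0 b0 \<gamma>_ge in \<open>auto simp: U_def V_def q0 a0_def b0_def\<close>)
  also have "1 / (\<beta> * U t0 - V t0) - 1 / (\<beta> * U t0 + V t0) = J"
    by (simp add: J_def U_def V_def q0 a0_def b0_def)
  finally have "\<gamma> * (J / \<gamma> + 1) < J" by (simp add: T_def)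
  then show False using \<gamma>_ge by (simp add: distrib_left)
qed

text \<open>A Gronwall argument run as an iteration: a bound
  \<open>S * exp (K * \<bar>s - t0\<bar>)\<close> for both \<open>u\<close> and \<open>ux\<close>
  improves itself to half its size, so \<open>S\<close> can be taken to be \<open>M / 2 ^ n\<close>
  for every \<open>n\<close>. Distances to \<open>t0\<close> enter in absolute value, so times
  before \<open>t0\<close> are covered as well.\<close>

lemma zero_propagates:
  assumes t0: "0 \<le> t0" and zero: "\<And>x. u t0 x = 0" and t: "0 \<le> t"
  shows "u t x = 0"
proof -
  define T where "T = max t0 t"
  have T: "0 \<le> T" and t0T: "t0 \<in> {0..T}" and tT: "t \<in> {0..T}" using t0 t by (auto simp: T_def)
  obtain M where M: "0 \<le> M" "\<And>t x. t \<in> {0..T} \<Longrightarrow> \<bar>u t x\<bar> \<le> M" "\<And>t x. t \<in> {0..T} \<Longrightarrow> \<bar>ux t x\<bar> \<le> M"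
    using locally_bounded[OF T] by blast
  have "ux t0 x = 0" for x
  proof -
    have "u t0 = (\<lambda>x. 0)" using zero by auto
    then have "((\<lambda>x. 0) has_real_derivative ux t0 x) (at x)" using space_derivative[OF t0, of x] by simp
    then show ?thesis using DERIV_unique[OF _ DERIV_const] by blast
  qed
  note zero' = zero this
  \<comment> \<open>In units of \<open>M * S * exp (K * \<bar>r - t0\<bar>)\<close> the derivative
    of \<open>ux\<close> is at most 10: 3 from the source, 3/2 from each of \<open>Pl\<close> and
    \<open>Pr\<close>, and 4 from \<open>\<gamma> * ux^2\<close>. Then
    \<open>10 * M * S / K \<le> S / 2\<close>.\<close>
  define K where "K = 20 * M + 1"
  have K: "0 < K" using M by (simp add: K_def)
  have step: "\<bar>u s x\<bar> \<le> S / 2 * exp (K * \<bar>s - t0\<bar>) \<and> \<bar>ux s x\<bar> \<le> S / 2 * exp (K * \<bar>s - t0\<bar>)"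
    if S: "0 \<le> S" and bound: "\<And>s x. s \<in> {0..T} \<Longrightarrow> \<bar>u s x\<bar> \<le> S * exp (K * \<bar>s - t0\<bar>)"
      "\<And>s x. s \<in> {0..T} \<Longrightarrow> \<bar>ux s x\<bar> \<le> S * exp (K * \<bar>s - t0\<bar>)" and s: "s \<in> {0..T}" for S s x
  proof -
    \<comment> \<open>The characteristic is prescribed at the target point \<open>(s, x)\<close> and
      traced to time \<open>t0\<close>, where \<open>u\<close> and \<open>ux\<close> vanish at every
      point.\<close>
    obtain q where q0: "q s = x" and q: "\<And>t. t \<in> {0..T} \<Longrightarrow> (q has_real_derivative \<gamma> * u t (q t)) (at t within {0..T})"
      using characteristic_exists[OF T] by blast
    have seg: "closed_segment t0 s \<subseteq> {0..T}" using t0T s by (auto simp: closed_segment_eq_real_ivl split: if_splits)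
    have fb: "\<bar>source r y\<bar> \<le> 3 * (M * (S * exp (K * \<bar>r - t0\<bar>)))" if "r \<in> {0..T}" for r y
      using that by (intro abs_source_le M bound)
    have PB: "\<bar>Pl r y\<bar> \<le> 3 * (M * (S * exp (K * \<bar>r - t0\<bar>))) / 2" "\<bar>Pr r y\<bar> \<le> 3 * (M * (S * exp (K * \<bar>r - t0\<bar>))) / 2"
      if "r \<in> {0..T}" for r y
      unfolding Pl_def Pr_def using that abs_kernel_left_le[OF continuous_source fb[OF that]] abs_kernel_right_le[OF continuous_source fb[OF that]]
      by auto
    have CK: "10 * M * S / K * exp (K * \<bar>s - t0\<bar>) \<le> S / 2 * exp (K * \<bar>s - t0\<bar>)"
    proof (rule mult_right_mono)
      have "20 * M * S \<le> S * K" using S by (simp add: K_def algebra_simps)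
      then show "10 * M * S / K \<le> S / 2" using K by (simp add: field_simps)
    qed simp
    have "\<bar>u s (q s) - u t0 (q t0)\<bar> \<le> (10 * M * S) / K * exp (K * \<bar>s - t0\<bar>)"
    proof (rule exponential_derivative_bound[OF K, where \<phi> = "\<lambda>r. u r (q r)"])
      show "0 \<le> 10 * M * S" using M S by simp
      fix r assume "r \<in> closed_segment t0 s"
      then have r: "r \<in> {0..T}" using seg by auto
      show "((\<lambda>r. u r (q r)) has_real_derivative Pl r (q r) - Pr r (q r)) (at r within closed_segment t0 s)"
        by (rule DERIV_subset[OF u_along_characteristic[OF q[OF r] r] seg])
      have "0 \<le> M * (S * exp (K * \<bar>r - t0\<bar>))" using M S by simp
      then show "\<bar>Pl r (q r) - Pr r (q r)\<bar> \<le> 10 * M * S * exp (K * \<bar>r - t0\<bar>)"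
        using PB[OF r, of "q r"] by (simp add: mult.assoc)
    qed
    moreover have "\<bar>ux s (q s) - ux t0 (q t0)\<bar> \<le> (10 * M * S) / K * exp (K * \<bar>s - t0\<bar>)"
    proof (rule exponential_derivative_bound[OF K, where \<phi> = "\<lambda>r. ux r (q r)"])
      show "0 \<le> 10 * M * S" using M S by simp
      fix r assume "r \<in> closed_segment t0 s"
      then have r: "r \<in> {0..T}" using seg by auto
      show "((\<lambda>r. ux r (q r)) has_real_derivative source r (q r) - Pl r (q r) - Pr r (q r) - \<gamma> * (ux r (q r))\<^sup>2) (at r within closed_segment t0 s)"
        by (rule DERIV_subset[OF ux_along_characteristic[OF T q r] seg])
      have "(ux r (q r))\<^sup>2 \<le> M * (S * exp (K * \<bar>r - t0\<bar>))"
        using mult_mono[OF M(3)[OF r, of "q r"] bound(2)[OF r, of "q r"] M(1)] by (simp add: power2_eq_square)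
      then have "\<gamma> * (ux r (q r))\<^sup>2 \<le> 4 * (M * (S * exp (K * \<bar>r - t0\<bar>)))"
        using \<gamma>_ge \<gamma>_le by (intro mult_mono) auto
      moreover have "0 \<le> \<gamma> * (ux r (q r))\<^sup>2" using \<gamma>_ge by simp
      ultimately show "\<bar>source r (q r) - Pl r (q r) - Pr r (q r) - \<gamma> * (ux r (q r))\<^sup>2\<bar> \<le> 10 * M * S * exp (K * \<bar>r - t0\<bar>)"
        using PB[OF r, of "q r"] fb[OF r, of "q r"] by (simp add: mult.assoc)
    qed
    ultimately show ?thesis using CK by (simp add: zero' q0)
  qed
  have "\<forall>s\<in>{0..T}. \<forall>x. \<bar>u s x\<bar> \<le> M / 2 ^ n * exp (K * \<bar>s - t0\<bar>) \<and> \<bar>ux s x\<bar> \<le> M / 2 ^ n * exp (K * \<bar>s - t0\<bar>)" for n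
  proof (induction n)
    case 0
    have "M * 1 \<le> M * exp (K * \<bar>s - t0\<bar>)" for s using M K by (intro mult_left_mono) auto
    then have "M \<le> M / 2 ^ 0 * exp (K * \<bar>s - t0\<bar>)" for s by simp
    then show ?case using order_trans[OF M(2)] order_trans[OF M(3)] by blast
  next
    case (Suc n)
    then show ?case using step[of "M / 2 ^ n"] M(1) by (simp add: mult.commute)
  qed
  then have "\<bar>u t x\<bar> \<le> M / 2 ^ n * exp (K * \<bar>t - t0\<bar>)" for n using tT by blast
  moreover have lim: "(\<lambda>n. M / 2 ^ n * exp (K * \<bar>t - t0\<bar>)) \<longlonglongrightarrow> 0 * exp (K * \<bar>t - t0\<bar>)"
    by (intro tendsto_mult tendsto_const) (rule LIMSEQ_divide_realpow_zero, simp)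
  ultimately have "\<bar>u t x\<bar> \<le> 0 * exp (K * \<bar>t - t0\<bar>)" by (intro LIMSEQ_le_const[OF lim]) blast
  then show ?thesis by simp
qed

end

section \<open>Global solutions\<close>

lemma weight_L2_norm_nonneg: "0 \<le> weight_L2_norm r"
  by (simp add: weight_L2_norm_def integral_nonneg_AE)

lemma eventually_within_nonneg_iff:
  fixes t :: real
  shows "eventually P (at t within {0..}) \<longleftrightarrow> (\<exists>d>0. \<forall>\<tau>\<ge>0. \<tau> \<noteq> t \<longrightarrow> \<bar>\<tau> - t\<bar> < d \<longrightarrow> P \<tau>)"
  unfolding eventually_at by (auto simp: dist_real_def)

lemma time_interval_infinity: "time_interval \<infinity> = {0..}"
  by (auto simp: time_interval_def)

text \<open>Sobolev embedding turns the convergence in \<open>H\<^sup>s\<close> and \<open>H\<^sup>s\<^sup>-\<^sup>1\<close> into convergence uniform in space.\<close>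

lemma classical_rod_solution_of_rod_solution:
  assumes \<gamma>: "1 \<le> \<gamma>" "\<gamma> \<le> 4" and s: "s > 3 / 2" and sol: "rod_solution \<gamma> s \<infinity> u"
  shows "classical_rod_solution \<gamma> u (\<lambda>t. deriv (u t))"
proof -
  obtain v where C0: "C0_sobolev {0..} s u" and cont: "\<And>t. 0 \<le> t \<Longrightarrow> continuous_on UNIV (u t)"
    and Dt: "has_sobolev_time_derivative {0..} (s - 1) u v"
    and eq: "\<And>t. 0 \<le> t \<Longrightarrow> AE x in lborel. v t x + \<gamma> * u t x * deriv (u t) x =
        - deriv (convolution rod_kernel
            (\<lambda>y. (3 - \<gamma>) / 2 * (u t y)\<^sup>2 + \<gamma> / 2 * (deriv (u t) y)\<^sup>2)) x"
    using sol unfolding rod_solution_def time_interval_infinity by auto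
  have us: "u t \<in> sobolev_space s" if "0 \<le> t" for t using C0 that by (auto simp: C0_sobolev_def)
  have us1: "u t \<in> sobolev_space (s - 1)" and vs1: "v t \<in> sobolev_space (s - 1)" if "0 \<le> t" for t
    using Dt that by (auto simp: has_sobolev_time_derivative_def)
  have der: "(u t has_real_derivative deriv (u t) x) (at x)" and dcont: "continuous_on UNIV (deriv (u t))"
    if "0 \<le> t" for t x
    using sobolev_C1[OF s us[OF that] cont[OF that]] by auto
  \<comment> \<open>One constant dominating both embedding constants; the added 1 makes it positive,
    so that \<open>e / c\<close> is an admissible tolerance.\<close>
  define c where "c = weight_L2_norm s + weight_L2_norm (s - 1) + 1"
  have c: "0 < c" "weight_L2_norm s \<le> c" "weight_L2_norm (s - 1) \<le> c"
    using weight_L2_norm_nonneg[of s] weight_L2_norm_nonneg[of "s - 1"] by (auto simp: c_def)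
  have norm0: "0 \<le> sobolev_norm r g" for r g by (simp add: sobolev_norm_def integral_nonneg_AE)
  have sup: "\<bar>g x\<bar> \<le> c * sobolev_norm s g" "\<bar>deriv g x\<bar> \<le> c * sobolev_norm s g"
    if "g \<in> sobolev_space s" "continuous_on UNIV g" for g x
    using sobolev_sup_bound[OF _ that, of x] sobolev_C1(3)[OF s that, of x] s
      mult_right_mono[OF c(2) norm0, of s g] mult_right_mono[OF c(3) norm0, of s g]
    by (linarith+)
  have bounded: "\<exists>M. \<forall>x. \<bar>u t x\<bar> \<le> M \<and> \<bar>deriv (u t) x\<bar> \<le> M" if "0 \<le> t" for t
    using sup[OF us[OF that] cont[OF that]] by blast
  define F where "F t y = (3 - \<gamma>) / 2 * (u t y)\<^sup>2 + \<gamma> / 2 * (deriv (u t) y)\<^sup>2" for t y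
  \<comment> \<open>The continuous representative of \<open>v t\<close>. The sup bound applies to
    continuous functions, while \<open>v t\<close> is pinned down by the equation only almost
    everywhere.\<close>
  define W where "W t x = - \<gamma> * u t x * deriv (u t) x - deriv (convolution rod_kernel (F t)) x" for t x
  have Wcont: "continuous_on UNIV (W t)" if t: "0 \<le> t" for t
  proof -
    obtain M where M: "\<And>x. \<bar>u t x\<bar> \<le> M" "\<And>x. \<bar>deriv (u t) x\<bar> \<le> M" using bounded[OF t] by blast
    have Fc: "continuous_on UNIV (F t)"
      unfolding F_def[abs_def] by (intro continuous_intros cont dcont t)
    have Fb: "\<bar>F t x\<bar> \<le> \<bar>(3 - \<gamma>) / 2\<bar> * M\<^sup>2 + \<bar>\<gamma> / 2\<bar> * M\<^sup>2" for x
    proof -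
      have "(u t x)\<^sup>2 \<le> M\<^sup>2" "(deriv (u t) x)\<^sup>2 \<le> M\<^sup>2"
        using power_mono[OF M(1)[of x], of 2] power_mono[OF M(2)[of x], of 2] by auto
      then show ?thesis unfolding F_def
        by (intro order_trans[OF abs_triangle_ineq] add_mono) (simp_all add: abs_mult mult_left_mono)
    qed
    have dl: "(kernel_left (F t) has_real_derivative F t x / 2 - kernel_left (F t) x) (at x)" for x
      by (rule kernel_left_has_derivative[OF Fc Fb])
    have dr: "(kernel_right (F t) has_real_derivative kernel_right (F t) x - F t x / 2) (at x)" for x
      by (rule kernel_right_has_derivative[OF Fc Fb])
    have "convolution rod_kernel (F t) = (\<lambda>x. kernel_left (F t) x + kernel_right (F t) x)"
      using convolution_rod_kernel[OF Fc Fb] by blast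
    moreover have "((\<lambda>x. kernel_left (F t) x + kernel_right (F t) x) has_real_derivative
        kernel_right (F t) x - kernel_left (F t) x) (at x)" for x
      using DERIV_add[OF dl dr, of x] by simp
    ultimately have "deriv (convolution rod_kernel (F t)) = (\<lambda>x. kernel_right (F t) x - kernel_left (F t) x)"
      by (auto simp: DERIV_imp_deriv)
    moreover have "continuous_on UNIV (kernel_left (F t))" "continuous_on UNIV (kernel_right (F t))"
      by (rule continuous_on_of_real_derivative[OF dl] continuous_on_of_real_derivative[OF dr])+
    ultimately show ?thesis unfolding W_def[abs_def]
      by (auto intro!: continuous_intros cont dcont t)
  qed
  have vW: "AE x in lborel. v t x = W t x" if "0 \<le> t" for t
    using eq[OF that] by eventually_elim (simp add: W_def F_def[abs_def])
  have Ws1: "W t \<in> sobolev_space (s - 1)" if t: "0 \<le> t" for t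
    by (rule sobolev_space_cong_AE[OF _ vW[OF t] vs1[OF t]])
      (simp add: Wcont[OF t] borel_measurable_continuous_onI)
  show ?thesis
  proof
    show "1 \<le> \<gamma>" "\<gamma> \<le> 4" by fact+
    show "(u t has_real_derivative deriv (u t) x) (at x)" if "0 \<le> t" for t x by (rule der[OF that])
    show "continuous_on UNIV (deriv (u t))" if "0 \<le> t" for t by (rule dcont[OF that])
    show "\<exists>M. \<forall>x. \<bar>u t x\<bar> \<le> M \<and> \<bar>deriv (u t) x\<bar> \<le> M" if "0 \<le> t" for t by (rule bounded[OF that])
  next
    fix t e :: real assume t: "0 \<le> t" and e: "0 < e"
    have "eventually (\<lambda>\<tau>. sobolev_norm s (\<lambda>x. u \<tau> x - u t x) < e / c) (at t within {0..})"
      using C0 t e c by (intro order_tendstoD(2)) (auto simp: C0_sobolev_def)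
    then obtain d where d: "d > 0" "\<And>\<tau>. 0 \<le> \<tau> \<Longrightarrow> \<tau> \<noteq> t \<Longrightarrow> \<bar>\<tau> - t\<bar> < d \<Longrightarrow> sobolev_norm s (\<lambda>x. u \<tau> x - u t x) < e / c"
      unfolding eventually_within_nonneg_iff by blast
    have "\<bar>u \<tau> x - u t x\<bar> < e \<and> \<bar>deriv (u \<tau>) x - deriv (u t) x\<bar> < e" if \<tau>: "0 \<le> \<tau>" "\<bar>\<tau> - t\<bar> < d" for \<tau> x
    proof (cases "\<tau> = t")
      case False
      have "c * sobolev_norm s (\<lambda>x. u \<tau> x - u t x) < c * (e / c)"
        using d(2)[OF \<tau>(1) False \<tau>(2)] c by (intro mult_strict_left_mono)
      then have lt: "c * sobolev_norm s (\<lambda>x. u \<tau> x - u t x) < e" using c by simp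
      have "deriv (\<lambda>x. u \<tau> x - u t x) x = deriv (u \<tau>) x - deriv (u t) x"
        by (intro DERIV_imp_deriv DERIV_diff der \<tau> t)
      then show ?thesis
        using sup[OF sobolev_space_diff[OF us[OF \<tau>(1)] us[OF t]] continuous_on_diff[OF cont[OF \<tau>(1)] cont[OF t]], of x] lt
        by auto
    qed (use e in simp)
    then show "\<exists>d>0. \<forall>\<tau>\<ge>0. \<bar>\<tau> - t\<bar> < d \<longrightarrow>
        (\<forall>x. \<bar>u \<tau> x - u t x\<bar> < e \<and> \<bar>deriv (u \<tau>) x - deriv (u t) x\<bar> < e)"
      using d(1) by blast
  next
    fix t e :: real assume t: "0 \<le> t" and e: "0 < e"
    have "eventually (\<lambda>\<tau>. sobolev_norm (s - 1) (\<lambda>x. (u \<tau> x - u t x) / (\<tau> - t) - v t x) < e / c) (at t within {0..})"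
      using Dt t e c by (intro order_tendstoD(2)) (auto simp: has_sobolev_time_derivative_def)
    then obtain d where d: "d > 0" "\<And>\<tau>. 0 \<le> \<tau> \<Longrightarrow> \<tau> \<noteq> t \<Longrightarrow> \<bar>\<tau> - t\<bar> < d \<Longrightarrow>
      sobolev_norm (s - 1) (\<lambda>x. (u \<tau> x - u t x) / (\<tau> - t) - v t x) < e / c"
      unfolding eventually_within_nonneg_iff by blast
    have "\<bar>u \<tau> x - u t x - (\<tau> - t) * W t x\<bar> \<le> e * \<bar>\<tau> - t\<bar>" if \<tau>: "0 \<le> \<tau>" "\<bar>\<tau> - t\<bar> < d" for \<tau> x
    proof (cases "\<tau> = t")
      case False
      \<comment> \<open>The difference quotient minus \<open>W t\<close>: almost everywhere equal to
        the function whose norm is small by assumption, hence of the same norm, but continuous.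
        Since \<open>s - 1 > 1/2\<close>, its norm controls it pointwise.\<close>
      define g where "g x = 1 / (\<tau> - t) * (u \<tau> x - u t x) - W t x" for x
      have gs: "g \<in> sobolev_space (s - 1)"
        unfolding g_def[abs_def] by (intro sobolev_space_diff sobolev_space_scale us1 Ws1 \<tau> t)
      have gc: "continuous_on UNIV g"
        unfolding g_def[abs_def] by (intro continuous_intros cont Wcont \<tau> t)
      have [measurable]: "u \<tau> \<in> borel_measurable lborel" "u t \<in> borel_measurable lborel"
        "v t \<in> borel_measurable lborel" "W t \<in> borel_measurable lborel"
        using us1[OF \<tau>(1)] us1[OF t] vs1[OF t] Ws1[OF t]
        by (auto simp: sobolev_space_def square_integrable_def)
      have "sobolev_norm (s - 1) (\<lambda>x. (u \<tau> x - u t x) / (\<tau> - t) - v t x) = sobolev_norm (s - 1) g"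
      proof (rule sobolev_norm_cong_AE)
        show "AE x in lborel. (u \<tau> x - u t x) / (\<tau> - t) - v t x = g x"
          using vW[OF t] by eventually_elim (simp add: g_def)
        show "(\<lambda>x. (u \<tau> x - u t x) / (\<tau> - t) - v t x) \<in> borel_measurable lborel" by measurable
        show "g \<in> borel_measurable lborel" using gc by (simp add: borel_measurable_continuous_onI)
      qed
      then have "c * sobolev_norm (s - 1) g < c * (e / c)"
        using d(2)[OF \<tau>(1) False \<tau>(2)] c by (intro mult_strict_left_mono) auto
      then have "c * sobolev_norm (s - 1) g < e" using c by simp
      then have "\<bar>g x\<bar> \<le> e"
        using sobolev_sup_bound[OF _ gs gc, of x] s mult_right_mono[OF c(3) norm0, of "s - 1" g] by linarith
      then have "\<bar>\<tau> - t\<bar> * \<bar>g x\<bar> \<le> \<bar>\<tau> - t\<bar> * e" by (intro mult_left_mono) auto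
      moreover have "u \<tau> x - u t x - (\<tau> - t) * W t x = (\<tau> - t) * g x"
        using False by (simp add: g_def right_diff_distrib)
      ultimately show ?thesis by (simp add: abs_mult mult.commute)
    qed simp
    then show "\<exists>d>0. \<forall>\<tau>\<ge>0. \<bar>\<tau> - t\<bar> < d \<longrightarrow> (\<forall>x.
        \<bar>u \<tau> x - u t x - (\<tau> - t) * (- \<gamma> * u t x * deriv (u t) x - deriv (convolution rod_kernel
            (\<lambda>y. (3 - \<gamma>) / 2 * (u t y)\<^sup>2 + \<gamma> / 2 * (deriv (u t) y)\<^sup>2)) x)\<bar> \<le> e * \<bar>\<tau> - t\<bar>)"
      using d(1) unfolding W_def F_def[abs_def] by blast
  qed
qed

section \<open>Growth of exponentially weighted slices and their sign\<close>

text \<open>Where \<open>v \<ge> 0\<close>, the derivative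
  \<open>exp (\<beta> * x) * (\<beta> * v + v')\<close> of the weighted function is nonnegative.
  Monotonicity in turn prevents \<open>v\<close> from coming down to 0, which closes the
  argument.\<close>

lemma exp_weight_growth_right:
  fixes v v' :: "real \<Rightarrow> real"
  assumes v: "\<And>x. (v has_real_derivative v' x) (at x)" and ge: "\<And>x. - \<beta> * \<bar>v x\<bar> \<le> v' x"
    and pos: "0 < v a" and ab: "a \<le> b"
  shows "exp (\<beta> * a) * v a \<le> exp (\<beta> * b) * v b"
proof -
  have cont: "continuous_on S v" for S by (rule continuous_on_of_real_derivative[OF v])
  have mono: "exp (\<beta> * a) * v a \<le> exp (\<beta> * c) * v c" if "a \<le> c" "\<And>x. x \<in> {a..c} \<Longrightarrow> 0 \<le> v x" for c
  proof (rule DERIV_nonneg_imp_nondecreasing[OF that(1)])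
    fix x assume x: "a \<le> x" "x \<le> c"
    have "((\<lambda>x. exp (\<beta> * x) * v x) has_real_derivative exp (\<beta> * x) * (\<beta> * v x + v' x)) (at x)"
      by (auto intro!: derivative_eq_intros v simp: algebra_simps)
    moreover have "0 \<le> exp (\<beta> * x) * (\<beta> * v x + v' x)" using ge[of x] that(2)[of x] x by simp
    ultimately show "\<exists>y. ((\<lambda>x. exp (\<beta> * x) * v x) has_real_derivative y) (at x) \<and> 0 \<le> y" by blast
  qed
  have "0 \<le> v x" if x: "x \<in> {a..b}" for x
  proof (rule ccontr)
    assume n: "\<not> 0 \<le> v x"
    \<comment> \<open>Its infimum \<open>z\<close> is the first point to the right of
      \<open>a\<close> where \<open>v \<le> 0\<close>. On \<open>{a..z}\<close> the function is
      nonnegative, so the weighted value at \<open>z\<close> would be at least the positive one at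
      \<open>a\<close>.\<close>
    define S where "S = {a..x} \<inter> {y. v y \<le> 0}"
    have "closed S" unfolding S_def
      by (intro closed_Int closed_atLeastAtMost closed_Collect_le cont continuous_on_const)
    moreover have xS: "x \<in> S" and bb: "bdd_below S" using x n by (auto simp: S_def intro: bdd_belowI[of _ a])
    ultimately have zS: "Inf S \<in> S" using closed_contains_Inf by blast
    define z where "z = Inf S"
    have z: "a \<le> z" "z \<le> x" "v z \<le> 0" using zS by (auto simp: S_def z_def)
    have before: "0 < v y" if "a \<le> y" "y < z" for y
    proof (rule ccontr)
      assume "\<not> 0 < v y"
      then have "y \<in> S" using that z by (auto simp: S_def)
      then show False using cInf_lower[OF _ bb] that by (force simp: z_def)
    qed
    have "eventually (\<lambda>y. 0 \<le> v y) (at_left z)"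
    proof -
      have "a < z" using pos z by (metis less_eq_real_def not_less)
      then show ?thesis using before by (auto simp: eventually_at_left intro!: exI[of _ a] less_imp_le)
    qed
    moreover have "(v \<longlongrightarrow> v z) (at_left z)"
      using cont[of UNIV] by (auto simp: continuous_on_def intro: tendsto_within_subset)
    ultimately have "0 \<le> v z" using tendsto_lowerbound trivial_limit_at_left_real by blast
    then have "\<And>y. y \<in> {a..z} \<Longrightarrow> 0 \<le> v y" using before by (force simp: less_eq_real_def)
    then have "exp (\<beta> * a) * v a \<le> exp (\<beta> * z) * v z" by (rule mono[OF z(1)])
    moreover have "exp (\<beta> * z) * v z \<le> 0" using z by (simp add: mult_le_0_iff)
    moreover have "0 < exp (\<beta> * a) * v a" using pos by simp
    ultimately show False by linarith
  qed
  then show ?thesis by (rule mono[OF ab])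
qed

text \<open>The map \<open>x\<close> to \<open>- v (- x)\<close> satisfies the same differential
  inequality and turns negative values to the left into positive values to the right.\<close>

lemma exp_weight_growth_left:
  fixes v v' :: "real \<Rightarrow> real"
  assumes v: "\<And>x. (v has_real_derivative v' x) (at x)" and ge: "\<And>x. - \<beta> * \<bar>v x\<bar> \<le> v' x"
    and neg: "v b < 0" and ab: "a \<le> b"
  shows "exp (- \<beta> * a) * v a \<le> exp (- \<beta> * b) * v b"
proof -
  have "exp (\<beta> * - b) * - v (- (- b)) \<le> exp (\<beta> * - a) * - v (- (- a))"
  proof (rule exp_weight_growth_right[where v = "\<lambda>x. - v (- x)" and v' = "\<lambda>x. v' (- x)"])
    show "((\<lambda>x. - v (- x)) has_real_derivative v' (- x)) (at x)" for x
      by (rule DERIV_cong[OF DERIV_minus[OF DERIV_chain2[where f = v and g = uminus, OF v]]])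
        (auto intro!: derivative_eq_intros)
  qed (use ge neg ab in auto)
  then show ?thesis by simp
qed

context classical_rod_solution
begin

lemma positive_right:
  assumes "0 \<le> t" "0 < u t a" "a \<le> b"
  shows "exp (rod_beta \<gamma> * a) * u t a \<le> exp (rod_beta \<gamma> * b) * u t b" and "0 < u t b"
proof -
  show *: "exp (rod_beta \<gamma> * a) * u t a \<le> exp (rod_beta \<gamma> * b) * u t b"
    by (rule exp_weight_growth_right[OF space_derivative no_wave_breaking]) (use assms in auto)
  have "0 < exp (rod_beta \<gamma> * a) * u t a" using assms by simp
  then have "0 < exp (rod_beta \<gamma> * b) * u t b" using * by linarith
  then show "0 < u t b" by (simp add: zero_less_mult_iff)
qed

lemma negative_left:
  assumes "0 \<le> t" "u t b < 0" "a \<le> b"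
  shows "exp (- rod_beta \<gamma> * a) * u t a \<le> exp (- rod_beta \<gamma> * b) * u t b" and "u t a < 0"
proof -
  show *: "exp (- rod_beta \<gamma> * a) * u t a \<le> exp (- rod_beta \<gamma> * b) * u t b"
    by (rule exp_weight_growth_left[OF space_derivative no_wave_breaking]) (use assms in auto)
  have "exp (- rod_beta \<gamma> * b) * u t b < 0" using assms by (simp add: mult_less_0_iff)
  then have "exp (- rod_beta \<gamma> * a) * u t a < 0" using * by linarith
  then show "u t a < 0" by (simp add: mult_less_0_iff)
qed

text \<open>Positivity spreads to the right and negativity to the left, so any zero, supplied by the
  intermediate value theorem, separates the signs. Between two zeros a positive value would spread
  to the right one and a negative value to the left one.\<close>

lemma sign_structure:
  assumes t: "0 \<le> t"
  shows "(\<forall>x. u t x > 0) \<or> (\<forall>x. u t x < 0) \<or>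
    (\<exists>z. (\<forall>x\<le>z. u t x \<le> 0) \<and> (\<forall>x\<ge>z. u t x \<ge> 0) \<and>
      (\<forall>a b. a < b \<and> u t a = 0 \<and> u t b = 0 \<longrightarrow> (\<forall>x\<in>{a..b}. u t x = 0)))"
proof (cases "(\<forall>x. u t x > 0) \<or> (\<forall>x. u t x < 0)")
  case False
  then obtain a b where ab: "u t a \<le> 0" "0 \<le> u t b" by (meson not_less)
  have "connected (range (u t))" by (intro connected_continuous_image continuous_u t connected_UNIV)
  then have "0 \<in> range (u t)" using ab unfolding connected_iff_interval by blast
  then obtain z where z: "u t z = 0" by (metis imageE)
  have "u t x \<le> 0" if "x \<le> z" for x using positive_right(2)[OF t _ that] z by force
  moreover have "u t x \<ge> 0" if "x \<ge> z" for x using negative_left(2)[OF t _ that] z by force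
  moreover have "u t x = 0" if "u t a = 0" "u t b = 0" "x \<in> {a..b}" for a b x
    using positive_right(2)[OF t, of x b] negative_left(2)[OF t, of x a] that by force
  ultimately show ?thesis by blast
qed blast

text \<open>To the right of a point where \<open>u t0 > 0\<close> the weighted function stays above
  its positive value there, so the lower limit would be positive; a negative value contradicts the
  upper limit in the same way.\<close>

lemma decay_imp_zero:
  assumes t0: "0 \<le> t0"
    and right: "Liminf at_top (\<lambda>x. ereal (exp (rod_beta \<gamma> * x) * u t0 x)) \<le> 0"
    and left: "Limsup at_bot (\<lambda>x. ereal (exp (- rod_beta \<gamma> * x) * u t0 x)) \<ge> 0"
    and t: "0 \<le> t"
  shows "u t x = 0"
proof (rule zero_propagates[OF t0 _ t])
  fix y
  have "\<not> 0 < u t0 y"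
  proof
    assume p: "0 < u t0 y"
    have "ereal (exp (rod_beta \<gamma> * y) * u t0 y) \<le> Liminf at_top (\<lambda>x. ereal (exp (rod_beta \<gamma> * x) * u t0 x))"
      by (rule Liminf_bounded) (use eventually_ge_at_top[of y] in \<open>eventually_elim, use positive_right(1)[OF t0 p] in auto\<close>)
    then have "ereal (exp (rod_beta \<gamma> * y) * u t0 y) \<le> 0" using right by (rule order_trans)
    then show False using p by (simp add: mult_le_0_iff)
  qed
  moreover have "\<not> u t0 y < 0"
  proof
    assume n: "u t0 y < 0"
    have "Limsup at_bot (\<lambda>x. ereal (exp (- rod_beta \<gamma> * x) * u t0 x)) \<le> ereal (exp (- rod_beta \<gamma> * y) * u t0 y)"
      by (rule Limsup_bounded) (use eventually_le_at_bot[of y] in \<open>eventually_elim, use negative_left(1)[OF t0 n] in auto\<close>)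
    then have "0 \<le> ereal (exp (- rod_beta \<gamma> * y) * u t0 y)" using left by (rule order_trans[rotated])
    then show False using n by (simp add: zero_le_mult_iff)
  qed
  ultimately show "u t0 y = 0" by simp
qed

end

section \<open>From data known almost everywhere to the continuous representative\<close>

lemma AE_lborel_witness:
  fixes a b :: real
  assumes "AE x in lborel. P x" "a < b"
  shows "\<exists>x\<in>{a<..<b}. P x"
proof (rule ccontr)
  assume "\<not> ?thesis"
  then have "AE x in lborel. x \<notin> {a<..<b}" using assms(1) by (auto elim: eventually_mono)
  moreover have "{x \<in> space lborel. \<not> x \<notin> {a<..<b}} = {a<..<b}" by auto
  ultimately have "emeasure lborel {a<..<b} = 0" by (subst (asm) AE_iff_measurable) auto
  then show False using assms(2) by simp
qed

text \<open>The decay is known for \<open>v0\<close>, the limit is wanted for \<open>v\<close>, and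
  they agree only almost everywhere. A positive lower limit would bound the weighted
  \<open>v\<close> away from 0 at all large \<open>x\<close>, so a single large point of agreement
  refutes it.\<close>

lemma Liminf_le_zero_of_small:
  fixes v v0 :: "real \<Rightarrow> real"
  assumes eq: "AE x in lborel. v x = v0 x" and small: "v0 \<in> o[at_infinity](\<lambda>x. exp (- \<beta> * \<bar>x\<bar>))"
  shows "Liminf at_top (\<lambda>x. ereal (exp (\<beta> * x) * v x)) \<le> 0"
proof (rule ccontr)
  assume "\<not> ?thesis"
  then have "0 < Liminf at_top (\<lambda>x. ereal (exp (\<beta> * x) * v x))" by (simp only: not_le)
  then obtain c where c: "0 < ereal c" "ereal c < Liminf at_top (\<lambda>x. ereal (exp (\<beta> * x) * v x))"
    using ereal_dense2 by blast
  then have "eventually (\<lambda>x. ereal c < ereal (exp (\<beta> * x) * v x)) at_top" by (intro less_LiminfD)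
  then obtain X where X: "\<And>x. X \<le> x \<Longrightarrow> c < exp (\<beta> * x) * v x"
    by (auto simp: eventually_at_top_linorder)
  have "eventually (\<lambda>x. norm (v0 x) \<le> c * norm (exp (- \<beta> * \<bar>x\<bar>))) at_infinity"
    using landau_o.smallD[OF small] c by simp
  then obtain Y where Y: "\<And>x. Y \<le> \<bar>x\<bar> \<Longrightarrow> \<bar>v0 x\<bar> \<le> c * exp (- \<beta> * \<bar>x\<bar>)"
    by (auto simp: eventually_at_infinity)
  \<comment> \<open>Beyond both thresholds, and nonnegative so that \<open>\<bar>x\<bar> = x\<close>
    and the two exponential weights cancel.\<close>
  define Z where "Z = max (max X Y) 0"
  obtain x where x: "x \<in> {Z<..<Z+1}" "v x = v0 x"
    using AE_lborel_witness[OF eq, of Z "Z + 1"] by auto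
  have "exp (\<beta> * x) * v x \<le> exp (\<beta> * x) * (c * exp (- \<beta> * \<bar>x\<bar>))"
    using Y[of x] x by (intro mult_left_mono) (auto simp: Z_def)
  also have "\<dots> = c" using x by (simp add: Z_def exp_minus)
  finally show False using X[of x] x by (simp add: Z_def)
qed

lemma Limsup_ge_zero_of_small:
  fixes v v0 :: "real \<Rightarrow> real"
  assumes eq: "AE x in lborel. v x = v0 x" and small: "v0 \<in> o[at_infinity](\<lambda>x. exp (- \<beta> * \<bar>x\<bar>))"
  shows "Limsup at_bot (\<lambda>x. ereal (exp (- \<beta> * x) * v x)) \<ge> 0"
proof (rule ccontr)
  assume "\<not> ?thesis"
  then have "Limsup at_bot (\<lambda>x. ereal (exp (- \<beta> * x) * v x)) < 0" by (simp only: not_le)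
  then obtain c where c: "ereal c < 0" "Limsup at_bot (\<lambda>x. ereal (exp (- \<beta> * x) * v x)) < ereal c"
    using ereal_dense2 by blast
  then have "eventually (\<lambda>x. ereal (exp (- \<beta> * x) * v x) < ereal c) at_bot" by (intro Limsup_lessD)
  then obtain X where X: "\<And>x. x \<le> X \<Longrightarrow> exp (- \<beta> * x) * v x < c"
    by (auto simp: eventually_at_bot_linorder)
  have "eventually (\<lambda>x. norm (v0 x) \<le> - c * norm (exp (- \<beta> * \<bar>x\<bar>))) at_infinity"
    using landau_o.smallD[OF small, of "- c"] c by simp
  then obtain Y where Y: "\<And>x. Y \<le> \<bar>x\<bar> \<Longrightarrow> \<bar>v0 x\<bar> \<le> - c * exp (- \<beta> * \<bar>x\<bar>)"
    by (auto simp: eventually_at_infinity)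
  define Z where "Z = min (min X (- Y)) 0"
  obtain x where x: "x \<in> {Z-1<..<Z}" "v x = v0 x"
    using AE_lborel_witness[OF eq, of "Z - 1" Z] by auto
  have "c = exp (- \<beta> * x) * (c * exp (- \<beta> * \<bar>x\<bar>))"
    using x by (simp add: Z_def exp_minus)
  also have "\<dots> \<le> exp (- \<beta> * x) * v x"
    using Y[of x] x by (intro mult_left_mono) (auto simp: Z_def)
  finally show False using X[of x] x by (simp add: Z_def)
qed

theorem corollary7p1:
  fixes \<gamma> s :: real
  assumes "1 \<le> \<gamma>" and "\<gamma> \<le> 4" and "s > 3 / 2"
  shows
    "(\<forall>u. rod_solution \<gamma> s \<infinity> u \<longrightarrow>
        (\<forall>t\<ge>0.
          (\<forall>x. u t x > 0) \<or>
          (\<forall>x. u t x < 0) \<or>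
          (\<exists>x\<^sub>t. (\<forall>x\<le>x\<^sub>t. u t x \<le> 0) \<and> (\<forall>x\<ge>x\<^sub>t. u t x \<ge> 0) \<and>
            (\<forall>a b. a < b \<and> u t a = 0 \<and> u t b = 0 \<longrightarrow> (\<forall>x\<in>{a..b}. u t x = 0)))) \<and>
        (\<forall>t\<^sub>0\<ge>0.
          Liminf at_top (\<lambda>x. ereal (exp (rod_beta \<gamma> * x) * u t\<^sub>0 x)) \<le> 0 \<and>
          Limsup at_bot (\<lambda>x. ereal (exp (- rod_beta \<gamma> * x) * u t\<^sub>0 x)) \<ge> 0 \<longrightarrow>
          (\<forall>t\<ge>0. \<forall>x. u t x = 0))) \<and>
     (\<forall>u\<^sub>0 T u.
        u\<^sub>0 \<in> sobolev_space s \<and> \<not> (AE x in lborel. u\<^sub>0 x = 0) \<and>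
        u\<^sub>0 \<in> o[at_infinity](\<lambda>x. exp (- rod_beta \<gamma> * \<bar>x\<bar>)) \<and>
        rod_maximal_solution \<gamma> s u\<^sub>0 T u \<longrightarrow> T < \<infinity>)"
proof (intro conjI allI impI)
  fix u :: "real \<Rightarrow> real \<Rightarrow> real" and t :: real
  assume "rod_solution \<gamma> s \<infinity> u" and t: "0 \<le> t"
  then interpret classical_rod_solution \<gamma> u "\<lambda>t. deriv (u t)"
    using assms by (intro classical_rod_solution_of_rod_solution)
  show "(\<forall>x. u t x > 0) \<or> (\<forall>x. u t x < 0) \<or>
      (\<exists>x\<^sub>t. (\<forall>x\<le>x\<^sub>t. u t x \<le> 0) \<and> (\<forall>x\<ge>x\<^sub>t. u t x \<ge> 0) \<and>
        (\<forall>a b. a < b \<and> u t a = 0 \<and> u t b = 0 \<longrightarrow> (\<forall>x\<in>{a..b}. u t x = 0)))"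
    by (rule sign_structure[OF t])
next
  fix u :: "real \<Rightarrow> real \<Rightarrow> real" and t\<^sub>0 t x :: real
  assume "rod_solution \<gamma> s \<infinity> u" and t0: "0 \<le> t\<^sub>0"
    and decay: "Liminf at_top (\<lambda>x. ereal (exp (rod_beta \<gamma> * x) * u t\<^sub>0 x)) \<le> 0 \<and>
      Limsup at_bot (\<lambda>x. ereal (exp (- rod_beta \<gamma> * x) * u t\<^sub>0 x)) \<ge> 0" and t: "0 \<le> t"
  then interpret classical_rod_solution \<gamma> u "\<lambda>t. deriv (u t)"
    using assms by (intro classical_rod_solution_of_rod_solution)
  show "u t x = 0" using decay_imp_zero[OF t0 _ _ t] decay by blast
next
  fix u\<^sub>0 :: "real \<Rightarrow> real" and T :: ereal and u :: "real \<Rightarrow> real \<Rightarrow> real"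
  assume *: "u\<^sub>0 \<in> sobolev_space s \<and> \<not> (AE x in lborel. u\<^sub>0 x = 0) \<and>
    u\<^sub>0 \<in> o[at_infinity](\<lambda>x. exp (- rod_beta \<gamma> * \<bar>x\<bar>)) \<and> rod_maximal_solution \<gamma> s u\<^sub>0 T u"
  show "T < \<infinity>"
  proof (rule ccontr)
    assume "\<not> T < \<infinity>"
    then have sol: "rod_solution \<gamma> s \<infinity> u" and eq: "AE x in lborel. u 0 x = u\<^sub>0 x"
      using * by (auto simp: rod_maximal_solution_def)
    interpret classical_rod_solution \<gamma> u "\<lambda>t. deriv (u t)"
      using assms sol by (intro classical_rod_solution_of_rod_solution)
    have "u 0 x = 0" for x
      using decay_imp_zero[OF _ Liminf_le_zero_of_small[OF eq] Limsup_ge_zero_of_small[OF eq]] * by simp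
    then show False using eq * by simp
  qed
qed

end
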